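(* Let $\mathcal{C}$ be a regular virtual holonomic constraint (VHC) of order $m$ for the Lagrangian control system $(\mathcal{Q},g,P,\{F^1,\dots,F^m\})$. Then the constrained dynamics $$\nabla^{\mathcal{C}}_{\dot q}\,\dot q=-\sigma_q\big(\operatorname{grad}P(q)\big)$$ on $T\mathcal{C}$ are Lagrangian if and only if the following two conditions hold: (i) the induced connection $\nabla^{\mathcal{C}}$ is metrizable, i.e. there exists a Riemannian metric $g_{\mathcal{C}}$ on $\mathcal{C}$ such that $\nabla^{\mathcal{C}}$ is the Riemannian (Levi-Civita) connection of $g_{\mathcal{C}}$; and (ii) for such a metric $g_{\mathcal{C}}$ as in (i) (the two conditions being required to hold with a common metric), there exists a smooth function $P_{\mathcal{C}}:\mathcal{C}\to\mathbb{R}$ such that $\sigma(\operatorname{grad}P)=\operatorname{grad}_{\mathcal{C}}P_{\mathcal{C}}$ on $\mathcal{C}$, where $\operatorname{grad}_{\mathcal{C}}P_{\mathcal{C}}$ is the gradient vector field of $P_{\mathcal{C}}$ with respect to $g_{\mathcal{C}}$, i.e. $dP_{\mathcal{C}}(v_q)=g_{\mathcal{C}}(\operatorname{grad}_{\mathcal{C}}P_{\mathcal{C}},v_q)$ for all $v_q\in T\mathcal{C}$. Moreover, if (i) and (ii) hold, the Lagrangian structure of the constrained dynamics is $(\mathcal{C},g_{\mathcal{C}},P_{\mathcal{C}})$.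
   Context: All manifolds, maps, vector fields and forms are smooth. A Lagrangian control system $(\mathcal{Q},g,P,\{F^1,\dots,F^m\})$ consists of an $n$-dimensional Riemannian manifold $(\mathcal{Q},g)$ with Levi-Civita connection $\nabla$, a smooth potential $P:\mathcal{Q}\to\mathbb{R}$, and one-forms $F^1,\dots,F^m$ on $\mathcal{Q}$, assumed linearly independent at every point. $(F^i)^\sharp$ is the vector field with $F^i(X)=g((F^i)^\sharp,X)$ for all $X$, and $\operatorname{grad}P=(dP)^\sharp$. The equation of motion is $\nabla_{\dot q}\dot q=-\operatorname{grad}P(q)+\sum_{i=1}^m(F^i)^\sharp_q\,\tau_i$, with control inputs $\tau_i\in\mathbb{R}$. The acceleration distribution is $\mathcal{D}_A=\operatorname{span}\{(F^1)^\sharp,\dots,(F^m)^\sharp\}$. A regular VHC of order $m$ is a closed embedded submanifold $\mathcal{C}\subset\mathcal{Q}$ of codimension $m$ with $T_q\mathcal{C}\oplus\mathcal{D}_A(q)=T_q\mathcal{Q}$ for all $q\in\mathcal{C}$. For $q\in\mathcal{C}$, $\sigma_q:T_q\mathcal{Q}\to T_q\mathcal{C}$ is the linear projection onto $T_q\mathcal{C}$ along $\mathcal{D}_A(q)$; together these define a smooth vector bundle map $\sigma:T\mathcal{Q}|_{\mathcal{C}}\to T\mathcal{C}$. The induced connection on $\mathcal{C}$ is $\nabla^{\mathcal{C}}_XY:=\sigma(\nabla_XY)$ for vector fields $X,Y$ on $\mathcal{C}$, where $\nabla_XY$ on $\mathcal{C}$ is computed with arbitrary smooth local extensions of $X,Y$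 to $\mathcal{Q}$ (the result does not depend on the extensions); $\nabla^{\mathcal{C}}$ is a symmetric (torsion-free) affine connection on $\mathcal{C}$. A Lagrangian system (or Lagrangian structure) on $\mathcal{C}$ is a triple $(\mathcal{C},g_{\mathcal{C}},P_{\mathcal{C}})$ with $g_{\mathcal{C}}$ a Riemannian metric on $\mathcal{C}$ and $P_{\mathcal{C}}:\mathcal{C}\to\mathbb{R}$ smooth; its base integral curves are the smooth curves $q:I\to\mathcal{C}$ ($I$ an open interval) with $\bar\nabla_{\dot q}\dot q=-\operatorname{grad}_{\mathcal{C}}P_{\mathcal{C}}(q)$, where $\bar\nabla$ is the Levi-Civita connection of $g_{\mathcal{C}}$ and $\operatorname{grad}_{\mathcal{C}}$ is the gradient with respect to $g_{\mathcal{C}}$. The constrained dynamics are Lagrangian, with Lagrangian structure $(\mathcal{C},g_{\mathcal{C}},P_{\mathcal{C}})$, if they are generated by such a triple: a smooth curve $q:I\to\mathcal{C}$ satisfies $\nabla^{\mathcal{C}}_{\dot q}\dot q=-\sigma_q(\operatorname{grad}P(q))$ if and only if it is a base integral curve of $(\mathcal{C},g_{\mathcal{C}},P_{\mathcal{C}})$. *)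

theory Defs
  imports "HOL-Analysis.Analysis" "HOL-Library.Function_Algebras"
begin

section \<open>Smooth maps between subsets of Euclidean spaces\<close>

text \<open>The sets \<open>S\<close> of interest are relatively open in a linear subspace \<open>E\<close>.  There the derivative
  within \<open>S\<close> is unique on the directions in \<open>E\<close> and unconstrained on a complement of \<open>E\<close>; since
  \<open>f'\<close> is existentially quantified, the predicate is exactly \<open>C\<^sup>k\<close> on the open subset \<open>S\<close> of \<open>E\<close>.\<close>

primrec C_k_on :: "nat \<Rightarrow> 'a::real_normed_vector set \<Rightarrow> ('a \<Rightarrow> 'b::real_normed_vector) \<Rightarrow> bool" where
  "C_k_on 0 S f \<longleftrightarrow> continuous_on S f"
| "C_k_on (Suc k) S f \<longleftrightarrow>
     (\<exists>f'. (\<forall>x\<in>S. (f has_derivative f' x) (at x within S)) \<and> (\<forall>u. C_k_on k S (\<lambda>x. f' x u)))"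

definition smooth_on :: "'a::real_normed_vector set \<Rightarrow> ('a \<Rightarrow> 'b::real_normed_vector) \<Rightarrow> bool" where
  "smooth_on S f \<longleftrightarrow> (\<forall>k. C_k_on k S f)"


section \<open>Pointwise vector space structure on functions\<close>

instantiation "fun" :: (type, real_vector) real_vector
begin

definition scaleR_fun :: "real \<Rightarrow> ('a \<Rightarrow> 'b) \<Rightarrow> 'a \<Rightarrow> 'b" where
  "scaleR_fun r f = (\<lambda>x. r *\<^sub>R f x)"

instance
  by standard (auto simp: scaleR_fun_def fun_eq_iff scaleR_add_right scaleR_add_left)

end


section \<open>Smooth manifolds\<close>

text \<open>A chart is a domain together with a coordinate map (only its values on the domain matter).
  A \<open>k\<close>-dimensional chart takes values in an open subset of a \<open>k\<close>-dimensional linear subspace of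
  the ambient Euclidean space \<open>'e\<close>, a copy of \<open>k\<close>-dimensional real space.  Allowing proper subspaces
  gives manifolds of all dimensions, including \<open>0\<close>, and makes the restriction of a slice chart to
  a submanifold a chart.  The subspace is the span of the chart image, because a nonempty relatively
  open subset of a linear subspace spans it.\<close>

type_synonym ('q, 'e) chart = "'q set \<times> ('q \<Rightarrow> 'e)"

abbreviation chart_dom :: "('q, 'e) chart \<Rightarrow> 'q set" where
  "chart_dom c \<equiv> fst c"

abbreviation chart_map :: "('q, 'e) chart \<Rightarrow> 'q \<Rightarrow> 'e" where
  "chart_map c \<equiv> snd c"

definition chart_inv :: "('q, 'e) chart \<Rightarrow> 'e \<Rightarrow> 'q" where
  "chart_inv c = inv_into (chart_dom c) (chart_map c)"

definition model :: "('q, 'e::euclidean_space) chart \<Rightarrow> 'e set" where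
  "model c = span (chart_map c ` chart_dom c)"

definition chart_on :: "nat \<Rightarrow> 'q::topological_space set \<Rightarrow> ('q, 'e::euclidean_space) chart \<Rightarrow> bool" where
  "chart_on k M c \<longleftrightarrow>
     openin (top_of_set M) (chart_dom c) \<and>
     dim (model c) = k \<and>
     openin (top_of_set (model c)) (chart_map c ` chart_dom c) \<and>
     homeomorphism (chart_dom c) (chart_map c ` chart_dom c) (chart_map c) (chart_inv c)"

definition transition :: "('q, 'e) chart \<Rightarrow> ('q, 'e) chart \<Rightarrow> 'e \<Rightarrow> 'e" where
  "transition c d = chart_map d \<circ> chart_inv c"

definition smoothly_compatible :: "('q, 'e::euclidean_space) chart \<Rightarrow> ('q, 'e) chart \<Rightarrow> bool" where
  "smoothly_compatible c d \<longleftrightarrow>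
     smooth_on (chart_map c ` (chart_dom c \<inter> chart_dom d)) (transition c d) \<and>
     smooth_on (chart_map d ` (chart_dom c \<inter> chart_dom d)) (transition d c)"

definition smooth_atlas ::
  "nat \<Rightarrow> 'q::topological_space set \<Rightarrow> ('q, 'e::euclidean_space) chart set \<Rightarrow> bool" where
  "smooth_atlas k M A \<longleftrightarrow>
     (\<forall>c\<in>A. chart_on k M c) \<and> (\<Union>c\<in>A. chart_dom c) = M \<and>
     (\<forall>c\<in>A. \<forall>d\<in>A. smoothly_compatible c d)"

text \<open>\<open>A\<close> is a maximal atlas of the \<open>k\<close>-dimensional manifold \<open>M\<close>.  The Hausdorff property and second
  countability come from the type class of the points.  Maximality is needed only to have all slice charts of
  submanifolds available; tangent vectors, fields, metrics and connections make sense, and mean the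
  same, for any atlas generating the smooth structure.\<close>

definition smooth_manifold ::
  "nat \<Rightarrow> 'q::{t2_space, second_countable_topology} set \<Rightarrow> ('q, 'e::euclidean_space) chart set \<Rightarrow> bool" where
  "smooth_manifold k M A \<longleftrightarrow>
     smooth_atlas k M A \<and>
     (\<forall>c. chart_on k M c \<and> (\<forall>d\<in>A. smoothly_compatible c d) \<longrightarrow> c \<in> A)"

definition chart_at :: "('q, 'e) chart set \<Rightarrow> 'q \<Rightarrow> ('q, 'e) chart" where
  "chart_at A p = (SOME c. c \<in> A \<and> p \<in> chart_dom c)"

definition smooth_fun ::
  "('q, 'e::euclidean_space) chart set \<Rightarrow> 'q set \<Rightarrow> ('q \<Rightarrow> real) \<Rightarrow> bool" where
  "smooth_fun A W f \<longleftrightarrow>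
     (\<forall>c\<in>A. smooth_on (chart_map c ` (chart_dom c \<inter> W)) (f \<circ> chart_inv c))"


section \<open>Tangent vectors\<close>

text \<open>A tangent vector at \<open>p\<close> is the family of its coordinate representatives in the charts around
  \<open>p\<close>, related by the derivatives of the transition maps; the components at all other indices are
  \<open>0\<close>, so that a tangent space is a linear subspace of the type of families.\<close>

type_synonym ('q, 'e) tvec = "('q, 'e) chart \<Rightarrow> 'e"

definition tangent_space ::
  "('q, 'e::euclidean_space) chart set \<Rightarrow> 'q \<Rightarrow> ('q, 'e) tvec set" where
  "tangent_space A p = {v.
     (\<forall>c. \<not> (c \<in> A \<and> p \<in> chart_dom c) \<longrightarrow> v c = 0) \<and>
     (\<forall>c\<in>A. p \<in> chart_dom c \<longrightarrow> v c \<in> model c) \<and>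
     (\<forall>c\<in>A. \<forall>d\<in>A. p \<in> chart_dom c \<inter> chart_dom d \<longrightarrow>
        v d = frechet_derivative (transition c d)
                (at (chart_map c p) within chart_map c ` (chart_dom c \<inter> chart_dom d)) (v c))}"

definition smooth_vector_field ::
  "('q, 'e::euclidean_space) chart set \<Rightarrow> 'q set \<Rightarrow> ('q \<Rightarrow> ('q, 'e) tvec) \<Rightarrow> bool" where
  "smooth_vector_field A W X \<longleftrightarrow>
     (\<forall>p\<in>W. X p \<in> tangent_space A p) \<and>
     (\<forall>c\<in>A. smooth_on (chart_map c ` (chart_dom c \<inter> W)) (\<lambda>x. X (chart_inv c x) c))"

text \<open>\<open>dfun A f p v\<close> is \<open>df\<^sub>p(v)\<close>.\<close>

definition dfun ::
  "('q, 'e::euclidean_space) chart set \<Rightarrow> ('q \<Rightarrow> real) \<Rightarrow> 'q \<Rightarrow> ('q, 'e) tvec \<Rightarrow> real" where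
  "dfun A f p v =
     (let c = chart_at A p in
      frechet_derivative (f \<circ> chart_inv c)
        (at (chart_map c p) within chart_map c ` chart_dom c) (v c))"

text \<open>The differential at \<open>p\<close> of a map \<open>\<Phi>\<close> between manifolds with atlases \<open>A\<close> and \<open>B\<close>.\<close>

definition differential ::
  "('p, 'e::euclidean_space) chart set \<Rightarrow> ('q, 'f::euclidean_space) chart set \<Rightarrow> ('p \<Rightarrow> 'q) \<Rightarrow>
   'p \<Rightarrow> ('p, 'e) tvec \<Rightarrow> ('q, 'f) tvec" where
  "differential A B \<Phi> p v = (\<lambda>d.
     if d \<in> B \<and> \<Phi> p \<in> chart_dom d
     then (let c = chart_at A p in
           frechet_derivative (chart_map d \<circ> \<Phi> \<circ> chart_inv c)
             (at (chart_map c p) within chart_map c ` {x \<in> chart_dom c. \<Phi> x \<in> chart_dom d}) (v c))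
     else 0)"

text \<open>The coordinate vector field on the domain of \<open>c\<close> with constant representative \<open>u\<close> in \<open>c\<close>.\<close>

definition coord_field ::
  "('q, 'e::euclidean_space) chart set \<Rightarrow> ('q, 'e) chart \<Rightarrow> 'e \<Rightarrow> 'q \<Rightarrow> ('q, 'e) tvec" where
  "coord_field A c u p = (\<lambda>d.
     if d \<in> A \<and> p \<in> chart_dom c \<inter> chart_dom d
     then frechet_derivative (transition c d)
            (at (chart_map c p) within chart_map c ` (chart_dom c \<inter> chart_dom d)) u
     else 0)"

text \<open>In every chart \<open>[X,Y] = DY(X) - DX(Y)\<close>.\<close>

definition lie_bracket ::
  "('q, 'e::euclidean_space) chart set \<Rightarrow> ('q \<Rightarrow> ('q, 'e) tvec) \<Rightarrow> ('q \<Rightarrow> ('q, 'e) tvec) \<Rightarrow>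
   'q \<Rightarrow> ('q, 'e) tvec" where
  "lie_bracket A X Y p = (\<lambda>c.
     if c \<in> A \<and> p \<in> chart_dom c
     then frechet_derivative (\<lambda>x. Y (chart_inv c x) c)
            (at (chart_map c p) within chart_map c ` chart_dom c) (X p c)
        - frechet_derivative (\<lambda>x. X (chart_inv c x) c)
            (at (chart_map c p) within chart_map c ` chart_dom c) (Y p c)
     else 0)"


section \<open>Riemannian metrics and one-forms\<close>

definition linear_functional_on :: "'v::real_vector set \<Rightarrow> ('v \<Rightarrow> real) \<Rightarrow> bool" where
  "linear_functional_on T \<omega> \<longleftrightarrow>
     (\<forall>v\<in>T. \<forall>w\<in>T. \<forall>a b. \<omega> (a *\<^sub>R v + b *\<^sub>R w) = a * \<omega> v + b * \<omega> w)"

definition smooth_one_form ::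
  "'q::topological_space set \<Rightarrow> ('q, 'e::euclidean_space) chart set \<Rightarrow>
   ('q \<Rightarrow> ('q, 'e) tvec \<Rightarrow> real) \<Rightarrow> bool" where
  "smooth_one_form M A \<omega> \<longleftrightarrow>
     (\<forall>p\<in>M. linear_functional_on (tangent_space A p) (\<omega> p)) \<and>
     (\<forall>W X. openin (top_of_set M) W \<and> smooth_vector_field A W X \<longrightarrow>
        smooth_fun A W (\<lambda>p. \<omega> p (X p)))"

definition riemannian_metric ::
  "'q::topological_space set \<Rightarrow> ('q, 'e::euclidean_space) chart set \<Rightarrow>
   ('q \<Rightarrow> ('q, 'e) tvec \<Rightarrow> ('q, 'e) tvec \<Rightarrow> real) \<Rightarrow> bool" where
  "riemannian_metric M A g \<longleftrightarrow>
     (\<forall>p\<in>M. \<forall>v\<in>tangent_space A p.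
        linear_functional_on (tangent_space A p) (g p v) \<and>
        (\<forall>w\<in>tangent_space A p. g p v w = g p w v) \<and>
        (v \<noteq> 0 \<longrightarrow> g p v v > 0)) \<and>
     (\<forall>W X Y. openin (top_of_set M) W \<and> smooth_vector_field A W X \<and> smooth_vector_field A W Y \<longrightarrow>
        smooth_fun A W (\<lambda>p. g p (X p) (Y p)))"

text \<open>\<open>sharp A g p \<omega>\<close> is the tangent vector at \<open>p\<close> representing the covector \<open>\<omega>\<close> at \<open>p\<close>.\<close>

definition sharp ::
  "('q, 'e::euclidean_space) chart set \<Rightarrow> ('q \<Rightarrow> ('q, 'e) tvec \<Rightarrow> ('q, 'e) tvec \<Rightarrow> real) \<Rightarrow>
   'q \<Rightarrow> (('q, 'e) tvec \<Rightarrow> real) \<Rightarrow> ('q, 'e) tvec" where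
  "sharp A g p \<omega> = (THE w. w \<in> tangent_space A p \<and> (\<forall>v\<in>tangent_space A p. \<omega> v = g p w v))"

definition grad ::
  "('q, 'e::euclidean_space) chart set \<Rightarrow> ('q \<Rightarrow> ('q, 'e) tvec \<Rightarrow> ('q, 'e) tvec \<Rightarrow> real) \<Rightarrow>
   ('q \<Rightarrow> real) \<Rightarrow> 'q \<Rightarrow> ('q, 'e) tvec" where
  "grad A g P p = sharp A g p (dfun A P p)"


section \<open>Affine connections\<close>

text \<open>A connection is given as the operator \<open>(p, v, Y) \<mapsto> \<nabla>\<^sub>v Y\<close> for \<open>v\<close> tangent at \<open>p\<close> and \<open>Y\<close> a smooth
  vector field on some open neighbourhood of \<open>p\<close>; \<open>\<nabla>\<^sub>X Y\<close> is \<open>p \<mapsto> \<nabla>\<^bsub>X p\<^esub> Y\<close>.  Its values on other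
  arguments are irrelevant.\<close>

type_synonym ('q, 'e) conn = "'q \<Rightarrow> ('q, 'e) tvec \<Rightarrow> ('q \<Rightarrow> ('q, 'e) tvec) \<Rightarrow> ('q, 'e) tvec"

definition affine_connection ::
  "'q::topological_space set \<Rightarrow> ('q, 'e::euclidean_space) chart set \<Rightarrow> ('q, 'e) conn \<Rightarrow> bool" where
  "affine_connection M A D \<longleftrightarrow>
     (\<forall>W Y. openin (top_of_set M) W \<and> smooth_vector_field A W Y \<longrightarrow>
        (\<forall>p\<in>W. \<forall>v\<in>tangent_space A p.
           D p v Y \<in> tangent_space A p \<and>
           (\<forall>w\<in>tangent_space A p. \<forall>a b. D p (a *\<^sub>R v + b *\<^sub>R w) Y = a *\<^sub>R D p v Y + b *\<^sub>R D p w Y) \<and>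
           (\<forall>Z. smooth_vector_field A W Z \<longrightarrow>
              D p v (\<lambda>x. Y x + Z x) = D p v Y + D p v Z \<and>
              ((\<forall>x\<in>W. Y x = Z x) \<longrightarrow> D p v Y = D p v Z)) \<and>
           (\<forall>f. smooth_fun A W f \<longrightarrow>
              D p v (\<lambda>x. f x *\<^sub>R Y x) = dfun A f p v *\<^sub>R Y p + f p *\<^sub>R D p v Y)) \<and>
        (\<forall>X. smooth_vector_field A W X \<longrightarrow> smooth_vector_field A W (\<lambda>p. D p (X p) Y)))"

definition torsion_free ::
  "'q::topological_space set \<Rightarrow> ('q, 'e::euclidean_space) chart set \<Rightarrow> ('q, 'e) conn \<Rightarrow> bool" where
  "torsion_free M A D \<longleftrightarrow>
     (\<forall>W X Y. openin (top_of_set M) W \<and> smooth_vector_field A W X \<and> smooth_vector_field A W Y \<longrightarrow>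
        (\<forall>p\<in>W. D p (X p) Y - D p (Y p) X = lie_bracket A X Y p))"

definition metric_compatible ::
  "'q::topological_space set \<Rightarrow> ('q, 'e::euclidean_space) chart set \<Rightarrow>
   ('q \<Rightarrow> ('q, 'e) tvec \<Rightarrow> ('q, 'e) tvec \<Rightarrow> real) \<Rightarrow> ('q, 'e) conn \<Rightarrow> bool" where
  "metric_compatible M A g D \<longleftrightarrow>
     (\<forall>W Y Z. openin (top_of_set M) W \<and> smooth_vector_field A W Y \<and> smooth_vector_field A W Z \<longrightarrow>
        (\<forall>p\<in>W. \<forall>v\<in>tangent_space A p.
           dfun A (\<lambda>x. g x (Y x) (Z x)) p v = g p (D p v Y) (Z p) + g p (Y p) (D p v Z)))"

definition levi_civita ::
  "'q::topological_space set \<Rightarrow> ('q, 'e::euclidean_space) chart set \<Rightarrow>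
   ('q \<Rightarrow> ('q, 'e) tvec \<Rightarrow> ('q, 'e) tvec \<Rightarrow> real) \<Rightarrow> ('q, 'e) conn \<Rightarrow> bool" where
  "levi_civita M A g D \<longleftrightarrow>
     affine_connection M A D \<and> torsion_free M A D \<and> metric_compatible M A g D"


section \<open>Curves and Lagrangian systems\<close>

definition open_interval :: "real set \<Rightarrow> bool" where
  "open_interval I \<longleftrightarrow> open I \<and> is_interval I \<and> I \<noteq> {}"

definition smooth_curve ::
  "'q::topological_space set \<Rightarrow> ('q, 'e::euclidean_space) chart set \<Rightarrow> real set \<Rightarrow> (real \<Rightarrow> 'q) \<Rightarrow> bool" where
  "smooth_curve M A I q \<longleftrightarrow>
     q ` I \<subseteq> M \<and> continuous_on I q \<and>
     (\<forall>c\<in>A. smooth_on {t \<in> I. q t \<in> chart_dom c} (chart_map c \<circ> q))"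

definition velocity ::
  "('q, 'e::euclidean_space) chart set \<Rightarrow> (real \<Rightarrow> 'q) \<Rightarrow> real \<Rightarrow> ('q, 'e) tvec" where
  "velocity A q t = (\<lambda>c.
     if c \<in> A \<and> q t \<in> chart_dom c then vector_derivative (chart_map c \<circ> q) (at t) else 0)"

text \<open>The covariant derivative of the velocity along \<open>q\<close>: in a chart with Christoffel symbols
  \<open>\<Gamma>\<close> it is \<open>q'' + \<Gamma>(q', q')\<close>, where \<open>\<Gamma>(u, w)\<close> represents \<open>\<nabla>\<^sub>u\<close> of the coordinate field \<open>w\<close>.\<close>

definition covariant_acceleration ::
  "('q, 'e::euclidean_space) chart set \<Rightarrow> ('q, 'e) conn \<Rightarrow> (real \<Rightarrow> 'q) \<Rightarrow> real \<Rightarrow> ('q, 'e) tvec" where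
  "covariant_acceleration A D q t = (\<lambda>c.
     if c \<in> A \<and> q t \<in> chart_dom c
     then vector_derivative (\<lambda>s. vector_derivative (chart_map c \<circ> q) (at s)) (at t)
        + D (q t) (velocity A q t) (coord_field A c (velocity A q t c)) c
     else 0)"

text \<open>Base integral curves of the Lagrangian system \<open>(M, g, P)\<close>; \<open>D\<close> is the Levi-Civita connection of
  \<open>g\<close>, which exists and is unique up to its values on irrelevant arguments.\<close>

definition base_integral_curve ::
  "'q::topological_space set \<Rightarrow> ('q, 'e::euclidean_space) chart set \<Rightarrow>
   ('q \<Rightarrow> ('q, 'e) tvec \<Rightarrow> ('q, 'e) tvec \<Rightarrow> real) \<Rightarrow> ('q \<Rightarrow> real) \<Rightarrow>
   real set \<Rightarrow> (real \<Rightarrow> 'q) \<Rightarrow> bool" where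
  "base_integral_curve M A g P I q \<longleftrightarrow>
     smooth_curve M A I q \<and>
     (\<exists>D. levi_civita M A g D \<and> (\<forall>t\<in>I. covariant_acceleration A D q t = - grad A g P (q t)))"


section \<open>Lagrangian control systems and virtual holonomic constraints\<close>

definition lagrangian_control_system ::
  "nat \<Rightarrow> 'q::{t2_space, second_countable_topology} set \<Rightarrow> ('q, 'e::euclidean_space) chart set \<Rightarrow>
   ('q \<Rightarrow> ('q, 'e) tvec \<Rightarrow> ('q, 'e) tvec \<Rightarrow> real) \<Rightarrow> ('q, 'e) conn \<Rightarrow> ('q \<Rightarrow> real) \<Rightarrow>
   nat \<Rightarrow> (nat \<Rightarrow> 'q \<Rightarrow> ('q, 'e) tvec \<Rightarrow> real) \<Rightarrow> bool" where
  "lagrangian_control_system n Q A g D P m F \<longleftrightarrow>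
     smooth_manifold n Q A \<and>
     riemannian_metric Q A g \<and>
     levi_civita Q A g D \<and>
     smooth_fun A Q P \<and>
     (\<forall>i\<in>{1..m}. smooth_one_form Q A (F i)) \<and>
     (\<forall>p\<in>Q. \<forall>a. (\<forall>v\<in>tangent_space A p. (\<Sum>i=1..m. a i * F i p v) = 0) \<longrightarrow> (\<forall>i\<in>{1..m}. a i = 0))"

definition acceleration_distribution ::
  "('q, 'e::euclidean_space) chart set \<Rightarrow> ('q \<Rightarrow> ('q, 'e) tvec \<Rightarrow> ('q, 'e) tvec \<Rightarrow> real) \<Rightarrow>
   nat \<Rightarrow> (nat \<Rightarrow> 'q \<Rightarrow> ('q, 'e) tvec \<Rightarrow> real) \<Rightarrow> 'q \<Rightarrow> ('q, 'e) tvec set" where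
  "acceleration_distribution A g m F q = span ((\<lambda>i. sharp A g q (F i q)) ` {1..m})"

text \<open>The restrictions to \<open>C\<close> of the slice charts of codimension \<open>m\<close>.  For an embedded submanifold
  they form a smooth atlas of \<open>C\<close>.\<close>

definition submanifold_atlas ::
  "('q, 'e::euclidean_space) chart set \<Rightarrow> nat \<Rightarrow> 'q set \<Rightarrow> ('q, 'e) chart set" where
  "submanifold_atlas A m C = {(chart_dom c \<inter> C, chart_map c) |c. c \<in> A \<and> chart_dom c \<inter> C \<noteq> {} \<and>
     (\<exists>S. subspace S \<and> S \<subseteq> model c \<and> dim S + m = dim (model c) \<and>
          chart_map c ` (chart_dom c \<inter> C) = chart_map c ` chart_dom c \<inter> S)}"

definition embedded_submanifold ::
  "'q set \<Rightarrow> ('q, 'e::euclidean_space) chart set \<Rightarrow> nat \<Rightarrow> 'q set \<Rightarrow> bool" where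
  "embedded_submanifold Q A m C \<longleftrightarrow>
     C \<subseteq> Q \<and> (\<forall>p\<in>C. \<exists>c\<in>submanifold_atlas A m C. p \<in> chart_dom c)"

text \<open>The differential of the inclusion of \<open>C\<close>, identifying the tangent spaces of \<open>C\<close> with
  subspaces of those of the ambient manifold.\<close>

definition incl ::
  "('q, 'e::euclidean_space) chart set \<Rightarrow> nat \<Rightarrow> 'q set \<Rightarrow> 'q \<Rightarrow> ('q, 'e) tvec \<Rightarrow> ('q, 'e) tvec" where
  "incl A m C = differential (submanifold_atlas A m C) A (\<lambda>x. x)"

definition regular_VHC ::
  "'q::topological_space set \<Rightarrow> ('q, 'e::euclidean_space) chart set \<Rightarrow>
   ('q \<Rightarrow> ('q, 'e) tvec \<Rightarrow> ('q, 'e) tvec \<Rightarrow> real) \<Rightarrow>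
   nat \<Rightarrow> (nat \<Rightarrow> 'q \<Rightarrow> ('q, 'e) tvec \<Rightarrow> real) \<Rightarrow> 'q set \<Rightarrow> bool" where
  "regular_VHC Q A g m F C \<longleftrightarrow>
     closedin (top_of_set Q) C \<and>
     embedded_submanifold Q A m C \<and>
     (\<forall>q\<in>C.
        let TC = incl A m C q ` tangent_space (submanifold_atlas A m C) q;
            DA = acceleration_distribution A g m F q
        in {v + w |v w. v \<in> TC \<and> w \<in> DA} = tangent_space A q \<and> TC \<inter> DA = {0})"

definition sigma ::
  "('q, 'e::euclidean_space) chart set \<Rightarrow> ('q \<Rightarrow> ('q, 'e) tvec \<Rightarrow> ('q, 'e) tvec \<Rightarrow> real) \<Rightarrow>
   nat \<Rightarrow> (nat \<Rightarrow> 'q \<Rightarrow> ('q, 'e) tvec \<Rightarrow> real) \<Rightarrow> 'q set \<Rightarrow>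
   'q \<Rightarrow> ('q, 'e) tvec \<Rightarrow> ('q, 'e) tvec" where
  "sigma A g m F C q w =
     (THE v. v \<in> tangent_space (submanifold_atlas A m C) q \<and>
             w - incl A m C q v \<in> acceleration_distribution A g m F q)"

text \<open>\<open>Y'\<close> is a smooth extension near \<open>p\<close>, to the ambient manifold, of the vector field \<open>Y\<close> on \<open>C\<close>.\<close>

definition extends_near ::
  "'q::topological_space set \<Rightarrow> ('q, 'e::euclidean_space) chart set \<Rightarrow> nat \<Rightarrow> 'q set \<Rightarrow> 'q \<Rightarrow>
   ('q \<Rightarrow> ('q, 'e) tvec) \<Rightarrow> ('q \<Rightarrow> ('q, 'e) tvec) \<Rightarrow> bool" where
  "extends_near Q A m C p Y Y' \<longleftrightarrow>
     (\<exists>W. openin (top_of_set Q) W \<and> p \<in> W \<and> smooth_vector_field A W Y' \<and>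
          (\<forall>x\<in>W \<inter> C. Y' x = incl A m C x (Y x)))"

definition induced_connection ::
  "'q::topological_space set \<Rightarrow> ('q, 'e::euclidean_space) chart set \<Rightarrow>
   ('q \<Rightarrow> ('q, 'e) tvec \<Rightarrow> ('q, 'e) tvec \<Rightarrow> real) \<Rightarrow> ('q, 'e) conn \<Rightarrow>
   nat \<Rightarrow> (nat \<Rightarrow> 'q \<Rightarrow> ('q, 'e) tvec \<Rightarrow> real) \<Rightarrow> 'q set \<Rightarrow> ('q, 'e) conn" where
  "induced_connection Q A g D m F C p v Y =
     sigma A g m F C p (D p (incl A m C p v) (SOME Y'. extends_near Q A m C p Y Y'))"

definition satisfies_constrained_dynamics ::
  "'q::topological_space set \<Rightarrow> ('q, 'e::euclidean_space) chart set \<Rightarrow>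
   ('q \<Rightarrow> ('q, 'e) tvec \<Rightarrow> ('q, 'e) tvec \<Rightarrow> real) \<Rightarrow> ('q, 'e) conn \<Rightarrow> ('q \<Rightarrow> real) \<Rightarrow>
   nat \<Rightarrow> (nat \<Rightarrow> 'q \<Rightarrow> ('q, 'e) tvec \<Rightarrow> real) \<Rightarrow> 'q set \<Rightarrow> real set \<Rightarrow> (real \<Rightarrow> 'q) \<Rightarrow> bool" where
  "satisfies_constrained_dynamics Q A g D P m F C I q \<longleftrightarrow>
     (\<forall>t\<in>I. covariant_acceleration (submanifold_atlas A m C) (induced_connection Q A g D m F C) q t
             = - sigma A g m F C (q t) (grad A g P (q t)))"

text \<open>The constrained dynamics are Lagrangian with Lagrangian structure \<open>(C, gC, PC)\<close>.\<close>

definition lagrangian_structure ::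
  "'q::topological_space set \<Rightarrow> ('q, 'e::euclidean_space) chart set \<Rightarrow>
   ('q \<Rightarrow> ('q, 'e) tvec \<Rightarrow> ('q, 'e) tvec \<Rightarrow> real) \<Rightarrow> ('q, 'e) conn \<Rightarrow> ('q \<Rightarrow> real) \<Rightarrow>
   nat \<Rightarrow> (nat \<Rightarrow> 'q \<Rightarrow> ('q, 'e) tvec \<Rightarrow> real) \<Rightarrow> 'q set \<Rightarrow>
   ('q \<Rightarrow> ('q, 'e) tvec \<Rightarrow> ('q, 'e) tvec \<Rightarrow> real) \<Rightarrow> ('q \<Rightarrow> real) \<Rightarrow> bool" where
  "lagrangian_structure Q A g D P m F C gC PC \<longleftrightarrow>
     riemannian_metric C (submanifold_atlas A m C) gC \<and>
     smooth_fun (submanifold_atlas A m C) C PC \<and>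
     (\<forall>I q. open_interval I \<and> smooth_curve C (submanifold_atlas A m C) I q \<longrightarrow>
        (satisfies_constrained_dynamics Q A g D P m F C I q \<longleftrightarrow>
         base_integral_curve C (submanifold_atlas A m C) gC PC I q))"

end

theory Submission
  imports Defs
begin

text \<open>In a chart adapted to \<open>C\<close> both the constrained dynamics and the equation of a Lagrangian system
  \<open>(C, gC, PC)\<close> have the form \<open>q'' + \<Gamma>(q', q') + \<kappa>(q) = 0\<close>: for the former, \<open>\<Gamma>\<close> consists of the
  Christoffel symbols of the induced connection and \<open>\<kappa> = \<sigma>(grad P)\<close>; for the latter, of those of the
  Levi-Civita connection of \<open>gC\<close> and \<open>\<kappa> = grad PC\<close>.  The theorem says that two such equations have
  the same solutions exactly if they have the same \<open>\<Gamma>\<close> and the same \<open>\<kappa>\<close>.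

  If the coefficients agree, so do the equations.  The only point to settle is that a base integral
  curve refers to some Levi-Civita connection of \<open>gC\<close>, which has to have the Christoffel symbols of
  the given one; this is the uniqueness half of the fundamental theorem of Riemannian geometry
  (\<open>levi_civita_christoffel_unique\<close>).

  Conversely, let the solutions agree.  The constrained equation has a smooth solution through
  every point \<open>p\<close> with every velocity \<open>u\<close> (\<open>constrained_dynamics_solution\<close>).  It is a base integral
  curve as well, so comparing the two accelerations at time \<open>0\<close> gives
  \<open>\<Gamma>\<^sub>1(u, u) + \<kappa>\<^sub>1 = \<Gamma>\<^sub>2(u, u) + \<kappa>\<^sub>2\<close> at \<open>p\<close>.  For \<open>u = 0\<close> this is \<open>\<kappa>\<^sub>1 = \<kappa>\<^sub>2\<close>, whence the quadratic parts
  agree; both connections are torsion-free, so their symbols are symmetric and agree by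
  polarization.  The existence of a Levi-Civita connection of \<open>gC\<close> does not have to be proved
  separately, since it is part of being a base integral curve.

  The analytic work lies in showing that the coefficients of the constrained equation are smooth.
  The projection \<open>\<sigma>\<close> is defined by a direct sum decomposition, and in coordinates \<open>\<sigma>(Z)\<close> is part of the
  solution of a linear system with smooth coefficients, which regularity of the constraint makes
  uniquely solvable (\<open>smooth_sigma\<close>, \<open>smooth_on_linear_solution\<close>).  The induced connection is defined
  through arbitrary extensions of vector fields; \<open>induced_connection_chart\<close> removes them by showing
  that in a slice chart its Christoffel symbols are the \<open>\<sigma>\<close>-images of those of the ambient
  connection.\<close>

section \<open>Calculus of C_k maps\<close>

lemma C_k_on_cong:
  assumes "\<And>x. x \<in> S \<Longrightarrow> f x = g x" and "C_k_on k S f"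
  shows "C_k_on k S g"
proof (cases k)
  case 0
  then show ?thesis using assms continuous_on_cong[of S S f g] by simp
next
  case (Suc j)
  then show ?thesis using assms has_derivative_transform[of _ S g f]
    by (metis C_k_on.simps(2))
qed

lemma C_k_on_subset: "C_k_on k S f \<Longrightarrow> T \<subseteq> S \<Longrightarrow> C_k_on k T f"
proof (induction k arbitrary: f)
  case 0
  then show ?case by (auto intro: continuous_on_subset)
next
  case (Suc k)
  then obtain f' where "\<forall>x\<in>S. (f has_derivative f' x) (at x within S)" "\<forall>u. C_k_on k S (\<lambda>x. f' x u)"
    by auto
  then show ?case unfolding C_k_on.simps using Suc.prems(2)
    by (intro exI[of _ f'] conjI ballI allI Suc.IH) (auto intro: has_derivative_subset)
qed

lemma C_k_on_SucD: "C_k_on (Suc k) S f \<Longrightarrow> C_k_on k S f"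
proof (induction k arbitrary: f)
  case 0
  then show ?case by (auto intro: has_derivative_continuous_on)
next
  case (Suc k)
  then show ?case by (metis C_k_on.simps(2))
qed

lemma C_k_on_imp_continuous_on: "C_k_on k S f \<Longrightarrow> continuous_on S f"
  by (cases k) (auto intro: has_derivative_continuous_on)

lemma C_k_on_const: "C_k_on k S (\<lambda>x. c)"
proof (induction k arbitrary: c)
  case (Suc k)
  show ?case unfolding C_k_on.simps
    by (rule exI[of _ "\<lambda>x h. 0"]) (use Suc in auto)
qed auto

lemma C_k_on_bounded_linear: "bounded_linear f \<Longrightarrow> C_k_on k S f"
  by (cases k) (auto simp: C_k_on_const linear_continuous_on bounded_linear_imp_has_derivative
      intro!: exI[of _ "\<lambda>x. f"])

lemma C_k_on_add: "C_k_on k S f \<Longrightarrow> C_k_on k S g \<Longrightarrow> C_k_on k S (\<lambda>x. f x + g x)"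
proof (induction k arbitrary: f g)
  case 0
  then show ?case by (auto intro: continuous_on_add)
next
  case (Suc k)
  then obtain f' g' where "\<forall>x\<in>S. (f has_derivative f' x) (at x within S)" "\<forall>u. C_k_on k S (\<lambda>x. f' x u)"
    "\<forall>x\<in>S. (g has_derivative g' x) (at x within S)" "\<forall>u. C_k_on k S (\<lambda>x. g' x u)" by auto
  then show ?case unfolding C_k_on.simps
    by (intro exI[of _ "\<lambda>x h. f' x h + g' x h"]) (auto intro: Suc.IH has_derivative_add)
qed

lemma C_k_on_sum: "(\<And>i. i \<in> I \<Longrightarrow> C_k_on k S (f i)) \<Longrightarrow> C_k_on k S (\<lambda>x. \<Sum>i\<in>I. f i x)"
  by (induction I rule: infinite_finite_induct) (auto intro: C_k_on_add C_k_on_const)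

lemma C_k_on_linear_comp:
  assumes "bounded_linear L"
  shows "C_k_on k S f \<Longrightarrow> C_k_on k S (\<lambda>x. L (f x))"
proof (induction k arbitrary: f)
  case 0
  then show ?case using assms by (auto intro: bounded_linear.continuous_on)
next
  case (Suc k)
  then obtain f' where "\<forall>x\<in>S. (f has_derivative f' x) (at x within S)" "\<forall>u. C_k_on k S (\<lambda>x. f' x u)"
    by auto
  then show ?case unfolding C_k_on.simps
    by (intro exI[of _ "\<lambda>x h. L (f' x h)"]) (auto intro: Suc.IH bounded_linear.has_derivative[OF assms])
qed

lemma C_k_on_scaleR:
  "C_k_on k S f \<Longrightarrow> C_k_on k S g \<Longrightarrow> C_k_on k S (\<lambda>x. f x *\<^sub>R g x)"
proof (induction k arbitrary: f g)
  case 0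
  then show ?case by (auto intro: continuous_on_scaleR)
next
  case (Suc k)
  then obtain f' g' where *: "\<forall>x\<in>S. (f has_derivative f' x) (at x within S)" "\<forall>u. C_k_on k S (\<lambda>x. f' x u)"
    "\<forall>x\<in>S. (g has_derivative g' x) (at x within S)" "\<forall>u. C_k_on k S (\<lambda>x. g' x u)" by auto
  show ?case unfolding C_k_on.simps
  proof (intro exI[of _ "\<lambda>x h. f x *\<^sub>R g' x h + f' x h *\<^sub>R g x"] conjI ballI allI)
    show "((\<lambda>x. f x *\<^sub>R g x) has_derivative (\<lambda>h. f x *\<^sub>R g' x h + f' x h *\<^sub>R g x)) (at x within S)"
      if "x \<in> S" for x using * that by (intro has_derivative_scaleR) auto
    show "C_k_on k S (\<lambda>x. f x *\<^sub>R g' x u + f' x u *\<^sub>R g x)" for u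
      using * C_k_on_SucD[OF Suc.prems(1)] C_k_on_SucD[OF Suc.prems(2)] by (intro C_k_on_add Suc.IH) auto
  qed
qed

lemma linear_basis_expansion:
  fixes f :: "'a::euclidean_space \<Rightarrow> 'b::real_vector"
  assumes "linear f"
  shows "f z = (\<Sum>b\<in>Basis. (z \<bullet> b) *\<^sub>R f b)"
proof -
  have "f z = f (\<Sum>b\<in>Basis. (z \<bullet> b) *\<^sub>R b)" by (simp add: euclidean_representation)
  also have "\<dots> = (\<Sum>b\<in>Basis. (z \<bullet> b) *\<^sub>R f b)"
    using assms by (simp add: linear_sum linear_scale)
  finally show ?thesis .
qed

text \<open>The direction \<open>g' x u\<close> in which \<open>f\<close> is differentiated moves with \<open>x\<close>, whereas the definition of
  \<open>C_k_on\<close> controls derivatives in fixed directions only.  Expanding it in a basis reduces the claim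
  to products of functions to which the induction hypothesis applies.\<close>

lemma C_k_on_compose:
  fixes f :: "'b::euclidean_space \<Rightarrow> 'c::real_normed_vector"
  shows "C_k_on k T f \<Longrightarrow> C_k_on k S g \<Longrightarrow> g ` S \<subseteq> T \<Longrightarrow> C_k_on k S (\<lambda>x. f (g x))"
proof (induction k arbitrary: f)
  case 0
  then show ?case by (auto intro: continuous_on_compose2)
next
  case (Suc k)
  then obtain f' g' where f: "\<forall>x\<in>T. (f has_derivative f' x) (at x within T)" "\<forall>u. C_k_on k T (\<lambda>x. f' x u)"
    and g: "\<forall>x\<in>S. (g has_derivative g' x) (at x within S)" "\<forall>u. C_k_on k S (\<lambda>x. g' x u)" by auto
  have ck: "C_k_on k S g" using Suc.prems(2) by (rule C_k_on_SucD)
  have "C_k_on k S (\<lambda>x. f' (g x) (g' x u))" for u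
  proof (rule C_k_on_cong)
    have "C_k_on k S (\<lambda>x. g' x u \<bullet> b)" for b
      using g(2) by (intro C_k_on_linear_comp[OF bounded_linear_inner_left]) auto
    moreover have "C_k_on k S (\<lambda>x. f' (g x) b)" for b
      using Suc.IH[OF _ ck Suc.prems(3)] f(2) by blast
    ultimately show "C_k_on k S (\<lambda>x. \<Sum>b\<in>Basis. (g' x u \<bullet> b) *\<^sub>R f' (g x) b)"
      by (intro C_k_on_sum C_k_on_scaleR)
  next
    fix x assume "x \<in> S"
    then have "linear (f' (g x))" using f Suc.prems(3)
      by (meson has_derivative_linear image_subset_iff)
    then show "(\<Sum>b\<in>Basis. (g' x u \<bullet> b) *\<^sub>R f' (g x) b) = f' (g x) (g' x u)"
      by (metis linear_basis_expansion)
  qed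
  moreover have "((\<lambda>x. f (g x)) has_derivative (\<lambda>h. f' (g x) (g' x h))) (at x within S)" if "x \<in> S" for x
  proof (rule has_derivative_in_compose[of g "g' x" x S f "f' (g x)"])
    show "(g has_derivative g' x) (at x within S)" using g that by blast
    show "(f has_derivative f' (g x)) (at (g x) within g ` S)"
      using f that Suc.prems(3) by (meson has_derivative_subset image_subset_iff)
  qed
  ultimately show ?case unfolding C_k_on.simps
    by (intro exI[of _ "\<lambda>x h. f' (g x) (g' x h)"] conjI ballI allI)
qed

lemma C_k_on_Pair:
  assumes f: "C_k_on k S f" and g: "C_k_on k S g"
  shows "C_k_on k S (\<lambda>x. (f x, g x))"
proof -
  have "bounded_linear (\<lambda>y. (y, 0))" "bounded_linear (\<lambda>y. (0, y))"
    by (intro bounded_linear_Pair bounded_linear_ident bounded_linear_zero)+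
  then have "C_k_on k S (\<lambda>x. (f x, 0) + (0, g x))"
    using f g C_k_on_linear_comp[of "\<lambda>y. (y, 0)"] C_k_on_linear_comp[of "\<lambda>y. (0, y)"]
    by (intro C_k_on_add) auto
  then show ?thesis by simp
qed

text \<open>A product rule in which the first factor is merely continuous, because the second one vanishes at
  the point.  With it the solution of a linear system can be differentiated before it is known to be
  differentiable.\<close>

lemma has_derivative_scaleR_vanishing:
  fixes f :: "'a::real_normed_vector \<Rightarrow> real"
  assumes f: "(f \<longlongrightarrow> f x) (at x within S)" and g: "(g has_derivative g') (at x within S)" and g0: "g x = 0"
  shows "((\<lambda>y. f y *\<^sub>R g y) has_derivative (\<lambda>h. f x *\<^sub>R g' h)) (at x within S)"
proof -
  have bl: "bounded_linear g'" using g by (rule has_derivative_bounded_linear)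
  then obtain K where K: "\<And>h. norm (g' h) \<le> norm h * K" using bounded_linear.bounded by blast
  have "((\<lambda>y. norm (g y - g x - g' (y - x)) / norm (y - x)) \<longlongrightarrow> 0) (at x within S)"
    using g by (simp add: has_derivative_iff_norm)
  then have "((\<lambda>y. \<bar>f y\<bar> * (norm (g y - g x - g' (y - x)) / norm (y - x)) + \<bar>f y - f x\<bar> * K)
      \<longlongrightarrow> \<bar>f x\<bar> * 0 + \<bar>f x - f x\<bar> * K) (at x within S)"
    by (intro tendsto_intros f)
  then have lim: "((\<lambda>y. \<bar>f y\<bar> * (norm (g y - g x - g' (y - x)) / norm (y - x)) + \<bar>f y - f x\<bar> * K)
      \<longlongrightarrow> 0) (at x within S)" by simp
  have "((\<lambda>y. norm (f y *\<^sub>R g y - f x *\<^sub>R g x - f x *\<^sub>R g' (y - x)) / norm (y - x)) \<longlongrightarrow> 0) (at x within S)"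
  proof (rule Lim_null_comparison[OF _ lim], rule eventually_at_filter[THEN iffD2], rule always_eventually, intro allI impI)
    fix y assume "y \<noteq> x"
    have "f y *\<^sub>R g y - f x *\<^sub>R g x - f x *\<^sub>R g' (y - x)
        = f y *\<^sub>R (g y - g x - g' (y - x)) + (f y - f x) *\<^sub>R g' (y - x)"
      using g0 by (simp add: algebra_simps)
    then have "norm (f y *\<^sub>R g y - f x *\<^sub>R g x - f x *\<^sub>R g' (y - x))
        \<le> \<bar>f y\<bar> * norm (g y - g x - g' (y - x)) + \<bar>f y - f x\<bar> * norm (g' (y - x))"
      by (metis norm_scaleR norm_triangle_ineq)
    also have "\<dots> \<le> \<bar>f y\<bar> * norm (g y - g x - g' (y - x)) + \<bar>f y - f x\<bar> * (norm (y - x) * K)"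
      using K[of "y - x"] by (intro add_left_mono mult_left_mono) auto
    finally have *: "norm (f y *\<^sub>R g y - f x *\<^sub>R g x - f x *\<^sub>R g' (y - x))
        \<le> \<bar>f y\<bar> * norm (g y - g x - g' (y - x)) + \<bar>f y - f x\<bar> * (norm (y - x) * K)" .
    have n: "norm (y - x) > 0" using \<open>y \<noteq> x\<close> by simp
    have "norm (f y *\<^sub>R g y - f x *\<^sub>R g x - f x *\<^sub>R g' (y - x)) / norm (y - x)
        \<le> (\<bar>f y\<bar> * norm (g y - g x - g' (y - x)) + \<bar>f y - f x\<bar> * (norm (y - x) * K)) / norm (y - x)"
      using * n by (simp add: divide_right_mono)
    also have "\<dots> = \<bar>f y\<bar> * (norm (g y - g x - g' (y - x)) / norm (y - x)) + \<bar>f y - f x\<bar> * K"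
      using n by (simp add: field_simps)
    finally show "norm (norm (f y *\<^sub>R g y - f x *\<^sub>R g x - f x *\<^sub>R g' (y - x)) / norm (y - x))
       \<le> \<bar>f y\<bar> * (norm (g y - g x - g' (y - x)) / norm (y - x)) + \<bar>f y - f x\<bar> * K" by simp
  qed
  then show ?thesis using bounded_linear_scaleR_right bl
    by (auto simp: has_derivative_iff_norm intro: bounded_linear_const_scaleR)
qed

text \<open>The inverse of a smooth family of linear maps is smooth, in a form without matrices.  Continuity of
  \<open>y\<close> follows from a lower bound on \<open>L a\<close> that persists near \<open>a\<close>.  For the derivative the equation is
  written as \<open>L a (y x) = r x - (\<Sum>b\<in>Basis. (y x \<bullet> b) *\<^sub>R (L x b - L a b))\<close>, where the factors
  \<open>L x b - L a b\<close> vanish at \<open>a\<close>, so that continuity of \<open>y\<close> suffices to differentiate the right-hand side.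
  The derivative solves a linear system with the same \<open>L\<close>, which carries the induction on \<open>k\<close>.\<close>

lemma C_k_on_linear_solution:
  fixes L :: "'a::real_normed_vector \<Rightarrow> 'b::euclidean_space \<Rightarrow> 'b"
  assumes lin: "\<And>x. x \<in> S \<Longrightarrow> linear (L x)" and inj: "\<And>x z. x \<in> S \<Longrightarrow> L x z = 0 \<Longrightarrow> z = 0"
  shows "(\<And>b. C_k_on k S (\<lambda>x. L x b)) \<Longrightarrow> C_k_on k S r \<Longrightarrow> (\<And>x. x \<in> S \<Longrightarrow> L x (y x) = r x)
    \<Longrightarrow> C_k_on k S y"
proof (induction k arbitrary: y r)
  case 0
  show ?case unfolding C_k_on.simps continuous_on_def
  proof
    fix a assume a: "a \<in> S"
    have "inj (L a)" using lin[OF a] inj[OF a] by (simp add: linear_injective_0)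
    then obtain B where B: "B > 0" "\<And>z. B * norm z \<le> norm (L a z)"
      using linear_inj_bounded_below_pos[OF lin[OF a]] by blast
    have cL: "((\<lambda>x. L x b) \<longlongrightarrow> L a b) (at a within S)" for b
      using 0(1)[of b] a by (auto simp: continuous_on_def)
    have cr: "(r \<longlongrightarrow> r a) (at a within S)" using 0(2) a by (auto simp: continuous_on_def)
    define N where "N x = (\<Sum>b\<in>Basis. norm (L x b - L a b))" for x
    have "(N \<longlongrightarrow> (\<Sum>b\<in>Basis. norm (L a b - L a b))) (at a within S)"
      unfolding N_def by (intro tendsto_intros cL)
    then have "\<forall>\<^sub>F x in at a within S. N x < B / 2" using B(1)
      by (intro order_tendstoD) auto
    then have ev: "\<forall>\<^sub>F x in at a within S. norm (y x - y a) \<le> (2 / B) * norm (r x - L x (y a))"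
      unfolding eventually_at_filter
    proof eventually_elim
      case (elim x)
      show ?case
      proof (intro impI)
        assume x: "x \<noteq> a" "x \<in> S"
        define d where "d = y x - y a"
        have "norm (L x d - L a d) \<le> N x * norm d"
        proof -
          have "L x d - L a d = (\<Sum>b\<in>Basis. (d \<bullet> b) *\<^sub>R (L x b - L a b))"
          proof -
            have "L x d = (\<Sum>b\<in>Basis. (d \<bullet> b) *\<^sub>R L x b)" "L a d = (\<Sum>b\<in>Basis. (d \<bullet> b) *\<^sub>R L a b)"
              using lin[OF x(2)] lin[OF a]
              by (blast intro: linear_basis_expansion)+
            then show ?thesis by (simp add: sum_subtractf scaleR_diff_right)
          qed
          also have "norm \<dots> \<le> (\<Sum>b\<in>Basis. norm ((d \<bullet> b) *\<^sub>R (L x b - L a b)))" by (rule norm_sum)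
          also have "\<dots> \<le> (\<Sum>b\<in>Basis. norm d * norm (L x b - L a b))"
            by (intro sum_mono) (auto intro: mult_right_mono Basis_le_norm)
          finally show ?thesis by (simp add: N_def sum_distrib_left mult.commute)
        qed
        moreover have "N x * norm d \<le> B / 2 * norm d" using elim x by (intro mult_right_mono) auto
        moreover have "norm (L x d) = norm (r x - L x (y a))"
          using 0(3)[OF x(2)] lin[OF x(2)] by (simp add: d_def linear_diff)
        moreover have "norm (L a d) \<le> norm (L x d) + norm (L x d - L a d)"
          by (metis norm_minus_commute norm_triangle_sub)
        ultimately have "B * norm d \<le> norm (r x - L x (y a)) + B / 2 * norm d"
          using B(2)[of d] by linarith
        then show "norm (y x - y a) \<le> (2 / B) * norm (r x - L x (y a))"
          using B(1) by (simp add: d_def field_simps)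
      qed
    qed
    have "((\<lambda>x. (2 / B) * norm (r x - L x (y a))) \<longlongrightarrow> (2 / B) * norm (r a - L a (y a))) (at a within S)"
      by (intro tendsto_intros cL cr)
    then have "((\<lambda>x. (2 / B) * norm (r x - L x (y a))) \<longlongrightarrow> 0) (at a within S)" using 0(3)[OF a] by simp
    from Lim_null_comparison[OF ev this] show "(y \<longlongrightarrow> y a) (at a within S)"
      using LIM_zero_iff by blast
  qed
next
  case (Suc k)
  have yk: "C_k_on k S y"
    by (rule Suc.IH[OF C_k_on_SucD[OF Suc.prems(1)] C_k_on_SucD[OF Suc.prems(2)] Suc.prems(3)])
  have y0: "(y \<longlongrightarrow> y a) (at a within S)" if "a \<in> S" for a
  proof -
    have "continuous_on S y" using yk by (rule C_k_on_imp_continuous_on)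
    then show ?thesis using that by (auto simp: continuous_on_def)
  qed
  obtain r' where r': "\<And>x. x \<in> S \<Longrightarrow> (r has_derivative r' x) (at x within S)" "\<And>u. C_k_on k S (\<lambda>x. r' x u)"
    using Suc.prems(2) by auto
  have "\<forall>b. \<exists>L'. (\<forall>x\<in>S. ((\<lambda>x. L x b) has_derivative L' x) (at x within S)) \<and> (\<forall>u. C_k_on k S (\<lambda>x. L' x u))"
    using Suc.prems(1) by auto
  then obtain L' where L': "\<And>b x. x \<in> S \<Longrightarrow> ((\<lambda>x. L x b) has_derivative L' b x) (at x within S)"
    "\<And>b u. C_k_on k S (\<lambda>x. L' b x u)" by metis
  define \<rho> where "\<rho> x u = r' x u - (\<Sum>b\<in>Basis. (y x \<bullet> b) *\<^sub>R L' b x u)" for x u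
  define y' where "y' x u = inv (L x) (\<rho> x u)" for x u
  have bij: "bij (L x)" if "x \<in> S" for x
    using lin[OF that] inj[OF that] linear_injective_imp_surjective[of "L x"]
    by (simp add: bij_def linear_injective_0)
  have \<rho>k: "C_k_on k S (\<lambda>x. \<rho> x u)" for u
  proof -
    have "C_k_on k S (\<lambda>x. y x \<bullet> b)" for b
      using yk by (rule C_k_on_linear_comp[OF bounded_linear_inner_left])
    then have "C_k_on k S (\<lambda>x. \<Sum>b\<in>Basis. (y x \<bullet> b) *\<^sub>R L' b x u)"
      by (rule C_k_on_sum[OF C_k_on_scaleR[OF _ L'(2)]])
    then have "C_k_on k S (\<lambda>x. - (\<Sum>b\<in>Basis. (y x \<bullet> b) *\<^sub>R L' b x u))"
      by (rule C_k_on_linear_comp[OF bounded_linear_minus[OF bounded_linear_ident]])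
    from C_k_on_add[OF r'(2) this] show ?thesis by (simp add: \<rho>_def)
  qed
  have y'k: "C_k_on k S (\<lambda>x. y' x u)" for u
  proof (rule Suc.IH[OF _ \<rho>k])
    show "C_k_on k S (\<lambda>x. L x b)" for b using C_k_on_SucD[OF Suc.prems(1)] .
    show "L x (y' x u) = \<rho> x u" if "x \<in> S" for x
      using bij[OF that] by (simp add: y'_def bij_is_surj surj_f_inv_f)
  qed
  have "(y has_derivative y' a) (at a within S)" if a: "a \<in> S" for a
  proof -
    have "((\<lambda>x. r x - (\<Sum>b\<in>Basis. (y x \<bullet> b) *\<^sub>R (L x b - L a b))) has_derivative (\<lambda>u. \<rho> a u)) (at a within S)"
      unfolding \<rho>_def
    proof (intro has_derivative_diff has_derivative_sum r' a has_derivative_scaleR_vanishing)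
      fix b :: 'b
      show "((\<lambda>x. y x \<bullet> b) \<longlongrightarrow> y a \<bullet> b) (at a within S)" by (intro tendsto_intros y0 a)
      show "((\<lambda>x. L x b - L a b) has_derivative L' b a) (at a within S)"
        using has_derivative_diff[OF L'(1)[OF a] has_derivative_const] by simp
    qed simp
    moreover have "bounded_linear (inv (L a))"
      using bij[OF a] lin[OF a] by (simp add: bij_def inj_linear_imp_inv_bounded_linear linear_conv_bounded_linear)
    ultimately have "((\<lambda>x. inv (L a) (r x - (\<Sum>b\<in>Basis. (y x \<bullet> b) *\<^sub>R (L x b - L a b)))) has_derivative y' a) (at a within S)"
      unfolding y'_def by (rule bounded_linear.has_derivative[rotated])
    note deriv = this
    show ?thesis
    proof (rule has_derivative_transform[OF a _ deriv])
      fix x assume x: "x \<in> S"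
      have "L x (y x) = (\<Sum>b\<in>Basis. (y x \<bullet> b) *\<^sub>R L x b)" "L a (y x) = (\<Sum>b\<in>Basis. (y x \<bullet> b) *\<^sub>R L a b)"
        using lin[OF x] lin[OF a]
        by (blast intro: linear_basis_expansion)+
      then have "r x - (\<Sum>b\<in>Basis. (y x \<bullet> b) *\<^sub>R (L x b - L a b)) = L a (y x)"
        using Suc.prems(3)[OF x] by (simp add: sum_subtractf scaleR_diff_right)
      then show "y x = inv (L a) (r x - (\<Sum>b\<in>Basis. (y x \<bullet> b) *\<^sub>R (L x b - L a b)))"
        using bij[OF a] by (simp add: bij_is_inj)
    qed
  qed
  then show ?case unfolding C_k_on.simps using y'k by blast
qed

subsection \<open>Smooth maps\<close>

lemma smooth_on_cong: "(\<And>x. x \<in> S \<Longrightarrow> f x = g x) \<Longrightarrow> smooth_on S f \<Longrightarrow> smooth_on S g"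
  unfolding smooth_on_def using C_k_on_cong by blast

lemma smooth_on_subset: "smooth_on S f \<Longrightarrow> T \<subseteq> S \<Longrightarrow> smooth_on T f"
  unfolding smooth_on_def using C_k_on_subset by blast

lemma smooth_on_const: "smooth_on S (\<lambda>x. c)"
  unfolding smooth_on_def by (simp add: C_k_on_const)

lemma smooth_on_bounded_linear: "bounded_linear f \<Longrightarrow> smooth_on S f"
  unfolding smooth_on_def by (simp add: C_k_on_bounded_linear)

lemma smooth_on_add: "smooth_on S f \<Longrightarrow> smooth_on S g \<Longrightarrow> smooth_on S (\<lambda>x. f x + g x)"
  unfolding smooth_on_def by (simp add: C_k_on_add)

lemma smooth_on_sum: "(\<And>i. i \<in> I \<Longrightarrow> smooth_on S (f i)) \<Longrightarrow> smooth_on S (\<lambda>x. \<Sum>i\<in>I. f i x)"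
  unfolding smooth_on_def by (rule allI, rule C_k_on_sum) simp

lemma smooth_on_linear_comp: "bounded_linear L \<Longrightarrow> smooth_on S f \<Longrightarrow> smooth_on S (\<lambda>x. L (f x))"
  unfolding smooth_on_def by (simp add: C_k_on_linear_comp)

lemma smooth_on_minus: "smooth_on S f \<Longrightarrow> smooth_on S (\<lambda>x. - f x)"
  by (rule smooth_on_linear_comp[OF bounded_linear_minus[OF bounded_linear_ident]])

lemma smooth_on_inner_const: "smooth_on S f \<Longrightarrow> smooth_on S (\<lambda>x. f x \<bullet> b)"
  by (rule smooth_on_linear_comp[OF bounded_linear_inner_left])

lemma smooth_on_scaleR: "smooth_on S f \<Longrightarrow> smooth_on S g \<Longrightarrow> smooth_on S (\<lambda>x. f x *\<^sub>R g x)"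
  unfolding smooth_on_def by (simp add: C_k_on_scaleR)

lemma smooth_on_mult:
  fixes f g :: "'a::real_normed_vector \<Rightarrow> real"
  shows "smooth_on S f \<Longrightarrow> smooth_on S g \<Longrightarrow> smooth_on S (\<lambda>x. f x * g x)"
  using smooth_on_scaleR[of S f g] by simp

lemma smooth_on_compose:
  fixes f :: "'b::euclidean_space \<Rightarrow> 'c::real_normed_vector"
  shows "smooth_on T f \<Longrightarrow> smooth_on S g \<Longrightarrow> g ` S \<subseteq> T \<Longrightarrow> smooth_on S (\<lambda>x. f (g x))"
  unfolding smooth_on_def by (rule allI, rule C_k_on_compose) auto

lemma smooth_on_Pair: "smooth_on S f \<Longrightarrow> smooth_on S g \<Longrightarrow> smooth_on S (\<lambda>x. (f x, g x))"
  unfolding smooth_on_def by (simp add: C_k_on_Pair)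

lemma smooth_on_linear_solution:
  fixes L :: "'a::real_normed_vector \<Rightarrow> 'b::euclidean_space \<Rightarrow> 'b"
  assumes "\<And>x. x \<in> S \<Longrightarrow> linear (L x)" and "\<And>x z. x \<in> S \<Longrightarrow> L x z = 0 \<Longrightarrow> z = 0"
    and "\<And>b. smooth_on S (\<lambda>x. L x b)" and "smooth_on S r" and "\<And>x. x \<in> S \<Longrightarrow> L x (y x) = r x"
  shows "smooth_on S y"
  unfolding smooth_on_def
proof
  show "C_k_on k S y" for k
    by (rule C_k_on_linear_solution[of S L k r y]) (use assms in \<open>simp_all add: smooth_on_def\<close>)
qed

lemma smooth_on_imp_continuous_on: "smooth_on S f \<Longrightarrow> continuous_on S f"
  unfolding smooth_on_def by (blast intro: C_k_on_imp_continuous_on)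


section \<open>Directional derivatives on relatively open subsets of subspaces\<close>

definition subspace_open :: "'a::euclidean_space set \<Rightarrow> 'a set \<Rightarrow> bool" where
  "subspace_open E S \<longleftrightarrow> subspace E \<and> openin (top_of_set E) S"

text \<open>Within a relatively open subset of a proper subspace a derivative is determined only in the
  directions of the subspace.  There it is the derivative along a line, which does not mention the
  subset; derivatives taken within different chart images thereby become one and the same
  function.\<close>

definition dir_deriv :: "('a::real_normed_vector \<Rightarrow> 'b::real_normed_vector) \<Rightarrow> 'a \<Rightarrow> 'a \<Rightarrow> 'b" where
  "dir_deriv f x u = vector_derivative (\<lambda>t. f (x + t *\<^sub>R u)) (at 0)"

lemma subspace_open_subset: "subspace_open E S \<Longrightarrow> S \<subseteq> E"
  unfolding subspace_open_def using openin_imp_subset by blast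

lemma at_within_subspace_open:
  assumes "subspace_open E S" "x \<in> S"
  shows "at x within S = at x within E"
proof -
  obtain T where "open T" "S = E \<inter> T" using assms(1) unfolding subspace_open_def openin_open by blast
  then show ?thesis using assms(2) at_within_nhd[of x T S E] by auto
qed

lemma subspace_open_line:
  assumes "subspace_open E S" "x \<in> S" "u \<in> E"
  shows "\<forall>\<^sub>F t in nhds (0::real). x + t *\<^sub>R u \<in> S"
proof -
  obtain T where T: "open T" "S = E \<inter> T" using assms(1) unfolding subspace_open_def openin_open by blast
  have E: "subspace E" "x \<in> E" using assms T unfolding subspace_open_def by auto
  have "((\<lambda>t. x + t *\<^sub>R u) \<longlongrightarrow> x + 0 *\<^sub>R u) (nhds (0::real))"
    by (intro tendsto_intros filterlim_ident)
  then have "\<forall>\<^sub>F t in nhds (0::real). x + t *\<^sub>R u \<in> T"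
    using T assms(2) by (simp add: topological_tendstoD)
  then show ?thesis
    by eventually_elim (use E assms(3) T in \<open>auto intro: subspace_add subspace_scale\<close>)
qed

lemma dir_deriv_eq:
  assumes E: "subspace E" "x \<in> E" "u \<in> E" and f: "(f has_derivative f') (at x within E)"
  shows "dir_deriv f x u = f' u"
proof -
  have "((\<lambda>t::real. x + t *\<^sub>R u) has_derivative (\<lambda>t. t *\<^sub>R u)) (at 0 within UNIV)"
    by (auto intro!: derivative_eq_intros)
  moreover have "(f has_derivative f') (at (x + 0 *\<^sub>R u) within (\<lambda>t. x + t *\<^sub>R u) ` UNIV)"
    using f E by (auto intro!: has_derivative_subset[OF f] subspace_add subspace_scale)
  ultimately have "((\<lambda>t. f (x + t *\<^sub>R u)) has_derivative (\<lambda>t. f' (t *\<^sub>R u))) (at 0 within UNIV)"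
    by (rule has_derivative_in_compose)
  then have "((\<lambda>t. f (x + t *\<^sub>R u)) has_vector_derivative f' u) (at 0)"
    unfolding has_vector_derivative_def
    using has_derivative_linear[OF f] by (simp add: linear_scale)
  then show ?thesis unfolding dir_deriv_def by (rule vector_derivative_at)
qed

lemma dir_deriv_cong:
  assumes "subspace_open E S" "x \<in> S" "u \<in> E" "\<And>y. y \<in> S \<Longrightarrow> f y = g y"
  shows "dir_deriv f x u = dir_deriv g x u"
  unfolding dir_deriv_def
proof (rule vector_derivative_cong_eq)
  show "\<forall>\<^sub>F t in nhds 0. t \<in> UNIV \<longrightarrow> f (x + t *\<^sub>R u) = g (x + t *\<^sub>R u)"
    using subspace_open_line[OF assms(1-3)] by eventually_elim (use assms(4) in auto)
qed auto

lemma C_k_on_dir_deriv: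
  assumes S: "subspace_open E S" and f: "C_k_on (Suc k) S f"
  obtains f' where "\<And>x. x \<in> S \<Longrightarrow> (f has_derivative f' x) (at x within E)"
    "\<And>x u. x \<in> S \<Longrightarrow> u \<in> E \<Longrightarrow> dir_deriv f x u = f' x u" "\<And>u. C_k_on k S (\<lambda>x. f' x u)"
proof -
  obtain f' where f': "\<And>x. x \<in> S \<Longrightarrow> (f has_derivative f' x) (at x within S)" "\<And>u. C_k_on k S (\<lambda>x. f' x u)"
    using f by auto
  have d: "(f has_derivative f' x) (at x within E)" if "x \<in> S" for x
    using f'(1)[OF that] at_within_subspace_open[OF S that] by simp
  moreover have "dir_deriv f x u = f' x u" if "x \<in> S" "u \<in> E" for x u
    using dir_deriv_eq[OF _ _ that(2) d[OF that(1)]] S that subspace_open_subset[OF S] by (auto simp: subspace_open_def)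
  ultimately show ?thesis using that f'(2) by blast
qed

lemma smooth_on_has_derivative:
  assumes "subspace_open E S" "smooth_on S f" "x \<in> S"
  obtains f' where "(f has_derivative f') (at x within E)" "\<And>u. u \<in> E \<Longrightarrow> dir_deriv f x u = f' u"
  using C_k_on_dir_deriv[OF assms(1), of 0 f] assms unfolding smooth_on_def by metis

lemma frechet_derivative_dir_deriv:
  assumes S: "subspace_open E S" "x \<in> S" and T: "subspace_open E T" "x \<in> T" "smooth_on T f" and u: "u \<in> E"
  shows "frechet_derivative f (at x within S) u = dir_deriv f x u"
proof -
  obtain f' where "(f has_derivative f') (at x within E)"
    using smooth_on_has_derivative[OF T(1,3,2)] by blast
  then have "(f has_derivative frechet_derivative f (at x within S)) (at x within E)"
    using at_within_subspace_open[OF S] frechet_derivative_works differentiable_def by metis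
  from dir_deriv_eq[OF _ _ u this] show ?thesis
    using S subspace_open_subset[OF S(1)] by (auto simp: subspace_open_def)
qed

lemma dir_deriv_lin:
  assumes "subspace_open E S" "smooth_on S f" "x \<in> S" "u \<in> E" "v \<in> E"
  shows "dir_deriv f x (a *\<^sub>R u + b *\<^sub>R v) = a *\<^sub>R dir_deriv f x u + b *\<^sub>R dir_deriv f x v"
proof -
  obtain f' where f': "(f has_derivative f') (at x within E)" "\<And>u. u \<in> E \<Longrightarrow> dir_deriv f x u = f' u"
    using smooth_on_has_derivative[OF assms(1-3)] by blast
  moreover have "a *\<^sub>R u + b *\<^sub>R v \<in> E"
    using assms by (auto simp: subspace_open_def intro: subspace_add subspace_scale)
  ultimately show ?thesis
    using assms has_derivative_linear[OF f'(1)] by (simp add: linear_add linear_scale)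
qed

lemma dir_deriv_const [simp]: "dir_deriv (\<lambda>y. c) x u = 0"
  by (simp add: dir_deriv_def)

lemma dir_deriv_linear_comp:
  assumes "subspace_open E S" "smooth_on S f" "x \<in> S" "u \<in> E" "bounded_linear L"
  shows "dir_deriv (\<lambda>y. L (f y)) x u = L (dir_deriv f x u)"
proof -
  obtain f' where f': "(f has_derivative f') (at x within E)" "\<And>u. u \<in> E \<Longrightarrow> dir_deriv f x u = f' u"
    using smooth_on_has_derivative[OF assms(1-3)] by blast
  show ?thesis
    using dir_deriv_eq[OF _ _ assms(4) bounded_linear.has_derivative[OF assms(5) f'(1)]] f' assms subspace_open_subset[OF assms(1)]
    by (auto simp: subspace_open_def)
qed

lemma ex_linear_projection:
  fixes E :: "'a::euclidean_space set"
  assumes "subspace E"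
  obtains \<pi> where "bounded_linear \<pi>" "\<And>x. \<pi> x \<in> E" "\<And>x. x \<in> E \<Longrightarrow> \<pi> x = x"
proof -
  obtain g where "range g \<subseteq> E" "linear g" "\<forall>v\<in>E. g (id v) = v"
    using linear_exists_left_inverse_on[OF linear_id assms] by auto
  then show ?thesis using that[of g] linear_conv_bounded_linear by auto
qed

text \<open>On \<open>S\<close> the map equals its composition with a linear projection onto \<open>E'\<close>, and a linear map may be
  taken out of the derivative.\<close>

lemma dir_deriv_in_subspace:
  fixes f :: "'a::euclidean_space \<Rightarrow> 'b::euclidean_space"
  assumes "subspace_open E S" "smooth_on S f" "x \<in> S" "u \<in> E" and E': "subspace E'" "f ` S \<subseteq> E'"
  shows "dir_deriv f x u \<in> E'"
proof -
  obtain \<pi> where \<pi>: "bounded_linear \<pi>" "\<And>x. \<pi> x \<in> E'" "\<And>x. x \<in> E' \<Longrightarrow> \<pi> x = x"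
    using ex_linear_projection[OF E'(1)] by blast
  have "dir_deriv f x u = dir_deriv (\<lambda>y. \<pi> (f y)) x u"
    using \<pi> E' assms by (intro dir_deriv_cong[of E S]) (auto simp: image_subset_iff)
  also have "\<dots> = \<pi> (dir_deriv f x u)" by (rule dir_deriv_linear_comp[OF assms(1-4) \<pi>(1)])
  finally show ?thesis using \<pi>(2) by metis
qed

lemma dir_deriv_chain:
  fixes f :: "'a::euclidean_space \<Rightarrow> 'b::euclidean_space"
  assumes f: "subspace_open E S" "smooth_on S f" "x \<in> S" "u \<in> E"
    and g: "subspace_open E' T" "smooth_on T g" "f ` S \<subseteq> T"
  shows "dir_deriv (\<lambda>y. g (f y)) x u = dir_deriv g (f x) (dir_deriv f x u)"
proof -
  obtain f' where f': "(f has_derivative f') (at x within E)" "\<And>u. u \<in> E \<Longrightarrow> dir_deriv f x u = f' u"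
    using smooth_on_has_derivative[OF f(1-3)] by blast
  have fx: "f x \<in> T" using f g by blast
  obtain g' where g': "(g has_derivative g') (at (f x) within E')" "\<And>u. u \<in> E' \<Longrightarrow> dir_deriv g (f x) u = g' u"
    using smooth_on_has_derivative[OF g(1,2) fx] by blast
  have "(f has_derivative f') (at x within S)" using f'(1) at_within_subspace_open[OF f(1,3)] by simp
  moreover have "(g has_derivative g') (at (f x) within f ` S)"
    by (rule has_derivative_subset[OF g'(1)]) (use g(3) subspace_open_subset[OF g(1)] in blast)
  ultimately have "((\<lambda>y. g (f y)) has_derivative (\<lambda>h. g' (f' h))) (at x within S)"
    by (rule has_derivative_in_compose)
  then have d: "((\<lambda>y. g (f y)) has_derivative (\<lambda>h. g' (f' h))) (at x within E)"
    using at_within_subspace_open[OF f(1,3)] by simp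
  have "dir_deriv f x u \<in> E'"
    using dir_deriv_in_subspace[OF f, of E'] g subspace_open_subset[OF g(1)] by (auto simp: subspace_open_def)
  then show ?thesis
    using dir_deriv_eq[OF _ _ f(4) d] f f'(2) g'(2) subspace_open_subset[OF f(1)] by (auto simp: subspace_open_def)
qed

lemma dir_deriv_along_curve:
  fixes f :: "'a::euclidean_space \<Rightarrow> 'b::real_normed_vector"
  assumes f: "subspace_open E S" "smooth_on S f"
    and \<gamma>: "(\<gamma> has_vector_derivative w) (at t)" "open J" "t \<in> J" "\<gamma> ` J \<subseteq> S"
  shows "w \<in> E" and "((\<lambda>s. f (\<gamma> s)) has_vector_derivative dir_deriv f (\<gamma> t) w) (at t)"
proof -
  have E: "subspace E" using f(1) by (simp add: subspace_open_def)
  obtain \<pi> where \<pi>: "bounded_linear \<pi>" "\<And>x. \<pi> x \<in> E" "\<And>x. x \<in> E \<Longrightarrow> \<pi> x = x"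
    using ex_linear_projection[OF E] by blast
  have "((\<lambda>s. \<pi> (\<gamma> s)) has_vector_derivative \<pi> w) (at t)"
    using \<pi>(1) \<gamma>(1) by (rule bounded_linear.has_vector_derivative)
  then have "(\<gamma> has_vector_derivative \<pi> w) (at t)"
    by (rule has_vector_derivative_transform_within_open[OF _ \<gamma>(2,3)])
      (use \<gamma>(4) \<pi>(3) subspace_open_subset[OF f(1)] in auto)
  then have "w = \<pi> w" using \<gamma>(1) vector_derivative_unique_at by blast
  then show w: "w \<in> E" using \<pi>(2) by metis
  have gt: "\<gamma> t \<in> S" using \<gamma> by blast
  obtain f' where f': "(f has_derivative f') (at (\<gamma> t) within E)" "\<And>u. u \<in> E \<Longrightarrow> dir_deriv f (\<gamma> t) u = f' u"
    using smooth_on_has_derivative[OF f gt] by blast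
  have at: "at t within J = at t" using at_within_open[OF \<gamma>(3,2)] .
  have "(\<gamma> has_derivative (\<lambda>h. h *\<^sub>R w)) (at t within J)"
    using \<gamma>(1) unfolding at has_vector_derivative_def .
  moreover have "(f has_derivative f') (at (\<gamma> t) within \<gamma> ` J)"
    by (rule has_derivative_subset[OF f'(1)]) (use \<gamma>(4) subspace_open_subset[OF f(1)] in blast)
  ultimately have "((\<lambda>s. f (\<gamma> s)) has_derivative (\<lambda>h. f' (h *\<^sub>R w))) (at t within J)"
    by (rule has_derivative_in_compose)
  then show "((\<lambda>s. f (\<gamma> s)) has_vector_derivative dir_deriv f (\<gamma> t) w) (at t)"
    unfolding at has_vector_derivative_def f'(2)[OF w] linear_scale[OF has_derivative_linear[OF f'(1)]] .
qed

lemma smooth_on_dir_deriv: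
  fixes f :: "'a::euclidean_space \<Rightarrow> 'b::real_normed_vector"
  assumes f: "subspace_open E S" "smooth_on S f" and \<phi>: "smooth_on T \<phi>" "\<phi> ` T \<subseteq> S"
    and w: "smooth_on T w" "w ` T \<subseteq> E"
  shows "smooth_on T (\<lambda>x. dir_deriv f (\<phi> x) (w x))"
  unfolding smooth_on_def
proof
  fix k
  obtain f' where f': "\<And>x. x \<in> S \<Longrightarrow> (f has_derivative f' x) (at x within E)"
    "\<And>x u. x \<in> S \<Longrightarrow> u \<in> E \<Longrightarrow> dir_deriv f x u = f' x u" "\<And>u. C_k_on k S (\<lambda>x. f' x u)"
    using C_k_on_dir_deriv[OF f(1), of k f] f(2) unfolding smooth_on_def by metis
  have wk: "C_k_on k T (\<lambda>x. w x \<bullet> b)" for b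
    using smooth_on_inner_const[OF w(1)] by (simp add: smooth_on_def)
  have fk: "C_k_on k T (\<lambda>x. f' (\<phi> x) b)" for b
    by (rule C_k_on_compose[OF f'(3)]) (use \<phi> in \<open>auto simp: smooth_on_def\<close>)
  have *: "C_k_on k T (\<lambda>x. \<Sum>b\<in>Basis. (w x \<bullet> b) *\<^sub>R f' (\<phi> x) b)"
    by (rule C_k_on_sum[OF C_k_on_scaleR[OF wk fk]])
  show "C_k_on k T (\<lambda>x. dir_deriv f (\<phi> x) (w x))"
  proof (rule C_k_on_cong[OF _ *])
    fix x assume x: "x \<in> T"
    then have "linear (f' (\<phi> x))" using f'(1) \<phi> has_derivative_linear by blast
    then have "(\<Sum>b\<in>Basis. (w x \<bullet> b) *\<^sub>R f' (\<phi> x) b) = f' (\<phi> x) (w x)"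
      by (rule linear_basis_expansion[symmetric])
    then show "(\<Sum>b\<in>Basis. (w x \<bullet> b) *\<^sub>R f' (\<phi> x) b) = dir_deriv f (\<phi> x) (w x)"
      using f'(2) x \<phi> w by (metis image_subset_iff)
  qed
qed

lemma dir_deriv_basis_expansion:
  fixes f :: "'a::euclidean_space \<Rightarrow> 'b::real_normed_vector"
  assumes "subspace_open E S" "smooth_on S f" "x \<in> S" "w \<in> E"
    and \<pi>: "bounded_linear \<pi>" "\<And>x. \<pi> x \<in> E" "\<And>x. x \<in> E \<Longrightarrow> \<pi> x = x"
  shows "dir_deriv f x w = (\<Sum>b\<in>Basis. (w \<bullet> b) *\<^sub>R dir_deriv f x (\<pi> b))"
proof -
  obtain f' where f': "(f has_derivative f') (at x within E)" "\<And>u. u \<in> E \<Longrightarrow> dir_deriv f x u = f' u"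
    using smooth_on_has_derivative[OF assms(1-3)] by blast
  have "linear (\<lambda>z. f' (\<pi> z))"
    using linear_compose[OF bounded_linear.linear[OF \<pi>(1)] has_derivative_linear[OF f'(1)]] by (simp add: comp_def)
  from linear_basis_expansion[OF this, of w] show ?thesis
    using f'(2) \<pi> assms(4) by simp
qed

text \<open>The product rule for a derivative whose base point and direction both move.  The direction is
  expanded in a basis; the sum that arises from the moving base point is then identified by comparison
  with the case of a constant direction, so that no second derivative has to be introduced as a
  bilinear map.\<close>

lemma dir_deriv_field_along_curve:
  fixes f :: "'a::euclidean_space \<Rightarrow> 'b::real_normed_vector"
  assumes f: "subspace_open E S" "smooth_on S f"
    and \<gamma>: "(\<gamma> has_vector_derivative v) (at t)" "open J" "t \<in> J" "\<gamma> ` J \<subseteq> S"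
    and w: "(w has_vector_derivative a) (at t)" "w ` J \<subseteq> E"
  shows "((\<lambda>s. dir_deriv f (\<gamma> s) (w s)) has_vector_derivative
      (dir_deriv (\<lambda>x. dir_deriv f x (w t)) (\<gamma> t) v + dir_deriv f (\<gamma> t) a)) (at t)"
proof -
  have E: "subspace E" using f(1) by (simp add: subspace_open_def)
  obtain \<pi> where \<pi>: "bounded_linear \<pi>" "\<And>x. \<pi> x \<in> E" "\<And>x. x \<in> E \<Longrightarrow> \<pi> x = x"
    using ex_linear_projection[OF E] by blast
  have sm: "smooth_on S (\<lambda>x. dir_deriv f x u)" if "u \<in> E" for u
    using that by (intro smooth_on_dir_deriv[OF f] smooth_on_bounded_linear bounded_linear_ident smooth_on_const) auto
  have wt: "w t \<in> E" using w \<gamma> by blast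
  have aE: "a \<in> E"
    using dir_deriv_along_curve(1)[OF _ smooth_on_const w(1) \<gamma>(2,3) w(2)] E by (simp add: subspace_open_def)
  have expand: "((\<lambda>s. dir_deriv f (\<gamma> s) (\<omega> s)) has_vector_derivative
      (\<Sum>b\<in>Basis. (\<omega> t \<bullet> b) *\<^sub>R dir_deriv (\<lambda>x. dir_deriv f x (\<pi> b)) (\<gamma> t) v + (\<alpha> \<bullet> b) *\<^sub>R dir_deriv f (\<gamma> t) (\<pi> b))) (at t)"
    if \<omega>: "(\<omega> has_vector_derivative \<alpha>) (at t)" "\<omega> ` J \<subseteq> E" for \<omega> \<alpha>
  proof (rule has_vector_derivative_transform_within_open[OF _ \<gamma>(2,3)])
    have "((\<lambda>s. \<omega> s \<bullet> b) has_real_derivative (\<alpha> \<bullet> b)) (at t)" for b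
      using bounded_linear.has_vector_derivative[OF bounded_linear_inner_left \<omega>(1)]
      by (simp add: has_real_derivative_iff_has_vector_derivative)
    moreover have "((\<lambda>s. dir_deriv f (\<gamma> s) (\<pi> b)) has_vector_derivative dir_deriv (\<lambda>x. dir_deriv f x (\<pi> b)) (\<gamma> t) v) (at t)" for b
      by (rule dir_deriv_along_curve(2)[OF f(1) sm \<gamma>]) (rule \<pi>)
    ultimately show "((\<lambda>s. \<Sum>b\<in>Basis. (\<omega> s \<bullet> b) *\<^sub>R dir_deriv f (\<gamma> s) (\<pi> b)) has_vector_derivative
      (\<Sum>b\<in>Basis. (\<omega> t \<bullet> b) *\<^sub>R dir_deriv (\<lambda>x. dir_deriv f x (\<pi> b)) (\<gamma> t) v + (\<alpha> \<bullet> b) *\<^sub>R dir_deriv f (\<gamma> t) (\<pi> b))) (at t)"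
      by (intro has_vector_derivative_sum has_vector_derivative_scaleR)
    show "(\<Sum>b\<in>Basis. (\<omega> s \<bullet> b) *\<^sub>R dir_deriv f (\<gamma> s) (\<pi> b)) = dir_deriv f (\<gamma> s) (\<omega> s)" if "s \<in> J" for s
      by (rule dir_deriv_basis_expansion[symmetric, OF f _ _ \<pi>]) (use that \<gamma>(4) \<omega>(2) in auto)
  qed
  have "((\<lambda>s. dir_deriv f (\<gamma> s) (w t)) has_vector_derivative
      (\<Sum>b\<in>Basis. (w t \<bullet> b) *\<^sub>R dir_deriv (\<lambda>x. dir_deriv f x (\<pi> b)) (\<gamma> t) v)) (at t)"
    using expand[of "\<lambda>s. w t" 0] wt by auto
  moreover have "((\<lambda>s. dir_deriv f (\<gamma> s) (w t)) has_vector_derivative dir_deriv (\<lambda>x. dir_deriv f x (w t)) (\<gamma> t) v) (at t)"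
    by (rule dir_deriv_along_curve(2)[OF f(1) sm[OF wt] \<gamma>])
  ultimately have "(\<Sum>b\<in>Basis. (w t \<bullet> b) *\<^sub>R dir_deriv (\<lambda>x. dir_deriv f x (\<pi> b)) (\<gamma> t) v)
      = dir_deriv (\<lambda>x. dir_deriv f x (w t)) (\<gamma> t) v"
    by (rule vector_derivative_unique_at)
  moreover have "(\<Sum>b\<in>Basis. (a \<bullet> b) *\<^sub>R dir_deriv f (\<gamma> t) (\<pi> b)) = dir_deriv f (\<gamma> t) a"
    by (rule dir_deriv_basis_expansion[symmetric, OF f _ aE \<pi>]) (use \<gamma> in auto)
  ultimately show ?thesis using expand[OF w] by (simp add: sum.distrib)
qed

lemma smooth_on_vector_derivative:
  fixes \<gamma> :: "real \<Rightarrow> 'b::real_normed_vector"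
  assumes "open J" "smooth_on J \<gamma>"
  shows "t \<in> J \<Longrightarrow> (\<gamma> has_vector_derivative vector_derivative \<gamma> (at t)) (at t)"
    and "smooth_on J (\<lambda>s. vector_derivative \<gamma> (at s))"
proof -
  have J: "subspace_open UNIV J" using assms(1) by (simp add: subspace_open_def)
  have *: "(\<gamma> has_vector_derivative dir_deriv \<gamma> t 1) (at t)" if t: "t \<in> J" for t
  proof -
    obtain f' where f': "(\<gamma> has_derivative f') (at t)" "\<And>u. dir_deriv \<gamma> t u = f' u"
      using smooth_on_has_derivative[OF J assms(2) t] by auto
    have e: "(\<lambda>h. h *\<^sub>R f' 1) = f'"
    proof
      fix h
      have "f' (h *\<^sub>R 1) = h *\<^sub>R f' 1" by (rule linear_scale[OF has_derivative_linear[OF f'(1)]])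
      then show "h *\<^sub>R f' 1 = f' h" by simp
    qed
    show ?thesis unfolding has_vector_derivative_def f'(2) e by (rule f'(1))
  qed
  then have eq: "vector_derivative \<gamma> (at t) = dir_deriv \<gamma> t 1" if "t \<in> J" for t
    using that by (intro vector_derivative_at) auto
  show "(\<gamma> has_vector_derivative vector_derivative \<gamma> (at t)) (at t)" if "t \<in> J"
    using * eq that by simp
  have "smooth_on J (\<lambda>s. dir_deriv \<gamma> s 1)"
    by (intro smooth_on_dir_deriv[OF J assms(2)] smooth_on_bounded_linear bounded_linear_ident smooth_on_const) auto
  then show "smooth_on J (\<lambda>s. vector_derivative \<gamma> (at s))"
    by (rule smooth_on_cong[rotated]) (simp add: eq)
qed

section \<open>Tangent vectors and smooth fields in charts\<close>

lemma subspace_model: "subspace (model c)"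
  by (simp add: model_def)

text \<open>The manifold and the constraint submanifold are both instances.  The atlas of restricted slice
  charts on the submanifold is not known to be maximal, so only the atlas conditions are assumed.\<close>

locale atlas =
  fixes k :: nat and M :: "'q::topological_space set" and A :: "('q, 'e::euclidean_space) chart set"
  assumes smooth_atlas: "smooth_atlas k M A"
begin

lemma chart: "c \<in> A \<Longrightarrow> chart_on k M c"
  using smooth_atlas by (simp add: smooth_atlas_def)

lemma dom_openin: "c \<in> A \<Longrightarrow> openin (top_of_set M) (chart_dom c)"
  using chart by (simp add: chart_on_def)

lemma dom_subset: "c \<in> A \<Longrightarrow> p \<in> chart_dom c \<Longrightarrow> p \<in> M"
  using dom_openin openin_imp_subset by blast

lemma ex_chart: "p \<in> M \<Longrightarrow> \<exists>c\<in>A. p \<in> chart_dom c"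
  using smooth_atlas by (auto simp: smooth_atlas_def)

lemma chart_at: "p \<in> M \<Longrightarrow> chart_at A p \<in> A \<and> p \<in> chart_dom (chart_at A p)"
  unfolding chart_at_def using ex_chart by (metis (mono_tags, lifting) someI_ex)

lemma homeo: "c \<in> A \<Longrightarrow> homeomorphism (chart_dom c) (chart_map c ` chart_dom c) (chart_map c) (chart_inv c)"
  using chart by (simp add: chart_on_def)

lemma chart_inv_map [simp]: "c \<in> A \<Longrightarrow> p \<in> chart_dom c \<Longrightarrow> chart_inv c (chart_map c p) = p"
  using homeomorphism_apply1[OF homeo] by blast

lemma chart_map_in_model: "p \<in> chart_dom c \<Longrightarrow> chart_map c p \<in> model c"
  by (simp add: model_def span_base)

lemma image_subspace_open:
  assumes "c \<in> A" "openin (top_of_set M) W"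
  shows "subspace_open (model c) (chart_map c ` (chart_dom c \<inter> W))"
proof -
  have "openin (top_of_set M) (chart_dom c \<inter> W)" using dom_openin[OF assms(1)] assms(2) by (rule openin_Int)
  then have "openin (top_of_set (chart_dom c)) (chart_dom c \<inter> W)"
    by (rule openin_subset_trans) (use dom_openin[OF assms(1)] openin_imp_subset in auto)
  then have "openin (top_of_set (chart_map c ` chart_dom c)) (chart_map c ` (chart_dom c \<inter> W))"
    by (rule homeomorphism_imp_open_map[OF homeo[OF assms(1)]])
  moreover have "openin (top_of_set (model c)) (chart_map c ` chart_dom c)"
    using chart[OF assms(1)] by (simp add: chart_on_def)
  ultimately show ?thesis unfolding subspace_open_def using subspace_model openin_trans by blast
qed

lemma image_dom_subspace_open: "c \<in> A \<Longrightarrow> subspace_open (model c) (chart_map c ` chart_dom c)"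
  using image_subspace_open[of c M] dom_subset by (metis inf.absorb1 openin_subtopology_self subsetI)

lemma overlap_subspace_open:
  "c \<in> A \<Longrightarrow> d \<in> A \<Longrightarrow> subspace_open (model c) (chart_map c ` (chart_dom c \<inter> chart_dom d))"
  using image_subspace_open dom_openin by blast

lemma transition_smooth:
  "c \<in> A \<Longrightarrow> d \<in> A \<Longrightarrow> smooth_on (chart_map c ` (chart_dom c \<inter> chart_dom d)) (transition c d)"
  using smooth_atlas by (auto simp: smooth_atlas_def smoothly_compatible_def)

lemma transition_map [simp]: "c \<in> A \<Longrightarrow> p \<in> chart_dom c \<Longrightarrow> transition c d (chart_map c p) = chart_map d p"
  by (simp add: transition_def)

abbreviation D_trans :: "('q, 'e) chart \<Rightarrow> ('q, 'e) chart \<Rightarrow> 'q \<Rightarrow> 'e \<Rightarrow> 'e" where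
  "D_trans c d p u \<equiv> dir_deriv (transition c d) (chart_map c p) u"

lemma frechet_transition:
  assumes "c \<in> A" "d \<in> A" "p \<in> chart_dom c" "p \<in> chart_dom d" "u \<in> model c"
  shows "frechet_derivative (transition c d)
     (at (chart_map c p) within chart_map c ` (chart_dom c \<inter> chart_dom d)) u = D_trans c d p u"
  by (rule frechet_derivative_dir_deriv[OF overlap_subspace_open[OF assms(1,2)] _
      overlap_subspace_open[OF assms(1,2)] _ transition_smooth[OF assms(1,2)] assms(5)])
    (use assms in auto)

lemma D_trans_in_model:
  assumes "c \<in> A" "d \<in> A" "p \<in> chart_dom c" "p \<in> chart_dom d" "u \<in> model c"
  shows "D_trans c d p u \<in> model d"
  by (rule dir_deriv_in_subspace[OF overlap_subspace_open transition_smooth])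
    (use assms in \<open>auto simp: subspace_model intro: chart_map_in_model\<close>)

lemma D_trans_lin:
  assumes "c \<in> A" "d \<in> A" "p \<in> chart_dom c" "p \<in> chart_dom d" "u \<in> model c" "v \<in> model c"
  shows "D_trans c d p (a *\<^sub>R u + b *\<^sub>R v) = a *\<^sub>R D_trans c d p u + b *\<^sub>R D_trans c d p v"
  by (rule dir_deriv_lin[OF overlap_subspace_open transition_smooth]) (use assms in auto)

lemma D_trans_self:
  assumes "c \<in> A" "p \<in> chart_dom c" "u \<in> model c"
  shows "D_trans c c p u = u"
proof -
  have "D_trans c c p u = dir_deriv (\<lambda>x. x) (chart_map c p) u"
    by (rule dir_deriv_cong[OF image_dom_subspace_open]) (use assms in auto)
  also have "\<dots> = u"
    by (rule dir_deriv_eq[OF subspace_model[of c]]) (use assms in \<open>auto intro: chart_map_in_model\<close>)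
  finally show ?thesis .
qed

lemma D_trans_cocycle:
  assumes "c \<in> A" "d \<in> A" "e \<in> A" "p \<in> chart_dom c" "p \<in> chart_dom d" "p \<in> chart_dom e" "u \<in> model c"
  shows "D_trans d e p (D_trans c d p u) = D_trans c e p u"
proof -
  let ?S = "chart_map c ` (chart_dom c \<inter> (chart_dom d \<inter> chart_dom e))"
  have S: "subspace_open (model c) ?S"
    using assms by (intro image_subspace_open openin_Int dom_openin)
  have "D_trans c e p u = dir_deriv (\<lambda>x. transition d e (transition c d x)) (chart_map c p) u"
    by (rule dir_deriv_cong[OF S]) (use assms in auto)
  also have "\<dots> = dir_deriv (transition d e) (transition c d (chart_map c p)) (D_trans c d p u)"
    by (rule dir_deriv_chain[OF S _ _ _ overlap_subspace_open[of d e] transition_smooth[of d e]])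
      (use assms in \<open>auto intro: smooth_on_subset[OF transition_smooth[of c d]]\<close>)
  finally show ?thesis using assms by simp
qed

lemma coord_field_at:
  assumes "c \<in> A" "u \<in> model c"
  shows "coord_field A c u p d = (if d \<in> A \<and> p \<in> chart_dom c \<inter> chart_dom d then D_trans c d p u else 0)"
  using assms by (simp add: coord_field_def frechet_transition)

lemma coord_field_self:
  assumes "c \<in> A" "p \<in> chart_dom c" "u \<in> model c"
  shows "coord_field A c u p c = u"
  using assms by (simp add: coord_field_at D_trans_self)

lemma coord_field_tangent:
  assumes "c \<in> A" "p \<in> chart_dom c" "u \<in> model c"
  shows "coord_field A c u p \<in> tangent_space A p"
  unfolding tangent_space_def
  using assms
  by (auto simp: coord_field_at D_trans_in_model frechet_transition D_trans_cocycle)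

lemma tangent_zero: "v \<in> tangent_space A p \<Longrightarrow> \<not> (d \<in> A \<and> p \<in> chart_dom d) \<Longrightarrow> v d = 0"
  unfolding tangent_space_def by blast

lemma tangent_in_model: "v \<in> tangent_space A p \<Longrightarrow> c \<in> A \<Longrightarrow> p \<in> chart_dom c \<Longrightarrow> v c \<in> model c"
  unfolding tangent_space_def by blast

lemma tangent_transform:
  assumes "v \<in> tangent_space A p" "c \<in> A" "d \<in> A" "p \<in> chart_dom c" "p \<in> chart_dom d"
  shows "v d = D_trans c d p (v c)"
proof -
  have "v d = frechet_derivative (transition c d)
     (at (chart_map c p) within chart_map c ` (chart_dom c \<inter> chart_dom d)) (v c)"
    using assms unfolding tangent_space_def by blast
  then show ?thesis using assms tangent_in_model frechet_transition by auto
qed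

text \<open>A tangent vector is determined by a single component.  Identities between tangent vectors are
  therefore verified in one convenient chart.\<close>

lemma tangent_eq_coord_field:
  assumes "v \<in> tangent_space A p" "c \<in> A" "p \<in> chart_dom c"
  shows "v = coord_field A c (v c) p"
proof
  fix d
  show "v d = coord_field A c (v c) p d"
    using assms tangent_transform[OF assms(1,2), of d] tangent_zero[OF assms(1)]
    by (auto simp: coord_field_at tangent_in_model)
qed

lemma tangent_eqI:
  assumes "v \<in> tangent_space A p" "w \<in> tangent_space A p" "c \<in> A" "p \<in> chart_dom c" "v c = w c"
  shows "v = w"
  using tangent_eq_coord_field assms by metis

lemma tangentI:
  assumes "\<And>d. \<not> (d \<in> A \<and> p \<in> chart_dom d) \<Longrightarrow> v d = 0"
    "\<And>d. d \<in> A \<Longrightarrow> p \<in> chart_dom d \<Longrightarrow> v d \<in> model d"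
    "\<And>c d. c \<in> A \<Longrightarrow> d \<in> A \<Longrightarrow> p \<in> chart_dom c \<Longrightarrow> p \<in> chart_dom d \<Longrightarrow> v d = D_trans c d p (v c)"
  shows "v \<in> tangent_space A p"
  unfolding tangent_space_def mem_Collect_eq
proof (intro conjI allI ballI impI)
  fix c d assume "c \<in> A" "d \<in> A" "p \<in> chart_dom c \<inter> chart_dom d"
  then show "v d = frechet_derivative (transition c d)
      (at (chart_map c p) within chart_map c ` (chart_dom c \<inter> chart_dom d)) (v c)"
    using assms(2)[of c] assms(3)[of c d] frechet_transition[of c d p "v c"] by simp
qed (use assms(1,2) in blast)+

lemma D_trans_zero:
  assumes "c \<in> A" "d \<in> A" "p \<in> chart_dom c" "p \<in> chart_dom d"
  shows "D_trans c d p 0 = 0"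
  using D_trans_lin[OF assms, of 0 0 0 0] by (simp add: subspace_0 subspace_model)

lemma tangent_lin:
  assumes "v \<in> tangent_space A p" "w \<in> tangent_space A p"
  shows "a *\<^sub>R v + b *\<^sub>R w \<in> tangent_space A p"
proof (rule tangentI)
  fix d assume "\<not> (d \<in> A \<and> p \<in> chart_dom d)"
  then show "(a *\<^sub>R v + b *\<^sub>R w) d = 0"
    using assms by (simp add: plus_fun_def scaleR_fun_def tangent_zero)
next
  fix d assume "d \<in> A" "p \<in> chart_dom d"
  then show "(a *\<^sub>R v + b *\<^sub>R w) d \<in> model d"
    using assms unfolding plus_fun_def scaleR_fun_def
    by (intro subspace_add subspace_scale subspace_model tangent_in_model)
next
  fix c d assume "c \<in> A" "d \<in> A" "p \<in> chart_dom c" "p \<in> chart_dom d"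
  then show "(a *\<^sub>R v + b *\<^sub>R w) d = D_trans c d p ((a *\<^sub>R v + b *\<^sub>R w) c)"
    using tangent_transform[OF assms(1), of c d] tangent_transform[OF assms(2), of c d] assms
    by (simp only: plus_fun_def scaleR_fun_def) (simp add: D_trans_lin tangent_in_model)
qed

lemma tangent_0: "0 \<in> tangent_space A p"
  by (rule tangentI) (auto simp: D_trans_zero subspace_0 subspace_model)

lemma subspace_tangent: "subspace (tangent_space A p)"
  unfolding subspace_def using tangent_lin[of _ p _ 1 1] tangent_lin[of _ p 0 _ 0] tangent_0 by simp

lemma tangent_add: "v \<in> tangent_space A p \<Longrightarrow> w \<in> tangent_space A p \<Longrightarrow> v + w \<in> tangent_space A p"
  and tangent_scale: "v \<in> tangent_space A p \<Longrightarrow> a *\<^sub>R v \<in> tangent_space A p"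
  and tangent_diff: "v \<in> tangent_space A p \<Longrightarrow> w \<in> tangent_space A p \<Longrightarrow> v - w \<in> tangent_space A p"
  and tangent_neg: "v \<in> tangent_space A p \<Longrightarrow> - v \<in> tangent_space A p"
  by (simp_all add: subspace_tangent subspace_add subspace_scale subspace_diff subspace_neg)

lemma coord_field_lin:
  assumes "c \<in> A" "p \<in> chart_dom c" "u \<in> model c" "w \<in> model c"
  shows "coord_field A c (a *\<^sub>R u + b *\<^sub>R w) p = a *\<^sub>R coord_field A c u p + b *\<^sub>R coord_field A c w p"
proof -
  have m: "a *\<^sub>R u + b *\<^sub>R w \<in> model c"
    using assms by (intro subspace_add subspace_scale subspace_model)
  show ?thesis
    by (rule tangent_eqI[OF coord_field_tangent tangent_lin[OF coord_field_tangent coord_field_tangent]])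
      (use assms m in \<open>auto simp: plus_fun_def scaleR_fun_def coord_field_self\<close>)
qed

lemma coord_field_zero: "c \<in> A \<Longrightarrow> p \<in> chart_dom c \<Longrightarrow> coord_field A c 0 p = 0"
  using coord_field_lin[of c p 0 0 0 0] by (simp add: subspace_0 subspace_model)

lemma coord_field_sum:
  assumes "c \<in> A" "p \<in> chart_dom c" "\<And>i. i \<in> I \<Longrightarrow> u i \<in> model c"
  shows "coord_field A c (\<Sum>i\<in>I. a i *\<^sub>R u i) p = (\<Sum>i\<in>I. a i *\<^sub>R coord_field A c (u i) p)"
  using assms(3)
proof (induction I rule: infinite_finite_induct)
  case (insert i I)
  have "(\<Sum>i\<in>I. a i *\<^sub>R u i) \<in> model c"
    by (rule subspace_sum[OF subspace_model]) (use insert in \<open>auto intro: subspace_scale subspace_model\<close>)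
  then show ?case using insert coord_field_lin[OF assms(1,2), of "u i" _ "a i" 1] by simp
qed (use coord_field_zero assms in auto)

lemma smooth_field_rep:
  "smooth_vector_field A W Y \<Longrightarrow> c \<in> A \<Longrightarrow>
   smooth_on (chart_map c ` (chart_dom c \<inter> W)) (\<lambda>x. Y (chart_inv c x) c)"
  by (simp add: smooth_vector_field_def)

lemma smooth_field_tangent: "smooth_vector_field A W Y \<Longrightarrow> p \<in> W \<Longrightarrow> Y p \<in> tangent_space A p"
  by (simp add: smooth_vector_field_def)

lemma smooth_field_subset:
  "smooth_vector_field A W Y \<Longrightarrow> W' \<subseteq> W \<Longrightarrow> smooth_vector_field A W' Y"
  unfolding smooth_vector_field_def
  by (metis (no_types, lifting) Int_mono image_mono smooth_on_subset subset_iff subset_refl)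

lemma smooth_field_cong:
  assumes "smooth_vector_field A W Y" "\<And>p. p \<in> W \<Longrightarrow> Y p = Z p"
  shows "smooth_vector_field A W Z"
  unfolding smooth_vector_field_def
proof (intro conjI ballI)
  fix p assume "p \<in> W" then show "Z p \<in> tangent_space A p"
    using assms by (metis smooth_field_tangent)
next
  fix c assume c: "c \<in> A"
  show "smooth_on (chart_map c ` (chart_dom c \<inter> W)) (\<lambda>x. Z (chart_inv c x) c)"
    by (rule smooth_on_cong[OF _ smooth_field_rep[OF assms(1) c]]) (use c assms(2) in auto)
qed

lemma smooth_field_add:
  assumes "smooth_vector_field A W Y" "smooth_vector_field A W Z"
  shows "smooth_vector_field A W (\<lambda>p. Y p + Z p)"
  unfolding smooth_vector_field_def
proof (intro conjI ballI)
  show "Y p + Z p \<in> tangent_space A p" if "p \<in> W" for p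
    using assms that by (intro tangent_add smooth_field_tangent)
next
  fix c assume c: "c \<in> A"
  show "smooth_on (chart_map c ` (chart_dom c \<inter> W)) (\<lambda>x. (Y (chart_inv c x) + Z (chart_inv c x)) c)"
    unfolding plus_fun_def by (intro smooth_on_add smooth_field_rep assms c)
qed

lemma smooth_field_scale:
  assumes "smooth_vector_field A W Y" "smooth_fun A W f"
  shows "smooth_vector_field A W (\<lambda>p. f p *\<^sub>R Y p)"
  unfolding smooth_vector_field_def
proof (intro conjI ballI)
  show "f p *\<^sub>R Y p \<in> tangent_space A p" if "p \<in> W" for p
    using assms that by (intro tangent_scale smooth_field_tangent)
next
  fix c assume c: "c \<in> A"
  have "smooth_on (chart_map c ` (chart_dom c \<inter> W)) (\<lambda>x. f (chart_inv c x))"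
    using assms(2) c by (simp add: smooth_fun_def comp_def)
  then show "smooth_on (chart_map c ` (chart_dom c \<inter> W)) (\<lambda>x. (f (chart_inv c x) *\<^sub>R Y (chart_inv c x)) c)"
    unfolding scaleR_fun_def by (intro smooth_on_scaleR smooth_field_rep assms c)
qed

lemma smooth_on_change_chart:
  assumes "c \<in> A" "d \<in> A" "smooth_on (chart_map c ` (chart_dom c \<inter> W)) f"
  shows "smooth_on (chart_map d ` (chart_dom d \<inter> chart_dom c \<inter> W)) (\<lambda>x. f (transition d c x))"
  by (rule smooth_on_compose[OF assms(3)])
    (use assms in \<open>auto intro: smooth_on_subset[OF transition_smooth[of d c]]\<close>)

lemma smooth_fun_from_chart:
  assumes "c \<in> A" "W \<subseteq> chart_dom c" "smooth_on (chart_map c ` W) (\<lambda>x. f (chart_inv c x))"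
  shows "smooth_fun A W f"
  unfolding smooth_fun_def comp_def
proof
  fix d assume d: "d \<in> A"
  have [simp]: "chart_dom c \<inter> W = W" "chart_dom d \<inter> chart_dom c \<inter> W = chart_dom d \<inter> W" using assms by auto
  show "smooth_on (chart_map d ` (chart_dom d \<inter> W)) (\<lambda>x. f (chart_inv d x))"
    by (rule smooth_on_cong[OF _ smooth_on_change_chart[OF assms(1) d, of W, simplified, OF assms(3)]])
      (use assms d in auto)
qed

text \<open>Smoothness in the chart \<open>c\<close> passes to any other chart \<open>d\<close>, because the component in \<open>d\<close> is the
  derivative of a transition map applied to \<open>y\<close>, both composed with the opposite transition map.\<close>

lemma smooth_field_from_chart:
  assumes c: "c \<in> A" "W \<subseteq> chart_dom c" and y: "smooth_on (chart_map c ` W) y" "y ` chart_map c ` W \<subseteq> model c"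
  shows "smooth_vector_field A W (\<lambda>p. coord_field A c (y (chart_map c p)) p)"
  unfolding smooth_vector_field_def
proof (intro conjI ballI)
  show "coord_field A c (y (chart_map c p)) p \<in> tangent_space A p" if "p \<in> W" for p
    using that assms by (intro coord_field_tangent) auto
next
  fix d assume d: "d \<in> A"
  let ?S = "chart_map d ` (chart_dom d \<inter> W)"
  have [simp]: "chart_dom c \<inter> W = W" "chart_dom d \<inter> chart_dom c \<inter> W = chart_dom d \<inter> W" using assms by auto
  have yw: "smooth_on ?S (\<lambda>x. y (transition d c x))"
    using smooth_on_change_chart[OF c(1) d, of W y] y(1) by simp
  have tr: "smooth_on ?S (transition d c)"
    by (rule smooth_on_subset[OF transition_smooth[OF d c(1)]]) (use c in auto)
  show "smooth_on ?S (\<lambda>x. coord_field A c (y (chart_map c (chart_inv d x))) (chart_inv d x) d)"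
  proof (rule smooth_on_cong)
    show "smooth_on ?S (\<lambda>x. dir_deriv (transition c d) (transition d c x) (y (transition d c x)))"
      by (rule smooth_on_dir_deriv[OF overlap_subspace_open[OF c(1) d] transition_smooth[OF c(1) d] tr _ yw])
        (use c d y in auto)
  next
    fix x assume "x \<in> ?S"
    then obtain p where p: "p \<in> chart_dom d" "p \<in> W" "x = chart_map d p" by auto
    then have "y (chart_map c p) \<in> model c" using y by auto
    then show "dir_deriv (transition c d) (transition d c x) (y (transition d c x)) =
      coord_field A c (y (chart_map c (chart_inv d x))) (chart_inv d x) d"
      using p c d by (auto simp: coord_field_at)
  qed
qed

lemma smooth_coord_field:
  assumes "c \<in> A" "u \<in> model c"
  shows "smooth_vector_field A (chart_dom c) (coord_field A c u)"
  using smooth_field_from_chart[OF assms(1) order_refl smooth_on_const, of u] assms by auto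

text \<open>The differential is defined in a chart picked by the choice operator; by the chain rule every chart
  around the point gives the same value.\<close>

lemma dfun_eq:
  assumes W: "openin (top_of_set M) W" "smooth_fun A W f"
    and p: "c \<in> A" "p \<in> chart_dom c" "p \<in> W" and v: "v \<in> tangent_space A p"
  shows "dfun A f p v = dir_deriv (\<lambda>x. f (chart_inv c x)) (chart_map c p) (v c)"
proof -
  define c0 where "c0 = chart_at A p"
  have c0: "c0 \<in> A" "p \<in> chart_dom c0" using chart_at dom_subset p unfolding c0_def by blast+
  have sm: "smooth_on (chart_map d ` (chart_dom d \<inter> W)) (\<lambda>x. f (chart_inv d x))" if "d \<in> A" for d
    using W(2) that by (simp add: smooth_fun_def comp_def)
  have "dfun A f p v = frechet_derivative (\<lambda>x. f (chart_inv c0 x)) (at (chart_map c0 p) within chart_map c0 ` chart_dom c0) (v c0)"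
    by (simp add: dfun_def c0_def comp_def Let_def)
  also have "\<dots> = dir_deriv (\<lambda>x. f (chart_inv c0 x)) (chart_map c0 p) (v c0)"
    by (rule frechet_derivative_dir_deriv[OF image_dom_subspace_open[OF c0(1)] _ image_subspace_open[OF c0(1) W(1)] _ sm])
      (use c0 p v tangent_in_model in auto)
  also have "\<dots> = dir_deriv (\<lambda>x. f (chart_inv c0 x)) (transition c c0 (chart_map c p)) (D_trans c c0 p (v c))"
    using p c0 v tangent_transform[of v p c c0] by simp
  also have "\<dots> = dir_deriv (\<lambda>x. f (chart_inv c0 (transition c c0 x))) (chart_map c p) (v c)"
  proof (rule dir_deriv_chain[symmetric, OF image_subspace_open[OF p(1), of "chart_dom c0 \<inter> W"] _ _ _
        image_subspace_open[OF c0(1) W(1)] sm[OF c0(1)]])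
    show "openin (top_of_set M) (chart_dom c0 \<inter> W)" using W c0 dom_openin by (intro openin_Int) auto
    show "smooth_on (chart_map c ` (chart_dom c \<inter> (chart_dom c0 \<inter> W))) (transition c c0)"
      by (rule smooth_on_subset[OF transition_smooth[OF p(1) c0(1)]]) auto
  qed (use c0 p v tangent_in_model in auto)
  also have "\<dots> = dir_deriv (\<lambda>x. f (chart_inv c x)) (chart_map c p) (v c)"
  proof (rule dir_deriv_cong[OF image_subspace_open[OF p(1), of "chart_dom c0 \<inter> W"]])
    show "openin (top_of_set M) (chart_dom c0 \<inter> W)" using W c0 dom_openin by (intro openin_Int) auto
  qed (use c0 p v tangent_in_model in auto)
  finally show ?thesis .
qed

end

section \<open>Connections in charts\<close>

definition christoffel ::
  "('q, 'e::euclidean_space) chart set \<Rightarrow> ('q, 'e) conn \<Rightarrow> ('q, 'e) chart \<Rightarrow> 'q \<Rightarrow> 'e \<Rightarrow> 'e \<Rightarrow> 'e" where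
  "christoffel A D c p u w = D p (coord_field A c u p) (coord_field A c w) c"

text \<open>What the comparison of two equations of motion uses of a connection.  Affine connections have this
  form; the induced connection is given by an operator on arbitrary extensions, for which this form
  is obtained directly.\<close>

definition has_christoffel_form ::
  "'q::topological_space set \<Rightarrow> ('q, 'e::euclidean_space) chart set \<Rightarrow> ('q, 'e) conn \<Rightarrow> bool" where
  "has_christoffel_form M A D \<longleftrightarrow>
     (\<forall>W Y p v. openin (top_of_set M) W \<longrightarrow> smooth_vector_field A W Y \<longrightarrow> p \<in> W \<longrightarrow> v \<in> tangent_space A p \<longrightarrow>
        D p v Y \<in> tangent_space A p \<and>
        (\<forall>c\<in>A. p \<in> chart_dom c \<longrightarrow>
           D p v Y c = dir_deriv (\<lambda>x. Y (chart_inv c x) c) (chart_map c p) (v c)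
                       + christoffel A D c p (v c) (Y p c)))"

lemma sum_apply:
  fixes f :: "'i \<Rightarrow> 'a \<Rightarrow> 'b::comm_monoid_add"
  shows "(\<Sum>i\<in>I. f i) x = (\<Sum>i\<in>I. f i x)"
  by (induction I rule: infinite_finite_induct) (auto simp: plus_fun_def)

context atlas
begin

lemma smooth_field_zero: "smooth_vector_field A W (\<lambda>x. 0)"
  unfolding smooth_vector_field_def
  by (intro conjI ballI tangent_0) (subst zero_fun_def, rule smooth_on_const)

lemma smooth_field_sum:
  "finite I \<Longrightarrow> (\<And>i. i \<in> I \<Longrightarrow> smooth_vector_field A W (Y i)) \<Longrightarrow> smooth_vector_field A W (\<lambda>x. \<Sum>i\<in>I. Y i x)"
  by (induction I rule: finite_induct) (auto intro: smooth_field_zero smooth_field_add)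

lemma
  assumes "affine_connection M A D" "openin (top_of_set M) W" "smooth_vector_field A W Y" "p \<in> W" "v \<in> tangent_space A p"
  shows affine_tangent: "D p v Y \<in> tangent_space A p"
    and affine_left_lin: "w \<in> tangent_space A p \<Longrightarrow> D p (a *\<^sub>R v + b *\<^sub>R w) Y = a *\<^sub>R D p v Y + b *\<^sub>R D p w Y"
    and affine_add: "smooth_vector_field A W Z \<Longrightarrow> D p v (\<lambda>x. Y x + Z x) = D p v Y + D p v Z"
    and affine_cong: "smooth_vector_field A W Z \<Longrightarrow> (\<And>x. x \<in> W \<Longrightarrow> Y x = Z x) \<Longrightarrow> D p v Y = D p v Z"
    and affine_leibniz: "smooth_fun A W f \<Longrightarrow> D p v (\<lambda>x. f x *\<^sub>R Y x) = dfun A f p v *\<^sub>R Y p + f p *\<^sub>R D p v Y"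
  using assms(1)[unfolded affine_connection_def, THEN spec, THEN spec, THEN mp, OF conjI[OF assms(2,3)],
      THEN conjunct1, THEN bspec, OF assms(4), THEN bspec, OF assms(5)]
  by blast+

lemma affine_sum:
  assumes D: "affine_connection M A D" "openin (top_of_set M) W" "p \<in> W" "v \<in> tangent_space A p"
    and I: "finite I"
  shows "(\<And>i. i \<in> I \<Longrightarrow> smooth_vector_field A W (Y i)) \<Longrightarrow> D p v (\<lambda>x. \<Sum>i\<in>I. Y i x) = (\<Sum>i\<in>I. D p v (Y i))"
  using I
proof (induction I rule: finite_induct)
  case empty
  have "D p v (\<lambda>x. 0 + 0) = D p v (\<lambda>x. 0) + D p v (\<lambda>x. 0)"
    by (rule affine_add[OF D(1,2) smooth_field_zero D(3,4) smooth_field_zero])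
  then have "D p v (\<lambda>x. 0) = 0" by simp
  then show ?case by (simp only: sum.empty)
next
  case (insert i I)
  have "D p v (\<lambda>x. Y i x + (\<Sum>i\<in>I. Y i x)) = D p v (Y i) + D p v (\<lambda>x. \<Sum>i\<in>I. Y i x)"
    using insert by (intro affine_add[OF D(1,2) _ D(3,4)] smooth_field_sum) auto
  moreover have "D p v (\<lambda>x. \<Sum>i\<in>I. Y i x) = (\<Sum>i\<in>I. D p v (Y i))"
    using insert by blast
  ultimately show ?case by (simp only: sum.insert[OF insert.hyps])
qed

lemma dir_deriv_coord_field_rep:
  assumes "c \<in> A" "p \<in> chart_dom c" "u \<in> model c" "w \<in> model c"
  shows "dir_deriv (\<lambda>x. coord_field A c w (chart_inv c x) c) (chart_map c p) u = 0"
proof -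
  have "dir_deriv (\<lambda>x. coord_field A c w (chart_inv c x) c) (chart_map c p) u = dir_deriv (\<lambda>x. w) (chart_map c p) u"
    by (rule dir_deriv_cong[OF image_dom_subspace_open]) (use assms in \<open>auto simp: coord_field_self\<close>)
  then show ?thesis by simp
qed

text \<open>Near \<open>p\<close> the field \<open>Y\<close> is a combination of coordinate fields with the components of \<open>Y\<close> as coefficients;
  the Leibniz rule separates the derivative of the coefficients from that of the fields.  Projecting
  the standard basis to the model space by \<open>\<pi>\<close> gives a spanning family of it for which these
  coefficients are smooth.\<close>

lemma affine_chart_expansion:
  assumes D: "affine_connection M A D" "openin (top_of_set M) W" "smooth_vector_field A W Y" "p \<in> W" "v \<in> tangent_space A p"
    and c: "c \<in> A" "p \<in> chart_dom c"
    and \<pi>: "bounded_linear \<pi>" "\<And>x. \<pi> x \<in> model c" "\<And>x. x \<in> model c \<Longrightarrow> \<pi> x = x"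
  shows "D p v Y c = dir_deriv (\<lambda>x. Y (chart_inv c x) c) (chart_map c p) (v c)
           + (\<Sum>b\<in>Basis. (Y p c \<bullet> b) *\<^sub>R D p v (coord_field A c (\<pi> b)) c)"
proof -
  define W' where "W' = chart_dom c \<inter> W"
  have W': "openin (top_of_set M) W'" "p \<in> W'" "W' \<subseteq> chart_dom c" "W' \<subseteq> W"
    using D(2,4) c dom_openin[OF c(1)] by (auto simp: W'_def)
  have Y': "smooth_vector_field A W' Y" using smooth_field_subset D(3) W' by blast
  define f where "f b x = Y x c \<bullet> b" for b x
  have rep: "smooth_on (chart_map c ` W') (\<lambda>x. Y (chart_inv c x) c)"
    using smooth_field_rep[OF D(3) c(1)] by (simp add: W'_def)
  have f: "smooth_fun A W' (f b)" for b
    unfolding f_def by (rule smooth_fun_from_chart[OF c(1) W'(3)]) (rule smooth_on_inner_const[OF rep])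
  have E: "smooth_vector_field A W' (coord_field A c (\<pi> b))" for b
    using smooth_field_subset[OF smooth_coord_field[OF c(1)]] W' \<pi> by blast
  have fE: "smooth_vector_field A W' (\<lambda>x. f b x *\<^sub>R coord_field A c (\<pi> b) x)" for b
    by (rule smooth_field_scale[OF E f])
  have pe: "(\<Sum>b\<in>Basis. (z \<bullet> b) *\<^sub>R \<pi> b) = z" if "z \<in> model c" for z
    using linear_basis_expansion[OF bounded_linear.linear[OF \<pi>(1)], of z] \<pi>(3)[OF that] by simp
  have "D p v Y = D p v (\<lambda>x. \<Sum>b\<in>Basis. f b x *\<^sub>R coord_field A c (\<pi> b) x)"
  proof (rule affine_cong[OF D(1) W'(1) Y' W'(2) D(5)])
    show "smooth_vector_field A W' (\<lambda>x. \<Sum>b\<in>Basis. f b x *\<^sub>R coord_field A c (\<pi> b) x)"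
      by (rule smooth_field_sum[OF finite_Basis fE])
    fix x assume "x \<in> W'"
    then have x: "x \<in> chart_dom c" "Y x \<in> tangent_space A x"
      using W' Y' smooth_field_tangent by blast+
    then have "Y x = coord_field A c (\<Sum>b\<in>Basis. (Y x c \<bullet> b) *\<^sub>R \<pi> b) x"
      using tangent_eq_coord_field[OF x(2) c(1) x(1)] pe[OF tangent_in_model[OF x(2) c(1) x(1)]] by simp
    then show "Y x = (\<Sum>b\<in>Basis. f b x *\<^sub>R coord_field A c (\<pi> b) x)"
      using coord_field_sum[OF c(1) x(1), of Basis \<pi>] \<pi>(2) by (simp add: f_def)
  qed
  also have "\<dots> = (\<Sum>b\<in>Basis. D p v (\<lambda>x. f b x *\<^sub>R coord_field A c (\<pi> b) x))"
    by (rule affine_sum[OF D(1) W'(1,2) D(5) finite_Basis fE])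
  also have "\<dots> = (\<Sum>b\<in>Basis. dfun A (f b) p v *\<^sub>R coord_field A c (\<pi> b) p + f b p *\<^sub>R D p v (coord_field A c (\<pi> b)))"
    by (rule sum.cong[OF refl affine_leibniz[OF D(1) W'(1) E W'(2) D(5) f]])
  finally have eq: "D p v Y c = (\<Sum>b\<in>Basis. dfun A (f b) p v *\<^sub>R \<pi> b + f b p *\<^sub>R D p v (coord_field A c (\<pi> b)) c)"
    using c \<pi>(2) by (simp add: plus_fun_def scaleR_fun_def sum_apply coord_field_self)
  let ?y = "\<lambda>x. Y (chart_inv c x) c"
  have S: "subspace_open (model c) (chart_map c ` W')"
    using image_subspace_open[OF c(1) D(2)] by (simp add: W'_def)
  have df: "dfun A (f b) p v = dir_deriv ?y (chart_map c p) (v c) \<bullet> b" for b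
  proof -
    have "dfun A (f b) p v = dir_deriv (\<lambda>x. ?y x \<bullet> b) (chart_map c p) (v c)"
      using dfun_eq[OF W'(1) f c W'(2) D(5)] by (simp add: f_def)
    also have "\<dots> = dir_deriv ?y (chart_map c p) (v c) \<bullet> b"
      by (rule dir_deriv_linear_comp[OF S rep _ _ bounded_linear_inner_left])
        (use W' D(5) c tangent_in_model in auto)
    finally show ?thesis .
  qed
  have "dir_deriv ?y (chart_map c p) (v c) \<in> model c"
  proof (rule dir_deriv_in_subspace[OF S rep _ _ subspace_model])
    have "Y x c \<in> model c" if "x \<in> W'" for x
      using that W'(3) c(1) tangent_in_model[OF smooth_field_tangent[OF Y' that], of c] by blast
    then show "?y ` chart_map c ` W' \<subseteq> model c" using W'(3) c(1) by auto
  qed (use W' D(5) c tangent_in_model in auto)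
  from pe[OF this] show ?thesis unfolding eq df by (simp add: sum.distrib f_def)
qed

lemma affine_christoffel:
  assumes D: "affine_connection M A D" and c: "c \<in> A" "p \<in> chart_dom c" "u \<in> model c" "w \<in> model c"
    and \<pi>: "bounded_linear \<pi>" "\<And>x. \<pi> x \<in> model c" "\<And>x. x \<in> model c \<Longrightarrow> \<pi> x = x"
  shows "christoffel A D c p u w = (\<Sum>b\<in>Basis. (w \<bullet> b) *\<^sub>R christoffel A D c p u (\<pi> b))"
  using affine_chart_expansion[OF D dom_openin[OF c(1)] smooth_coord_field[OF c(1,4)] c(2) coord_field_tangent[OF c(1-3)] c(1,2) \<pi>] c
  by (simp add: christoffel_def dir_deriv_coord_field_rep coord_field_self)

theorem affine_has_christoffel_form:
  assumes D: "affine_connection M A D"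
  shows "has_christoffel_form M A D"
  unfolding has_christoffel_form_def
proof (intro allI impI conjI ballI)
  fix W Y p v assume *: "openin (top_of_set M) W" "smooth_vector_field A W Y" "p \<in> W" "v \<in> tangent_space A p"
  show "D p v Y \<in> tangent_space A p" using D * by (rule affine_tangent)
  fix c assume c: "c \<in> A" "p \<in> chart_dom c"
  obtain \<pi> where \<pi>: "bounded_linear \<pi>" "\<And>x. \<pi> x \<in> model c" "\<And>x. x \<in> model c \<Longrightarrow> \<pi> x = x"
    using ex_linear_projection[OF subspace_model] by blast
  have v: "v c \<in> model c" "coord_field A c (v c) p = v"
    using tangent_in_model[OF *(4) c] tangent_eq_coord_field[OF *(4) c] by simp_all
  have Yp: "Y p c \<in> model c" using tangent_in_model[OF smooth_field_tangent[OF *(2,3)] c] .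
  show "D p v Y c = dir_deriv (\<lambda>x. Y (chart_inv c x) c) (chart_map c p) (v c) + christoffel A D c p (v c) (Y p c)"
    using affine_chart_expansion[OF D * c \<pi>] affine_christoffel[OF D c v(1) Yp \<pi>] v(2)
    by (simp add: christoffel_def)
qed

lemma affine_christoffel_lin_right:
  assumes D: "affine_connection M A D" and c: "c \<in> A" "p \<in> chart_dom c" "u \<in> model c" "w \<in> model c" "z \<in> model c"
  shows "christoffel A D c p u (a *\<^sub>R w + b *\<^sub>R z) = a *\<^sub>R christoffel A D c p u w + b *\<^sub>R christoffel A D c p u z"
proof -
  obtain \<pi> where \<pi>: "bounded_linear \<pi>" "\<And>x. \<pi> x \<in> model c" "\<And>x. x \<in> model c \<Longrightarrow> \<pi> x = x"
    using ex_linear_projection[OF subspace_model] by blast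
  have m: "a *\<^sub>R w + b *\<^sub>R z \<in> model c" using c by (intro subspace_add subspace_scale subspace_model)
  show ?thesis
    using affine_christoffel[OF D c(1-3) m \<pi>] affine_christoffel[OF D c(1-3,4) \<pi>] affine_christoffel[OF D c(1-3,5) \<pi>]
    by (simp add: inner_add_left scaleR_add_left sum.distrib scaleR_sum_right)
qed

lemma torsion_free_christoffel_sym:
  assumes "torsion_free M A D" "c \<in> A" "p \<in> chart_dom c" "u \<in> model c" "w \<in> model c"
  shows "christoffel A D c p u w = christoffel A D c p w u"
proof -
  let ?E = "coord_field A c"
  have "D p (?E u p) (?E w) - D p (?E w p) (?E u) = lie_bracket A (?E u) (?E w) p"
    using assms(1)[unfolded torsion_free_def, rule_format, of "chart_dom c" "?E u" "?E w" p]
      dom_openin[OF assms(2)] smooth_coord_field assms by simp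
  moreover have "lie_bracket A (?E u) (?E w) p c = 0"
  proof -
    have "frechet_derivative (\<lambda>x. ?E z (chart_inv c x) c) (at (chart_map c p) within chart_map c ` chart_dom c) y = 0"
      if "z \<in> model c" "y \<in> model c" for z y
    proof -
      have "smooth_on (chart_map c ` chart_dom c) (\<lambda>x. ?E z (chart_inv c x) c)"
        using smooth_field_rep[OF smooth_coord_field[OF assms(2) that(1)] assms(2)] by simp
      then have "frechet_derivative (\<lambda>x. ?E z (chart_inv c x) c) (at (chart_map c p) within chart_map c ` chart_dom c) y
          = dir_deriv (\<lambda>x. ?E z (chart_inv c x) c) (chart_map c p) y"
        using that assms by (intro frechet_derivative_dir_deriv[OF image_dom_subspace_open[OF assms(2)] _ image_dom_subspace_open[OF assms(2)]]) auto
      then show ?thesis using dir_deriv_coord_field_rep assms that by simp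
    qed
    then show ?thesis using assms by (simp add: lie_bracket_def coord_field_self)
  qed
  ultimately have "(D p (?E u p) (?E w) - D p (?E w p) (?E u)) c = 0" by simp
  then show ?thesis by (simp add: christoffel_def fun_diff_def)
qed

lemma
  assumes "riemannian_metric M A g" "p \<in> M" "v \<in> tangent_space A p" "w \<in> tangent_space A p"
  shows metric_sym: "g p v w = g p w v"
    and metric_pos: "v \<noteq> 0 \<Longrightarrow> g p v v > 0"
    and metric_lin_right: "z \<in> tangent_space A p \<Longrightarrow> g p v (a *\<^sub>R w + b *\<^sub>R z) = a * g p v w + b * g p v z"
  using assms unfolding riemannian_metric_def linear_functional_on_def by blast+

lemma metric_lin_left:
  assumes "riemannian_metric M A g" "p \<in> M" "v \<in> tangent_space A p" "w \<in> tangent_space A p" "z \<in> tangent_space A p"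
  shows "g p (a *\<^sub>R v + b *\<^sub>R w) z = a * g p v z + b * g p w z"
  using metric_sym[OF assms(1,2) _ assms(5)] metric_lin_right[OF assms(1,2,5,3,4)] assms tangent_lin by simp

lemma metric_nondegenerate:
  assumes g: "riemannian_metric M A g" "p \<in> M" and vw: "v \<in> tangent_space A p" "w \<in> tangent_space A p"
    and eq: "\<And>z. z \<in> tangent_space A p \<Longrightarrow> g p v z = g p w z"
  shows "v = w"
proof (rule ccontr)
  assume "v \<noteq> w"
  have d: "v - w \<in> tangent_space A p" using vw by (rule tangent_diff)
  have "g p (1 *\<^sub>R v + (- 1) *\<^sub>R w) (v - w) = 0"
    using metric_lin_left[OF g vw d, of 1 "- 1"] eq[OF d] by simp
  then show False using metric_pos[OF g d d] \<open>v \<noteq> w\<close> by simp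
qed

text \<open>The difference of the two connections, made trilinear with the metric, is symmetric in its first
  two arguments as torsion vanishes, and skew in its last two arguments by compatibility with the
  metric.\<close>

theorem levi_civita_christoffel_unique:
  assumes g: "riemannian_metric M A g" and D: "levi_civita M A g D1" "levi_civita M A g D2"
    and c: "c \<in> A" "p \<in> chart_dom c" "u \<in> model c" "w \<in> model c"
  shows "christoffel A D1 c p u w = christoffel A D2 c p u w"
proof -
  have p: "p \<in> M" using c dom_subset by blast
  let ?E = "coord_field A c"
  define G where "G D x y z = g p (D p (?E x p) (?E y)) (?E z p)" for D x y z
  have E: "smooth_vector_field A (chart_dom c) (?E z)" "?E z p \<in> tangent_space A p" if "z \<in> model c" for z
    using that c smooth_coord_field coord_field_tangent by auto
  have DT: "D p (?E x p) (?E y) \<in> tangent_space A p"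
    if "levi_civita M A g D" "x \<in> model c" "y \<in> model c" for D x y
    using that c E affine_tangent[OF _ dom_openin[OF c(1)]] by (auto simp: levi_civita_def)
  have sym: "D p (?E x p) (?E y) = D p (?E y p) (?E x)"
    if "levi_civita M A g D" "x \<in> model c" "y \<in> model c" for D x y
    using tangent_eqI[OF DT[OF that] DT[OF that(1,3,2)] c(1,2)] torsion_free_christoffel_sym[of D c p x y] that c
    by (simp add: levi_civita_def christoffel_def)
  have compat: "dfun A (\<lambda>x'. g x' (?E y x') (?E z x')) p (?E x p) = G D x y z + G D x z y"
    if "levi_civita M A g D" "x \<in> model c" "y \<in> model c" "z \<in> model c" for D x y z
  proof -
    have "metric_compatible M A g D" using that by (simp add: levi_civita_def)
    then have "dfun A (\<lambda>x'. g x' (?E y x') (?E z x')) p (?E x p)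
        = g p (D p (?E x p) (?E y)) (?E z p) + g p (?E y p) (D p (?E x p) (?E z))"
      unfolding metric_compatible_def using E that dom_openin[OF c(1)] c(2) by blast
    then show ?thesis using metric_sym[OF g p] E DT that by (simp add: G_def)
  qed
  define B where "B x y z = G D1 x y z - G D2 x y z" for x y z
  have B1: "B x y z = B y x z" if "x \<in> model c" "y \<in> model c" for x y z
    using sym D that by (simp add: B_def G_def)
  have B2: "B x y z = - B x z y" if "x \<in> model c" "y \<in> model c" "z \<in> model c" for x y z
    using compat[OF D(1) that] compat[OF D(2) that] by (simp add: B_def)
  \<comment> \<open>The braid argument: a trilinear form that is symmetric in one pair of arguments and skew in
    another vanishes.\<close>
  have B0: "B u w z = 0" if "z \<in> model c" for z
    using B1[of u w z] B2[of w u z] B1[of w z u] B2[of z w u] B1[of z u w] B2[of u z w] c that by linarith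
  have "D1 p (?E u p) (?E w) = D2 p (?E u p) (?E w)"
  proof (rule metric_nondegenerate[OF g p DT[OF D(1) c(3,4)] DT[OF D(2) c(3,4)]])
    fix z assume z: "z \<in> tangent_space A p"
    from B0[OF tangent_in_model[OF z c(1,2)]]
    show "g p (D1 p (?E u p) (?E w)) z = g p (D2 p (?E u p) (?E w)) z"
      using tangent_eq_coord_field[OF z c(1,2)] by (simp add: B_def G_def)
  qed
  then show ?thesis by (simp add: christoffel_def)
qed

end

section \<open>Curves and covariant acceleration\<close>

context atlas
begin

lemma open_curve_preimage:
  assumes "open I" "smooth_curve M A I q" "c \<in> A"
  shows "open {s \<in> I. q s \<in> chart_dom c}"
proof -
  obtain T where T: "open T" "chart_dom c = M \<inter> T"
    using dom_openin[OF assms(3)] unfolding openin_open by blast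
  have "open {s \<in> I. q s \<in> T}"
    using continuous_open_preimage[OF _ assms(1) T(1), of q] assms(2)
    by (simp add: smooth_curve_def vimage_def Int_def)
  moreover have "{s \<in> I. q s \<in> chart_dom c} = {s \<in> I. q s \<in> T}"
    using T assms(2) by (auto simp: smooth_curve_def)
  ultimately show ?thesis by simp
qed

lemma curve_smooth:
  "smooth_curve M A I q \<Longrightarrow> c \<in> A \<Longrightarrow> smooth_on {s \<in> I. q s \<in> chart_dom c} (\<lambda>s. chart_map c (q s))"
  by (simp add: smooth_curve_def comp_def)

lemma velocity_at:
  "c \<in> A \<Longrightarrow> q t \<in> chart_dom c \<Longrightarrow> velocity A q t c = vector_derivative (\<lambda>s. chart_map c (q s)) (at t)"
  by (simp add: velocity_def comp_def)

lemma curve_has_velocity: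
  assumes "open I" "smooth_curve M A I q" "c \<in> A" "t \<in> I" "q t \<in> chart_dom c"
  shows "((\<lambda>s. chart_map c (q s)) has_vector_derivative velocity A q t c) (at t)"
  using smooth_on_vector_derivative(1)[OF open_curve_preimage[OF assms(1-3)] curve_smooth[OF assms(2,3)]] assms
  by (simp add: velocity_at)

lemma velocity_tangent:
  assumes I: "open I" "smooth_curve M A I q" "t \<in> I"
  shows "velocity A q t \<in> tangent_space A (q t)"
proof (rule tangentI)
  show "velocity A q t d = 0" if "\<not> (d \<in> A \<and> q t \<in> chart_dom d)" for d
    using that by (auto simp: velocity_def)
next
  fix d assume d: "d \<in> A" "q t \<in> chart_dom d"
  show "velocity A q t d \<in> model d"
    by (rule dir_deriv_along_curve(1)[OF image_dom_subspace_open[OF d(1)] smooth_on_const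
          curve_has_velocity[OF I(1,2) d(1) I(3) d(2)] open_curve_preimage[OF I(1,2) d(1)]])
      (use I d in auto)
next
  fix c d assume c: "c \<in> A" "d \<in> A" "q t \<in> chart_dom c" "q t \<in> chart_dom d"
  let ?J = "{s \<in> I. q s \<in> chart_dom c} \<inter> {s \<in> I. q s \<in> chart_dom d}"
  have J: "open ?J" "t \<in> ?J"
    using open_Int[OF open_curve_preimage[OF I(1,2) c(1)] open_curve_preimage[OF I(1,2) c(2)]] I c by auto
  have "((\<lambda>s. transition c d (chart_map c (q s))) has_vector_derivative
      D_trans c d (q t) (velocity A q t c)) (at t)"
    by (rule dir_deriv_along_curve(2)[OF overlap_subspace_open[OF c(1,2)] transition_smooth[OF c(1,2)]
          curve_has_velocity[OF I(1,2) c(1) I(3) c(3)] J]) auto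
  then have "((\<lambda>s. chart_map d (q s)) has_vector_derivative D_trans c d (q t) (velocity A q t c)) (at t)"
    by (rule has_vector_derivative_transform_within_open[OF _ J]) (use c in auto)
  then show "velocity A q t d = D_trans c d (q t) (velocity A q t c)"
    using curve_has_velocity[OF I(1,2) c(2) I(3) c(4)] vector_derivative_unique_at by blast
qed

lemma christoffel_formD:
  assumes "has_christoffel_form M A D" "openin (top_of_set M) W" "smooth_vector_field A W Y" "p \<in> W" "v \<in> tangent_space A p"
  shows "D p v Y \<in> tangent_space A p"
    and "c \<in> A \<Longrightarrow> p \<in> chart_dom c \<Longrightarrow>
      D p v Y c = dir_deriv (\<lambda>x. Y (chart_inv c x) c) (chart_map c p) (v c) + christoffel A D c p (v c) (Y p c)"
  using assms unfolding has_christoffel_form_def by blast+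

abbreviation accel :: "(real \<Rightarrow> 'q) \<Rightarrow> ('q, 'e) chart \<Rightarrow> real \<Rightarrow> 'e" where
  "accel q c t \<equiv> vector_derivative (\<lambda>s. vector_derivative (\<lambda>s. chart_map c (q s)) (at s)) (at t)"

lemma covariant_acceleration_at:
  assumes I: "open I" "smooth_curve M A I q" "t \<in> I" and c: "c \<in> A" "q t \<in> chart_dom c"
  shows "covariant_acceleration A D q t c = accel q c t + christoffel A D c (q t) (velocity A q t c) (velocity A q t c)"
  using tangent_eq_coord_field[OF velocity_tangent[OF I] c] c
  by (simp add: covariant_acceleration_def christoffel_def comp_def)

text \<open>The inhomogeneous term in the change of chart of a second derivative, written as the derivative of
  the field with constant representative \<open>q'\<close>.  In this shape it is the term by which Christoffel
  symbols change.\<close>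

lemma accel_transform:
  assumes I: "open I" "smooth_curve M A I q" "t \<in> I"
    and c: "c \<in> A" "d \<in> A" "q t \<in> chart_dom c" "q t \<in> chart_dom d"
  shows "accel q d t = dir_deriv (\<lambda>x. coord_field A c (velocity A q t c) (chart_inv d x) d) (chart_map d (q t)) (velocity A q t d)
           + D_trans c d (q t) (accel q c t)"
    and "accel q c t \<in> model c"
proof -
  let ?J = "{s \<in> I. q s \<in> chart_dom c} \<inter> {s \<in> I. q s \<in> chart_dom d}"
  let ?\<gamma> = "\<lambda>s. chart_map c (q s)" and ?v = "\<lambda>s. velocity A q s c"
  have J: "open ?J" "t \<in> ?J"
    using open_Int[OF open_curve_preimage[OF I(1,2) c(1)] open_curve_preimage[OF I(1,2) c(2)]] I c by auto
  have Jc: "open {s \<in> I. q s \<in> chart_dom c}" by (rule open_curve_preimage[OF I(1,2) c(1)])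
  have vm: "velocity A q s c \<in> model c" if "s \<in> ?J" for s
    by (rule tangent_in_model[OF velocity_tangent[OF I(1,2)]]) (use that c in auto)
  have acc: "((\<lambda>s. velocity A q s e) has_vector_derivative accel q e t) (at t)" if e: "e \<in> {c, d}" for e
  proof (rule has_vector_derivative_transform_within_open[OF _ J])
    have "open {s \<in> I. q s \<in> chart_dom e}" "smooth_on {s \<in> I. q s \<in> chart_dom e} (\<lambda>s. chart_map e (q s))"
      using e c I by (auto intro: open_curve_preimage curve_smooth)
    from smooth_on_vector_derivative(1)[OF this(1) smooth_on_vector_derivative(2)[OF this]]
    show "((\<lambda>s. vector_derivative (\<lambda>s. chart_map e (q s)) (at s)) has_vector_derivative accel q e t) (at t)"
      using e c I by auto
  qed (use e c in \<open>auto simp: velocity_at\<close>)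
  show mc: "accel q c t \<in> model c"
    by (rule dir_deriv_along_curve(1)[OF _ smooth_on_const acc J])
      (use vm in \<open>auto simp: subspace_open_def subspace_model\<close>)
  have der: "(?\<gamma> has_vector_derivative ?v t) (at t)" by (rule curve_has_velocity[OF I(1,2) c(1) I(3) c(3)])
  have "((\<lambda>s. dir_deriv (transition c d) (?\<gamma> s) (?v s)) has_vector_derivative
      (dir_deriv (\<lambda>x. dir_deriv (transition c d) x (?v t)) (?\<gamma> t) (?v t) + dir_deriv (transition c d) (?\<gamma> t) (accel q c t))) (at t)"
    by (rule dir_deriv_field_along_curve[OF overlap_subspace_open[OF c(1,2)] transition_smooth[OF c(1,2)] der J _ acc])
      (use vm in auto)
  then have "((\<lambda>s. velocity A q s d) has_vector_derivative
      (dir_deriv (\<lambda>x. dir_deriv (transition c d) x (?v t)) (?\<gamma> t) (?v t) + D_trans c d (q t) (accel q c t))) (at t)"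
    by (rule has_vector_derivative_transform_within_open[OF _ J])
      (use c tangent_transform[OF velocity_tangent[OF I(1,2)], of _ c d] in auto)
  then have 1: "accel q d t = dir_deriv (\<lambda>x. dir_deriv (transition c d) x (?v t)) (?\<gamma> t) (?v t) + D_trans c d (q t) (accel q c t)"
    using acc[of d] vector_derivative_unique_at by auto
  \<comment> \<open>The second derivative of the transition map is never written out: the same vector is
    recognised as the derivative along the curve of the coordinate field of the velocity.\<close>
  have vt: "?v t \<in> model c" using vm J by auto
  have sm: "smooth_on (chart_map c ` (chart_dom c \<inter> chart_dom d)) (\<lambda>x. dir_deriv (transition c d) x (?v t))"
    by (intro smooth_on_dir_deriv[OF overlap_subspace_open[OF c(1,2)] transition_smooth[OF c(1,2)]]
        smooth_on_bounded_linear bounded_linear_ident smooth_on_const) (use vt in auto)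
  have "((\<lambda>s. dir_deriv (transition c d) (?\<gamma> s) (?v t)) has_vector_derivative
      dir_deriv (\<lambda>x. dir_deriv (transition c d) x (?v t)) (?\<gamma> t) (?v t)) (at t)"
    by (rule dir_deriv_along_curve(2)[OF overlap_subspace_open[OF c(1,2)] sm der J]) auto
  moreover have "((\<lambda>s. dir_deriv (transition c d) (?\<gamma> s) (?v t)) has_vector_derivative
      dir_deriv (\<lambda>x. coord_field A c (?v t) (chart_inv d x) d) (chart_map d (q t)) (velocity A q t d)) (at t)"
  proof (rule has_vector_derivative_transform_within_open[OF _ J])
    have "smooth_on (chart_map d ` (chart_dom d \<inter> chart_dom c)) (\<lambda>x. coord_field A c (?v t) (chart_inv d x) d)"
      by (rule smooth_field_rep[OF smooth_coord_field[OF c(1) vt] c(2)])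
    then show "((\<lambda>s. coord_field A c (?v t) (chart_inv d (chart_map d (q s))) d) has_vector_derivative
      dir_deriv (\<lambda>x. coord_field A c (?v t) (chart_inv d x) d) (chart_map d (q t)) (velocity A q t d)) (at t)"
      by (rule dir_deriv_along_curve(2)[OF overlap_subspace_open[OF c(2,1)] _
            curve_has_velocity[OF I(1,2) c(2) I(3) c(4)] J]) auto
    show "coord_field A c (?v t) (chart_inv d (chart_map d (q s))) d = dir_deriv (transition c d) (?\<gamma> s) (?v t)"
      if "s \<in> ?J" for s using that c vt by (simp add: coord_field_at)
  qed
  ultimately show "accel q d t = dir_deriv (\<lambda>x. coord_field A c (?v t) (chart_inv d x) d) (chart_map d (q t)) (velocity A q t d)
      + D_trans c d (q t) (accel q c t)"
    using 1 vector_derivative_unique_at by metis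
qed

text \<open>The inhomogeneous terms in the transformation of the second derivative and of the Christoffel
  symbols cancel.  Consequently the equation of motion holds in all charts once it holds in one.\<close>

theorem covariant_acceleration_tangent:
  assumes D: "has_christoffel_form M A D" and I: "open I" "smooth_curve M A I q" "t \<in> I"
  shows "covariant_acceleration A D q t \<in> tangent_space A (q t)"
proof (rule tangentI)
  show "covariant_acceleration A D q t d = 0" if "\<not> (d \<in> A \<and> q t \<in> chart_dom d)" for d
    using that by (auto simp: covariant_acceleration_def)
next
  fix d assume d: "d \<in> A" "q t \<in> chart_dom d"
  note v = velocity_tangent[OF I]
  have "D (q t) (velocity A q t) (coord_field A d (velocity A q t d)) \<in> tangent_space A (q t)"
    using christoffel_formD(1)[OF D dom_openin[OF d(1)] smooth_coord_field[OF d(1)] d(2) v] tangent_in_model[OF v d] by blast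
  from subspace_add[OF subspace_model accel_transform(2)[OF I d(1) d(1) d(2) d(2)] tangent_in_model[OF this d]]
  show "covariant_acceleration A D q t d \<in> model d"
    using d by (simp add: covariant_acceleration_def comp_def)
next
  fix c d assume c: "c \<in> A" "d \<in> A" "q t \<in> chart_dom c" "q t \<in> chart_dom d"
  let ?v = "velocity A q t" and ?p = "q t"
  let ?Y = "coord_field A c (?v c)"
  note v = velocity_tangent[OF I]
  note vc = tangent_in_model[OF v c(1,3)] and vd = tangent_in_model[OF v c(2,4)]
  note form = christoffel_formD[OF D dom_openin[OF c(1)] smooth_coord_field[OF c(1) vc] c(3) v]
  have "D_trans c d ?p (D ?p ?v ?Y c) = D ?p ?v ?Y d"
    using tangent_transform[OF form(1) c] by simp
  also have "\<dots> = dir_deriv (\<lambda>x. ?Y (chart_inv d x) d) (chart_map d ?p) (?v d) + christoffel A D d ?p (?v d) (?v d)"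
    using form(2)[OF c(2,4)] tangent_eq_coord_field[OF v c(1,3)] by simp
  finally have "D_trans c d ?p (accel q c t + D ?p ?v ?Y c)
      = accel q d t + christoffel A D d ?p (?v d) (?v d)"
    using accel_transform(1)[OF I c] D_trans_lin[OF c accel_transform(2)[OF I c] tangent_in_model[OF form(1) c(1,3)], of 1 1]
    by simp
  then show "covariant_acceleration A D q t d = D_trans c d ?p (covariant_acceleration A D q t c)"
    using covariant_acceleration_at[OF I c(2,4), of D] c by (simp add: covariant_acceleration_def comp_def)
qed

lemma smooth_curve_from_chart:
  assumes c: "c \<in> A" and x: "open I" "smooth_on I x" "x ` I \<subseteq> chart_map c ` chart_dom c"
  shows "smooth_curve M A I (\<lambda>t. chart_inv c (x t))"
  unfolding smooth_curve_def
proof (intro conjI ballI)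
  have in_dom: "chart_inv c (x t) \<in> chart_dom c" "chart_map c (chart_inv c (x t)) = x t" if "t \<in> I" for t
  proof -
    obtain p where "p \<in> chart_dom c" "x t = chart_map c p" using x(3) \<open>t \<in> I\<close> by blast
    then show "chart_inv c (x t) \<in> chart_dom c" "chart_map c (chart_inv c (x t)) = x t" using c by auto
  qed
  show "(\<lambda>t. chart_inv c (x t)) ` I \<subseteq> M" using in_dom dom_subset[OF c] by blast
  have "continuous_on (chart_map c ` chart_dom c) (chart_inv c)"
    using homeo[OF c] by (simp add: homeomorphism_def)
  then show "continuous_on I (\<lambda>t. chart_inv c (x t))"
    using smooth_on_imp_continuous_on[OF x(2)] x(3) by (rule continuous_on_compose2)
  fix d assume d: "d \<in> A"
  let ?J = "{t \<in> I. chart_inv c (x t) \<in> chart_dom d}"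
  have "smooth_on ?J (\<lambda>t. transition c d (x t))"
  proof (rule smooth_on_compose[OF transition_smooth[OF c d]])
    show "smooth_on ?J x" by (rule smooth_on_subset[OF x(2)]) auto
    show "x ` ?J \<subseteq> chart_map c ` (chart_dom c \<inter> chart_dom d)"
    proof
      fix y assume "y \<in> x ` ?J"
      then obtain t where "t \<in> I" "y = x t" "chart_inv c (x t) \<in> chart_dom d" by blast
      then show "y \<in> chart_map c ` (chart_dom c \<inter> chart_dom d)" using in_dom[of t] by (metis IntI imageI)
    qed
  qed
  then show "smooth_on ?J (chart_map d \<circ> (\<lambda>t. chart_inv c (x t)))"
    by (simp add: transition_def comp_def)
qed

end

section \<open>Raising indices\<close>

lemma ex_orthogonal_projection:
  fixes E :: "'a::euclidean_space set"
  assumes "subspace E"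
  obtains \<pi> where "bounded_linear \<pi>" "\<And>x. \<pi> x \<in> E" "\<And>x. x \<in> E \<Longrightarrow> \<pi> x = x"
    "\<And>x y. y \<in> E \<Longrightarrow> (x - \<pi> x) \<bullet> y = 0"
proof -
  obtain B where B: "B \<subseteq> E" "pairwise orthogonal B" "\<And>x. x \<in> B \<Longrightarrow> norm x = 1" "independent B" "span B = E"
    using orthonormal_basis_subspace[OF assms] by metis
  have fin: "finite B" using B independent_imp_finite by blast
  define \<pi> where "\<pi> x = (\<Sum>b\<in>B. (x \<bullet> b) *\<^sub>R b)" for x
  have in_E: "\<pi> x \<in> E" for x
    unfolding \<pi>_def using B(1) assms by (intro subspace_sum subspace_scale) auto
  have ip: "\<pi> x \<bullet> b = x \<bullet> b" if "b \<in> B" for x b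
  proof -
    have "\<pi> x \<bullet> b = (\<Sum>a\<in>B. (x \<bullet> a) * (a \<bullet> b))" by (simp add: \<pi>_def inner_sum_left)
    also have "\<dots> = (\<Sum>a\<in>B. if a = b then x \<bullet> b else 0)"
    proof (rule sum.cong[OF refl])
      fix a assume "a \<in> B"
      show "(x \<bullet> a) * (a \<bullet> b) = (if a = b then x \<bullet> b else 0)"
        using B(2,3) \<open>a \<in> B\<close> that by (auto simp: pairwise_def orthogonal_def norm_eq_1)
    qed
    finally show ?thesis using fin that by simp
  qed
  have orth: "(x - \<pi> x) \<bullet> y = 0" if "y \<in> E" for x y
  proof -
    have "y \<in> span B" using that B by simp
    then show ?thesis
    proof (induction rule: span_induct_alt)
      case (step c b y) then show ?case using ip[of b x] by (simp add: inner_add_right inner_diff_left)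
    qed simp
  qed
  have "\<pi> x = x" if "x \<in> E" for x
  proof -
    have "x - \<pi> x \<in> E" using that in_E assms by (intro subspace_diff)
    then show ?thesis using orth[of "x - \<pi> x" x] by simp
  qed
  moreover have "bounded_linear \<pi>"
    unfolding \<pi>_def by (intro bounded_linear_sum bounded_linear_scaleR_const bounded_linear_inner_left)
  ultimately show ?thesis using that in_E orth by blast
qed

lemma span_image_sum:
  fixes f :: "'i \<Rightarrow> 'v::real_vector"
  assumes "finite I" "x \<in> span (f ` I)"
  obtains a where "x = (\<Sum>i\<in>I. a i *\<^sub>R f i)"
proof -
  let ?U = "range (\<lambda>a. \<Sum>i\<in>I. a i *\<^sub>R f i)"
  have "subspace ?U"
    unfolding subspace_def
  proof (intro conjI ballI allI)
    show "0 \<in> ?U" by (rule range_eqI[of _ _ "\<lambda>i. 0"]) simp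
  next
    fix x y assume "x \<in> ?U" "y \<in> ?U"
    then obtain a b where "x = (\<Sum>i\<in>I. a i *\<^sub>R f i)" "y = (\<Sum>i\<in>I. b i *\<^sub>R f i)" by blast
    then show "x + y \<in> ?U"
      by (intro range_eqI[of _ _ "\<lambda>i. a i + b i"]) (simp add: scaleR_add_left sum.distrib)
  next
    fix r x assume "x \<in> ?U"
    then obtain a where "x = (\<Sum>i\<in>I. a i *\<^sub>R f i)" by blast
    then show "r *\<^sub>R x \<in> ?U"
      by (intro range_eqI[of _ _ "\<lambda>i. r * a i"]) (simp add: scaleR_sum_right)
  qed
  moreover have "f ` I \<subseteq> ?U"
  proof
    fix y assume "y \<in> f ` I"
    then obtain j where j: "j \<in> I" "y = f j" by blast
    have "(\<Sum>i\<in>I. (if i = j then 1 else 0) *\<^sub>R f i) = (\<Sum>i\<in>I. if i = j then f i else 0)"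
      by (rule sum.cong) auto
    also have "\<dots> = y" using j assms(1) by simp
    finally show "y \<in> ?U" by (intro range_eqI[of _ _ "\<lambda>i. if i = j then 1 else 0"]) simp
  qed
  ultimately have "span (f ` I) \<subseteq> ?U" by (intro span_minimal)
  then show ?thesis using assms that by blast
qed

context atlas
begin

lemma metric_sum_left:
  assumes g: "riemannian_metric M A g" "p \<in> M" and z: "z \<in> tangent_space A p"
    and v: "\<And>i. i \<in> I \<Longrightarrow> v i \<in> tangent_space A p"
  shows "g p (\<Sum>i\<in>I. a i *\<^sub>R v i) z = (\<Sum>i\<in>I. a i * g p (v i) z)"
  using v
proof (induction I rule: infinite_finite_induct)
  case (insert i I)
  have "(\<Sum>i\<in>I. a i *\<^sub>R v i) \<in> tangent_space A p"
    using insert by (intro subspace_sum[OF subspace_tangent] tangent_scale) auto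
  from metric_lin_left[OF g insert.prems[of i] this z, of "a i" 1] show ?case
    using insert by (simp del: plus_fun_apply)
qed (use metric_lin_left[OF g tangent_0 tangent_0 z, of 0 0] in auto)

text \<open>The sum is the vector of the Euclidean space that represents the covector \<open>\<omega>\<close> after pulling it back
  along \<open>\<pi>\<close>.  Encoding covectors as vectors turns equations between covectors into linear systems on
  the Euclidean space.\<close>

lemma functional_coord_field_expansion:
  assumes \<omega>: "linear_functional_on (tangent_space A p) \<omega>" and c: "c \<in> A" "p \<in> chart_dom c"
    and \<pi>: "bounded_linear \<pi>" "\<And>x. \<pi> x \<in> model c"
  shows "(\<Sum>b\<in>Basis. \<omega> (coord_field A c (\<pi> b) p) *\<^sub>R b) \<bullet> w = \<omega> (coord_field A c (\<pi> w) p)"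
proof -
  have lin: "linear (\<lambda>w. \<omega> (coord_field A c (\<pi> w) p))"
  proof
    interpret \<pi>: bounded_linear \<pi> by (rule \<pi>(1))
    note E = coord_field_tangent[OF c \<pi>(2)]
    note \<omega>' = \<omega>[unfolded linear_functional_on_def, rule_format, OF E E]
    show "\<omega> (coord_field A c (\<pi> (x + y)) p) = \<omega> (coord_field A c (\<pi> x) p) + \<omega> (coord_field A c (\<pi> y) p)" for x y
      using \<omega>'[of 1 x 1 y] coord_field_lin[OF c \<pi>(2) \<pi>(2), of 1 x 1 y] by (simp add: \<pi>.add)
    show "\<omega> (coord_field A c (\<pi> (r *\<^sub>R x)) p) = r *\<^sub>R \<omega> (coord_field A c (\<pi> x) p)" for r x
      using \<omega>'[of r x 0 x] coord_field_lin[OF c \<pi>(2) \<pi>(2), of r x 0 x] by (simp add: \<pi>.scaleR)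
  qed
  show ?thesis
    unfolding linear_basis_expansion[OF lin, of w] inner_sum_left
    by (simp add: inner_commute[of w] mult.commute)
qed

lemma metric_functional:
  assumes "riemannian_metric M A g" "p \<in> M" "v \<in> tangent_space A p"
  shows "linear_functional_on (tangent_space A p) (g p v)"
  using assms unfolding riemannian_metric_def by blast

theorem
  assumes g: "riemannian_metric M A g" "p \<in> M" and \<omega>: "linear_functional_on (tangent_space A p) \<omega>"
  shows sharp_tangent: "sharp A g p \<omega> \<in> tangent_space A p"
    and sharp_represents: "v \<in> tangent_space A p \<Longrightarrow> g p (sharp A g p \<omega>) v = \<omega> v"
proof -
  obtain c where c: "c \<in> A" "p \<in> chart_dom c" using ex_chart[OF g(2)] by blast
  obtain \<pi> where \<pi>: "bounded_linear \<pi>" "\<And>x. \<pi> x \<in> model c" "\<And>x. x \<in> model c \<Longrightarrow> \<pi> x = x"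
    "\<And>x y. y \<in> model c \<Longrightarrow> (x - \<pi> x) \<bullet> y = 0"
    using ex_orthogonal_projection[OF subspace_model] by blast
  interpret \<pi>: bounded_linear \<pi> by (rule \<pi>(1))
  let ?E = "\<lambda>u. coord_field A c u p"
  note E = coord_field_tangent[OF c]
  \<comment> \<open>The Gram map of the metric on the model space, extended by the identity on its orthogonal
    complement; positive definiteness makes it injective, hence onto.\<close>
  define L where "L u = (\<Sum>b\<in>Basis. g p (?E (\<pi> u)) (?E (\<pi> b)) *\<^sub>R b) + (u - \<pi> u)" for u
  have Lw: "L u \<bullet> w = g p (?E (\<pi> u)) (?E w)" if "w \<in> model c" for u w
    using functional_coord_field_expansion[OF metric_functional[OF g E[OF \<pi>(2)]] c \<pi>(1,2)] \<pi>(3,4) that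
    by (simp add: L_def inner_add_left)
  have lin: "linear L"
  proof
    note gl = metric_lin_left[OF g E[OF \<pi>(2)] E[OF \<pi>(2)] E[OF \<pi>(2)]]
    show "L (x + y) = L x + L y" for x y
      using gl[of 1 x 1 y] coord_field_lin[OF c \<pi>(2) \<pi>(2), of 1 x 1 y]
      by (simp add: L_def \<pi>.add scaleR_add_left sum.distrib)
    show "L (r *\<^sub>R x) = r *\<^sub>R L x" for r x
      using gl[of r x 0 x] coord_field_lin[OF c \<pi>(2) \<pi>(2), of r x 0 x]
      by (simp add: L_def \<pi>.scaleR scaleR_sum_right scaleR_add_right scaleR_diff_right)
  qed
  have "u = 0" if "L u = 0" for u
  proof -
    have "g p (?E (\<pi> u)) (?E (\<pi> u)) = 0" using Lw[OF \<pi>(2), of u u] that by simp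
    then have "?E (\<pi> u) = 0" using metric_pos[OF g E[OF \<pi>(2)] E[OF \<pi>(2)], of u] by force
    then have "\<pi> u = 0" using coord_field_self[OF c \<pi>(2), of u] by simp
    moreover have "g p 0 (?E (\<pi> b)) = 0" for b
      using metric_lin_left[OF g tangent_0 tangent_0 E[OF \<pi>(2)], of 0 0] by simp
    ultimately show ?thesis using that coord_field_zero[OF c] by (simp add: L_def)
  qed
  then have "inj L" using lin by (simp add: linear_injective_0)
  then have "surj L" using lin linear_injective_imp_surjective by blast
  then obtain u where u: "L u = (\<Sum>b\<in>Basis. \<omega> (?E (\<pi> b)) *\<^sub>R b)" by (metis surjD)
  define w where "w = ?E (\<pi> u)"
  have w: "w \<in> tangent_space A p" using E \<pi> by (simp add: w_def)
  have rep: "\<omega> v = g p w v" if v: "v \<in> tangent_space A p" for v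
    using functional_coord_field_expansion[OF \<omega> c \<pi>(1,2), of "v c"] Lw[OF tangent_in_model[OF v c], of u]
      u \<pi>(3)[OF tangent_in_model[OF v c]] tangent_eq_coord_field[OF v c] by (simp add: w_def)
  have "sharp A g p \<omega> = w"
    unfolding sharp_def
  proof (rule the_equality)
    fix w' assume "w' \<in> tangent_space A p \<and> (\<forall>v\<in>tangent_space A p. \<omega> v = g p w' v)"
    then show "w' = w" using metric_nondegenerate[OF g _ w] rep by metis
  qed (use w rep in blast)
  then show "sharp A g p \<omega> \<in> tangent_space A p" "v \<in> tangent_space A p \<Longrightarrow> g p (sharp A g p \<omega>) v = \<omega> v"
    using w rep by auto
qed

lemma dfun_functional:
  assumes "smooth_fun A M P" "p \<in> M"
  shows "linear_functional_on (tangent_space A p) (dfun A P p)"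
  unfolding linear_functional_on_def
proof (intro ballI allI)
  fix v w a b assume vw: "v \<in> tangent_space A p" "w \<in> tangent_space A p"
  obtain c where c: "c \<in> A" "p \<in> chart_dom c" using ex_chart[OF assms(2)] by blast
  have sm: "smooth_on (chart_map c ` chart_dom c) (\<lambda>x. P (chart_inv c x))"
    using assms(1) c dom_subset[OF c(1)] by (metis (no_types, lifting) comp_def inf.absorb1 smooth_fun_def smooth_on_cong subsetI)
  note eq = dfun_eq[OF openin_subtopology_self assms(1) c assms(2)]
  show "dfun A P p (a *\<^sub>R v + b *\<^sub>R w) = a * dfun A P p v + b * dfun A P p w"
    using dir_deriv_lin[OF image_dom_subspace_open[OF c(1)] sm _ tangent_in_model[OF vw(1) c] tangent_in_model[OF vw(2) c], of "chart_map c p" a b]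
      eq[OF vw(1)] eq[OF vw(2)] eq[OF tangent_lin[OF vw]] c
    by (simp add: scaleR_fun_def)
qed

end

section \<open>The constraint manifold and the induced connection\<close>

lemma span_subspace_open:
  fixes E :: "'a::euclidean_space set"
  assumes "subspace_open E U" "U \<noteq> {}"
  shows "span U = E"
proof
  show "span U \<subseteq> E"
    using assms by (intro span_minimal) (auto simp: subspace_open_def dest: openin_imp_subset)
  show "E \<subseteq> span U"
  proof
    fix u assume u: "u \<in> E"
    obtain x where x: "x \<in> U" using assms by blast
    have "\<forall>\<^sub>F t in at (0::real). x + t *\<^sub>R u \<in> U"
      using subspace_open_line[OF assms(1) x u] by (simp add: eventually_nhds_conv_at)
    moreover have "\<forall>\<^sub>F t in at (0::real). t \<noteq> 0" by (simp add: eventually_at_filter)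
    ultimately have "\<forall>\<^sub>F t in at (0::real). x + t *\<^sub>R u \<in> U \<and> t \<noteq> 0" by (rule eventually_conj)
    then obtain t where t: "x + t *\<^sub>R u \<in> U" "t \<noteq> 0" using eventually_happens' at_neq_bot by blast
    have "(1 / t) *\<^sub>R ((x + t *\<^sub>R u) - x) \<in> span U"
      using t x by (intro span_scale span_diff) (auto intro: span_base)
    then show "u \<in> span U" using t by simp
  qed
qed

text \<open>Here \<open>\<pi>\<close> is the component along the slice and the \<open>h i\<close> are \<open>m\<close> orthonormal directions transverse to it.
  A vector of \<open>S\<close> together with \<open>m\<close> multipliers is thus encoded as one vector of \<open>E\<close>.\<close>

lemma slice_coordinates:
  fixes E S :: "'a::euclidean_space set"
  assumes "subspace E" "subspace S" "S \<subseteq> E" "dim S + m = dim E"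
  obtains \<pi> h where "bounded_linear \<pi>" "\<And>x. \<pi> x \<in> S" "\<And>x. x \<in> S \<Longrightarrow> \<pi> x = x"
    "\<And>i. i \<in> {1..m} \<Longrightarrow> h i \<in> E" "\<And>i. i \<in> {1..m} \<Longrightarrow> \<pi> (h i) = (0::'a)"
    "\<And>i x. i \<in> {1..m} \<Longrightarrow> x \<in> S \<Longrightarrow> x \<bullet> h i = 0"
    "\<And>i j. i \<in> {1..m} \<Longrightarrow> j \<in> {1..m} \<Longrightarrow> h i \<bullet> h j = (if i = j then 1 else 0)"
    "\<forall>z\<in>E. \<pi> z = 0 \<longrightarrow> (\<forall>i\<in>{1..m::nat}. z \<bullet> h i = 0) \<longrightarrow> z = 0"
proof -
  obtain \<pi> where \<pi>: "bounded_linear \<pi>" "\<And>x. \<pi> x \<in> S" "\<And>x. x \<in> S \<Longrightarrow> \<pi> x = x"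
    "\<And>x y. y \<in> S \<Longrightarrow> (x - \<pi> x) \<bullet> y = 0"
    using ex_orthogonal_projection[OF assms(2)] by blast
  define T where "T = {y \<in> E. \<forall>x\<in>S. orthogonal x y}"
  have T: "subspace T"
    unfolding T_def subspace_def using assms(1)
    by (auto simp: orthogonal_def inner_add_right subspace_add subspace_scale subspace_0)
  have "dim T = m" using dim_subspace_orthogonal_to_vectors[OF assms(2,1,3)] assms(4) by (simp add: T_def)
  then obtain B where B: "B \<subseteq> T" "pairwise orthogonal B" "\<And>x. x \<in> B \<Longrightarrow> norm x = 1" "independent B" "card B = m" "span B = T"
    using orthonormal_basis_subspace[OF T] by metis
  have "finite B" using B independent_imp_finite by blast
  then obtain h where h: "bij_betw h {1..m} B" using ex_bij_betw_nat_finite_1 B(5) by metis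
  have hB: "h i \<in> B" if "i \<in> {1..m}" for i using h that bij_betwE by blast
  have hT: "h i \<in> T" if "i \<in> {1..m}" for i using hB[OF that] B(1) by blast
  have xh: "x \<bullet> h i = 0" if "i \<in> {1..m}" "x \<in> S" for i x
    using hT[OF that(1)] that by (auto simp: T_def orthogonal_def)
  show thesis
  proof (rule that[of \<pi> h])
    fix i assume i: "i \<in> {1..m}"
    show "h i \<in> E" using hT[OF i] by (simp add: T_def)
    have "h i \<bullet> \<pi> (h i) = 0" using xh[OF i \<pi>(2), of "h i"] by (simp add: inner_commute)
    then have "\<pi> (h i) \<bullet> \<pi> (h i) = 0"
      using \<pi>(4)[OF \<pi>(2), of "h i" "h i"] by (simp add: inner_diff_left)
    then show "\<pi> (h i) = 0" by simp
  next
    fix i j assume ij: "i \<in> {1..m}" "j \<in> {1..m}"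
    show "h i \<bullet> h j = (if i = j then 1 else 0)"
    proof (cases "i = j")
      case True then show ?thesis using B(3)[OF hB[OF ij(1)]] by (simp add: norm_eq_1)
    next
      case False
      then have "h i \<noteq> h j" using h ij by (metis bij_betw_inv_into_left)
      then show ?thesis using False B(2) hB ij by (auto simp: pairwise_def orthogonal_def)
    qed
  next
    show "\<forall>z\<in>E. \<pi> z = 0 \<longrightarrow> (\<forall>i\<in>{1..m}. z \<bullet> h i = 0) \<longrightarrow> z = 0"
    proof (intro ballI impI)
      fix z assume z: "z \<in> E" "\<pi> z = 0" "\<forall>i\<in>{1..m}. z \<bullet> h i = 0"
      have "z \<in> T" using z(1,2) \<pi>(4)[of _ z] by (auto simp: T_def orthogonal_def inner_commute)
      then have "z \<in> span B" using B by simp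
      moreover have "z \<bullet> b = 0" if "b \<in> B" for b
      proof -
        obtain i where "i \<in> {1..m}" "b = h i" using h \<open>b \<in> B\<close> by (metis bij_betw_def imageE)
        then show ?thesis using z(3) by simp
      qed
      ultimately have "z \<bullet> z = 0"
        using orthogonal_to_span[of z B z] by (simp add: orthogonal_def)
      then show "z = 0" by simp
    qed
  qed (use \<pi> xh in auto)
qed

locale vhc =
  fixes n m :: nat
    and Q C :: "'q::{t2_space, second_countable_topology} set"
    and A :: "('q, 'e::euclidean_space) chart set"
    and g :: "'q \<Rightarrow> ('q, 'e) tvec \<Rightarrow> ('q, 'e) tvec \<Rightarrow> real"
    and D :: "('q, 'e) conn"
    and P :: "'q \<Rightarrow> real"
    and F :: "nat \<Rightarrow> 'q \<Rightarrow> ('q, 'e) tvec \<Rightarrow> real"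
  assumes lcs: "lagrangian_control_system n Q A g D P m F"
    and vhc: "regular_VHC Q A g m F C"
begin

abbreviation "AC \<equiv> submanifold_atlas A m C"
abbreviation "DC \<equiv> induced_connection Q A g D m F C"

lemma g_metric: "riemannian_metric Q A g" and D_connection: "levi_civita Q A g D" "affine_connection Q A D" "torsion_free Q A D"
  and P_smooth: "smooth_fun A Q P"
  and F_forms: "i \<in> {1..m} \<Longrightarrow> smooth_one_form Q A (F i)"
  and F_independent: "p \<in> Q \<Longrightarrow> (\<And>v. v \<in> tangent_space A p \<Longrightarrow> (\<Sum>i=1..m. a i * F i p v) = 0) \<Longrightarrow> i \<in> {1..m} \<Longrightarrow> a i = 0"
  using lcs unfolding lagrangian_control_system_def levi_civita_def by blast+

sublocale Q: atlas n Q A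
  using lcs by unfold_locales (simp add: lagrangian_control_system_def smooth_manifold_def)

lemma C_subset: "p \<in> C \<Longrightarrow> p \<in> Q"
  using vhc by (auto simp: regular_VHC_def embedded_submanifold_def)

lemma openin_C: "openin (top_of_set Q) W \<Longrightarrow> openin (top_of_set C) (W \<inter> C)"
  using C_subset by (auto simp: openin_open)

text \<open>The ambient chart that a chart of the constraint submanifold restricts.  It is not determined by the
  restriction, which forgets the part of the domain outside \<open>C\<close>; the coordinate map is the same for
  all choices.\<close>

definition ambient :: "('q, 'e) chart \<Rightarrow> ('q, 'e) chart" where
  "ambient c' = (SOME c. c \<in> A \<and> c' = (chart_dom c \<inter> C, chart_map c) \<and> chart_dom c \<inter> C \<noteq> {} \<and>
     (\<exists>S. subspace S \<and> S \<subseteq> model c \<and> dim S + m = dim (model c) \<and>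
          chart_map c ` (chart_dom c \<inter> C) = chart_map c ` chart_dom c \<inter> S))"

lemma
  assumes "c' \<in> AC"
  shows ambient_in: "ambient c' \<in> A"
    and dom_slice: "chart_dom c' = chart_dom (ambient c') \<inter> C"
    and map_slice: "chart_map c' = chart_map (ambient c')"
    and model_slice_subset: "model c' \<subseteq> model (ambient c')"
    and dim_slice: "dim (model c') + m = dim (model (ambient c'))"
    and slice_image_open: "subspace_open (model c') (chart_map c' ` chart_dom c')"
proof -
  have "\<exists>c. c \<in> A \<and> c' = (chart_dom c \<inter> C, chart_map c) \<and> chart_dom c \<inter> C \<noteq> {} \<and>
     (\<exists>S. subspace S \<and> S \<subseteq> model c \<and> dim S + m = dim (model c) \<and>
          chart_map c ` (chart_dom c \<inter> C) = chart_map c ` chart_dom c \<inter> S)"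
    using assms unfolding submanifold_atlas_def by blast
  from someI_ex[OF this, folded ambient_def]
  obtain S where *: "ambient c' \<in> A" "c' = (chart_dom (ambient c') \<inter> C, chart_map (ambient c'))"
    "chart_dom (ambient c') \<inter> C \<noteq> {}" and
    S: "subspace S" "S \<subseteq> model (ambient c')" "dim S + m = dim (model (ambient c'))"
     "chart_map (ambient c') ` (chart_dom (ambient c') \<inter> C) = chart_map (ambient c') ` chart_dom (ambient c') \<inter> S"
    by blast
  show a: "ambient c' \<in> A" by (rule *(1))
  show d: "chart_dom c' = chart_dom (ambient c') \<inter> C" and mp: "chart_map c' = chart_map (ambient c')"
    using *(2) by (metis fst_conv, metis snd_conv)
  then have ne: "chart_dom c' \<noteq> {}" using *(3) by simp
  have im: "chart_map c' ` chart_dom c' = chart_map (ambient c') ` chart_dom (ambient c') \<inter> S"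
    using S(4) d mp by simp
  obtain T where "open T" "chart_map (ambient c') ` chart_dom (ambient c') = model (ambient c') \<inter> T"
    using Q.image_dom_subspace_open[OF a] unfolding subspace_open_def openin_open by blast
  then have "openin (top_of_set S) (chart_map c' ` chart_dom c')"
    using S(2) unfolding im openin_open by (intro exI[of _ T]) auto
  then have so: "subspace_open S (chart_map c' ` chart_dom c')" using S(1) by (simp add: subspace_open_def)
  have "model c' = S" unfolding model_def by (rule span_subspace_open[OF so]) (use ne in auto)
  then show "model c' \<subseteq> model (ambient c')" "dim (model c') + m = dim (model (ambient c'))"
    "subspace_open (model c') (chart_map c' ` chart_dom c')"
    using S so by simp_all
qed

lemma slice_inj: "c' \<in> AC \<Longrightarrow> inj_on (chart_map c') (chart_dom c')"
  using Q.chart_inv_map[OF ambient_in] unfolding inj_on_def by (metis IntD1 dom_slice map_slice)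

lemma slice_inv:
  assumes "c' \<in> AC" "p \<in> chart_dom c'"
  shows "chart_inv c' (chart_map c' p) = p"
  using inv_into_f_f[OF slice_inj] assms by (simp add: chart_inv_def)

lemma slice_inv_eq:
  assumes "c' \<in> AC" "x \<in> chart_map c' ` chart_dom c'"
  shows "chart_inv c' x = chart_inv (ambient c') x"
  using assms slice_inv[OF assms(1)] Q.chart_inv_map[OF ambient_in[OF assms(1)]] dom_slice[OF assms(1)] map_slice[OF assms(1)]
  by auto

lemma slice_transition:
  assumes "c' \<in> AC" "x \<in> chart_map c' ` chart_dom c'"
  shows "transition c' d x = chart_map d (chart_inv (ambient c') x)"
  using slice_inv_eq[OF assms] by (simp add: transition_def)

lemma smooth_slice_transition:
  assumes "c' \<in> AC" "d' \<in> AC"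
  shows "smooth_on (chart_map c' ` (chart_dom c' \<inter> chart_dom d')) (transition c' d')"
proof (rule smooth_on_cong)
  show "smooth_on (chart_map c' ` (chart_dom c' \<inter> chart_dom d')) (transition (ambient c') (ambient d'))"
    by (rule smooth_on_subset[OF Q.transition_smooth[OF ambient_in[OF assms(1)] ambient_in[OF assms(2)]]])
      (use assms in \<open>auto simp: dom_slice map_slice\<close>)
  show "transition (ambient c') (ambient d') x = transition c' d' x"
    if "x \<in> chart_map c' ` (chart_dom c' \<inter> chart_dom d')" for x
    using that slice_transition[of c' x d'] assms map_slice[OF assms(2)] by (auto simp: transition_def)
qed

lemma slice_chart_on:
  assumes "c' \<in> AC"
  shows "chart_on (n - m) C c'"
proof -
  have dn: "dim (model (ambient c')) = n"
    using Q.chart[OF ambient_in[OF assms]] by (simp add: chart_on_def)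
  have d: "openin (top_of_set C) (chart_dom c')"
    using openin_C[OF Q.dom_openin[OF ambient_in[OF assms]]] by (simp add: dom_slice[OF assms])
  have "homeomorphism (chart_dom c') (chart_map c' ` chart_dom c') (chart_map (ambient c')) (chart_inv (ambient c'))"
    by (rule homeomorphism_of_subsets[OF Q.homeo[OF ambient_in[OF assms]]])
      (auto simp: dom_slice[OF assms] map_slice[OF assms])
  then have "homeomorphism (chart_dom c') (chart_map c' ` chart_dom c') (chart_map c') (chart_inv c')"
    by (rule homeomorphism_cong) (use slice_inv_eq[OF assms] map_slice[OF assms] in auto)
  then show ?thesis
    using d dim_slice[OF assms] dn slice_image_open[OF assms] by (simp add: chart_on_def subspace_open_def)
qed

sublocale S: atlas "n - m" C AC
proof
  have "C \<subseteq> (\<Union>c\<in>AC. chart_dom c)"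
    using vhc unfolding regular_VHC_def embedded_submanifold_def by blast
  moreover have "(\<Union>c\<in>AC. chart_dom c) \<subseteq> C" using dom_slice by blast
  ultimately show "smooth_atlas (n - m) C AC"
    unfolding smooth_atlas_def smoothly_compatible_def
    using slice_chart_on smooth_slice_transition by (metis Int_commute subset_antisym)
qed

lemma in_dom_ambient: "c' \<in> AC \<Longrightarrow> p \<in> chart_dom c' \<Longrightarrow> p \<in> chart_dom (ambient c')"
  by (simp add: dom_slice)

lemma in_dom_C: "c' \<in> AC \<Longrightarrow> p \<in> chart_dom c' \<Longrightarrow> p \<in> C"
  by (simp add: dom_slice)

lemma model_slice: "c' \<in> AC \<Longrightarrow> u \<in> model c' \<Longrightarrow> u \<in> model (ambient c')"
  using model_slice_subset by blast

text \<open>In slice charts the inclusion is represented by the identity, so that a tangent vector of \<open>C\<close> and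
  its image have the same component.  The chart in the definition of the differential is arbitrary,
  and the change to \<open>c'\<close> is made by the same transition map on \<open>C\<close> and on the ambient manifold.\<close>

lemma incl_eq:
  assumes c': "c' \<in> AC" "p \<in> chart_dom c'" and v: "v \<in> tangent_space AC p"
  shows "incl A m C p v = coord_field A (ambient c') (v c') p"
proof -
  define c0 where "c0 = Defs.chart_at AC p"
  have pC: "p \<in> C" using in_dom_C[OF c'] .
  have c0: "c0 \<in> AC" "p \<in> chart_dom c0" using S.chart_at[OF pC] by (simp_all add: c0_def)
  note a0 = ambient_in[OF c0(1)] in_dom_ambient[OF c0] and a = ambient_in[OF c'(1)] in_dom_ambient[OF c']
  have v0: "v c0 \<in> model c0" using S.tangent_in_model[OF v c0] .
  note v0' = model_slice[OF c0(1) v0]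
  have 1: "incl A m C p v = coord_field A (ambient c0) (v c0) p"
  proof
    fix d
    have "frechet_derivative (chart_map d \<circ> (\<lambda>x. x) \<circ> chart_inv c0)
            (at (chart_map c0 p) within chart_map c0 ` {x \<in> chart_dom c0. x \<in> chart_dom d}) (v c0)
        = Q.D_trans (ambient c0) d p (v c0)" if d: "d \<in> A" "p \<in> chart_dom d"
    proof -
      let ?S = "chart_map c0 ` {x \<in> chart_dom c0. x \<in> chart_dom d}"
      have "?S = chart_map c0 ` (chart_dom c0 \<inter> (chart_dom d \<inter> C))"
        using in_dom_C[OF c0(1)] by (intro arg_cong[where f="\<lambda>X. chart_map c0 ` X"]) auto
      then have S: "subspace_open (model c0) ?S"
        using S.image_subspace_open[OF c0(1) openin_C[OF Q.dom_openin[OF d(1)]]] by simp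
      have eq: "(chart_map d \<circ> (\<lambda>x. x) \<circ> chart_inv c0) x = transition (ambient c0) d x" if "x \<in> ?S" for x
        using that slice_inv_eq[OF c0(1), of x] by (auto simp: transition_def)
      have "smooth_on ?S (transition (ambient c0) d)"
        by (rule smooth_on_subset[OF Q.transition_smooth[OF a0(1) d(1)]])
          (use c0 in \<open>auto simp: dom_slice map_slice\<close>)
      then have "smooth_on ?S (chart_map d \<circ> (\<lambda>x. x) \<circ> chart_inv c0)"
        by (rule smooth_on_cong[rotated]) (use eq in auto)
      then have "frechet_derivative (chart_map d \<circ> (\<lambda>x. x) \<circ> chart_inv c0) (at (chart_map c0 p) within ?S) (v c0)
          = dir_deriv (chart_map d \<circ> (\<lambda>x. x) \<circ> chart_inv c0) (chart_map c0 p) (v c0)"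
        by (intro frechet_derivative_dir_deriv[OF S _ S _ _ v0]) (use c0 d in auto)
      also have "\<dots> = dir_deriv (transition (ambient c0) d) (chart_map c0 p) (v c0)"
        by (rule dir_deriv_cong[OF S _ v0 eq]) (use c0 d in auto)
      finally show ?thesis using map_slice[OF c0(1)] by simp
    qed
    then show "incl A m C p v d = coord_field A (ambient c0) (v c0) p d"
      using Q.coord_field_at[OF a0(1) v0'] a0
      by (simp add: incl_def differential_def c0_def[symmetric] Let_def)
  qed
  have "coord_field A (ambient c0) (v c0) p (ambient c') = Q.D_trans (ambient c0) (ambient c') p (v c0)"
    using Q.coord_field_at[OF a0(1) v0'] a0 a by simp
  also have "\<dots> = dir_deriv (transition c0 c') (chart_map c0 p) (v c0)"
    unfolding map_slice[OF c0(1), symmetric]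
  proof (rule dir_deriv_cong[OF S.overlap_subspace_open[OF c0(1) c'(1)] _ v0])
    show "transition (ambient c0) (ambient c') y = transition c0 c' y"
      if "y \<in> chart_map c0 ` (chart_dom c0 \<inter> chart_dom c')" for y
      using that slice_transition[OF c0(1), of y c'] map_slice[OF c'(1)] by (auto simp: transition_def)
  qed (use c0 c' in auto)
  also have "\<dots> = v c'" using S.tangent_transform[OF v c0(1) c'(1) c0(2) c'(2)] by simp
  finally have "coord_field A (ambient c0) (v c0) p (ambient c') = v c'" .
  then have "coord_field A (ambient c0) (v c0) p = coord_field A (ambient c') (v c') p"
    using Q.tangent_eq_coord_field[OF Q.coord_field_tangent[OF a0 v0'] a] by simp
  with 1 show ?thesis by simp
qed

lemma incl_tangent:
  assumes "p \<in> C" "v \<in> tangent_space AC p"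
  shows "incl A m C p v \<in> tangent_space A p"
proof -
  obtain c' where c': "c' \<in> AC" "p \<in> chart_dom c'" using S.ex_chart[OF assms(1)] by blast
  show ?thesis unfolding incl_eq[OF c' assms(2)]
    by (rule Q.coord_field_tangent[OF ambient_in[OF c'(1)] in_dom_ambient[OF c']
          model_slice[OF c'(1) S.tangent_in_model[OF assms(2) c']]])
qed

lemma incl_component:
  assumes "c' \<in> AC" "p \<in> chart_dom c'" "v \<in> tangent_space AC p"
  shows "incl A m C p v (ambient c') = v c'"
  unfolding incl_eq[OF assms]
  by (rule Q.coord_field_self[OF ambient_in[OF assms(1)] in_dom_ambient[OF assms(1,2)]
        model_slice[OF assms(1) S.tangent_in_model[OF assms(3,1,2)]]])

lemma incl_lin:
  assumes "p \<in> C" "v \<in> tangent_space AC p" "w \<in> tangent_space AC p"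
  shows "incl A m C p (a *\<^sub>R v + b *\<^sub>R w) = a *\<^sub>R incl A m C p v + b *\<^sub>R incl A m C p w"
proof -
  obtain c' where c': "c' \<in> AC" "p \<in> chart_dom c'" using S.ex_chart[OF assms(1)] by blast
  note mv = model_slice[OF c'(1) S.tangent_in_model[OF assms(2) c']]
    and mw = model_slice[OF c'(1) S.tangent_in_model[OF assms(3) c']]
  show ?thesis
    using Q.coord_field_lin[OF ambient_in[OF c'(1)] in_dom_ambient[OF c'] mv mw, of a b]
    by (simp only: incl_eq[OF c' assms(2)] incl_eq[OF c' assms(3)] incl_eq[OF c' S.tangent_lin[OF assms(2,3)]])
      (simp add: scaleR_fun_def)
qed

abbreviation "DA p \<equiv> acceleration_distribution A g m F p"

lemma decomposition:
  assumes "p \<in> C"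
  shows "{v + w |v w. v \<in> incl A m C p ` tangent_space AC p \<and> w \<in> DA p} = tangent_space A p"
    and "incl A m C p ` tangent_space AC p \<inter> DA p = {0}"
  using vhc assms unfolding regular_VHC_def Let_def by blast+

lemma subspace_DA: "subspace (DA p)"
  by (simp add: acceleration_distribution_def)

lemma incl_zero: "p \<in> C \<Longrightarrow> incl A m C p 0 = 0"
  using incl_lin[OF _ S.tangent_0 S.tangent_0, of p 0 0] by simp

lemma incl_eq_zero:
  assumes "p \<in> C" "v \<in> tangent_space AC p" "incl A m C p v \<in> DA p"
  shows "v = 0"
proof -
  obtain c' where c': "c' \<in> AC" "p \<in> chart_dom c'" using S.ex_chart[OF assms(1)] by blast
  have "incl A m C p v = 0" using assms decomposition(2)[OF assms(1)] by blast
  then have "v c' = 0 c'" using incl_component[OF c' assms(2)] by simp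
  then show ?thesis by (rule S.tangent_eqI[OF assms(2) S.tangent_0 c'])
qed

text \<open>If \<open>v\<close> and \<open>w\<close> both qualify, the image of \<open>w - v\<close> lies in \<open>TC\<close> and in the acceleration distribution,
  whose intersection is trivial.\<close>

lemma sigma_unique:
  assumes p: "p \<in> C" and v: "v \<in> tangent_space AC p" "z - incl A m C p v \<in> DA p"
  shows "sigma A g m F C p z = v"
  unfolding sigma_def
proof (rule the_equality)
  fix w assume w: "w \<in> tangent_space AC p \<and> z - incl A m C p w \<in> DA p"
  have "incl A m C p (1 *\<^sub>R w + (- 1) *\<^sub>R v) = (z - incl A m C p v) - (z - incl A m C p w)"
    using incl_lin[OF p _ v(1), of w 1 "- 1"] w by simp
  also have "\<dots> \<in> DA p" by (rule subspace_diff[OF subspace_DA v(2) conjunct2[OF w]])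
  finally have "1 *\<^sub>R w + (- 1) *\<^sub>R v = 0"
    by (intro incl_eq_zero[OF p]) (use v w S.tangent_lin in blast)+
  then show "w = v" by simp
qed (use v in simp)

lemma
  assumes p: "p \<in> C" and z: "z \<in> tangent_space A p"
  shows sigma_tangent: "sigma A g m F C p z \<in> tangent_space AC p"
    and sigma_diff: "z - incl A m C p (sigma A g m F C p z) \<in> DA p"
proof -
  obtain v w where vw: "v \<in> tangent_space AC p" "w \<in> DA p" "z = incl A m C p v + w"
    using z unfolding decomposition(1)[OF p, symmetric] by blast
  then have "z - incl A m C p v \<in> DA p" by simp
  with vw(1) sigma_unique[OF p] show "sigma A g m F C p z \<in> tangent_space AC p"
    "z - incl A m C p (sigma A g m F C p z) \<in> DA p" by auto
qed

lemma sigma_lin: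
  assumes p: "p \<in> C" and z: "z \<in> tangent_space A p" "w \<in> tangent_space A p"
  shows "sigma A g m F C p (a *\<^sub>R z + b *\<^sub>R w) = a *\<^sub>R sigma A g m F C p z + b *\<^sub>R sigma A g m F C p w"
proof (rule sigma_unique[OF p S.tangent_lin])
  show "sigma A g m F C p z \<in> tangent_space AC p" "sigma A g m F C p w \<in> tangent_space AC p"
    using sigma_tangent[OF p] z by auto
  have "a *\<^sub>R (z - incl A m C p (sigma A g m F C p z)) + b *\<^sub>R (w - incl A m C p (sigma A g m F C p w)) \<in> DA p"
    using sigma_diff[OF p] z subspace_DA by (intro subspace_add subspace_scale) auto
  also have "a *\<^sub>R (z - incl A m C p (sigma A g m F C p z)) + b *\<^sub>R (w - incl A m C p (sigma A g m F C p w))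
      = a *\<^sub>R z + b *\<^sub>R w - incl A m C p (a *\<^sub>R sigma A g m F C p z + b *\<^sub>R sigma A g m F C p w)"
    unfolding incl_lin[OF p sigma_tangent[OF p z(1)] sigma_tangent[OF p z(2)]] by (simp add: scaleR_diff_right)
  finally show "a *\<^sub>R z + b *\<^sub>R w - incl A m C p (a *\<^sub>R sigma A g m F C p z + b *\<^sub>R sigma A g m F C p w) \<in> DA p" .
qed

lemma sigma_incl:
  assumes p: "p \<in> C" and v: "v \<in> tangent_space AC p"
  shows "sigma A g m F C p (incl A m C p v) = v"
  by (rule sigma_unique[OF p v]) (simp add: subspace_0[OF subspace_DA])

end

context vhc
begin

lemma smooth_metric_coord:
  assumes "c \<in> A" "smooth_vector_field A (chart_dom c) Z" "w \<in> model c"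
  shows "smooth_on (chart_map c ` chart_dom c) (\<lambda>x. g (chart_inv c x) (Z (chart_inv c x)) (coord_field A c w (chart_inv c x)))"
proof -
  have "smooth_fun A (chart_dom c) (\<lambda>p. g p (Z p) (coord_field A c w p))"
    by (rule g_metric[unfolded riemannian_metric_def, THEN conjunct2, rule_format,
        OF conjI[OF Q.dom_openin[OF assms(1)] conjI[OF assms(2) Q.smooth_coord_field[OF assms(1,3)]]]])
  from this[unfolded smooth_fun_def comp_def, rule_format, OF assms(1)] show ?thesis by simp
qed

lemma smooth_form_coord:
  assumes "c \<in> A" "w \<in> model c" "i \<in> {1..m}"
  shows "smooth_on (chart_map c ` chart_dom c) (\<lambda>x. F i (chart_inv c x) (coord_field A c w (chart_inv c x)))"
proof -
  have "smooth_fun A (chart_dom c) (\<lambda>p. F i p (coord_field A c w p))"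
    by (rule F_forms[OF assms(3), unfolded smooth_one_form_def, THEN conjunct2, rule_format,
        OF conjI[OF Q.dom_openin[OF assms(1)] Q.smooth_coord_field[OF assms(1,2)]]])
  from this[unfolded smooth_fun_def comp_def, rule_format, OF assms(1)] show ?thesis by simp
qed

lemma F_functional: "p \<in> Q \<Longrightarrow> i \<in> {1..m} \<Longrightarrow> linear_functional_on (tangent_space A p) (F i p)"
  using F_forms unfolding smooth_one_form_def by blast

text \<open>The value \<open>u = \<sigma>(Z)\<close> is characterised, together with multipliers \<open>\<lambda>\<^sub>i\<close>, by the equation
  \<open>Z = u + (\<Sum>i. \<lambda>\<^sub>i (F\<^sup>i)\<^sup>\<sharp>)\<close>.  Pairing it with \<open>g\<close> gives
  \<open>g(u, \<cdot>) + (\<Sum>i. \<lambda>\<^sub>i F\<^sup>i) = g(Z, \<cdot>)\<close>, a linear system for \<open>(u, \<lambda>)\<close> in which only smooth data occur.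
  Regularity of the constraint and independence of the forms make it injective.  The hypothesis on
  \<open>Z\<close> concerns \<open>g(Z, \<cdot>)\<close> because this is what is at hand for a gradient.\<close>

lemma smooth_sigma:
  assumes c': "c' \<in> AC"
    and Z: "\<And>p. p \<in> chart_dom c' \<Longrightarrow> Z p \<in> tangent_space A p"
    and gZ: "\<And>w. w \<in> model (ambient c') \<Longrightarrow>
      smooth_on (chart_map c' ` chart_dom c') (\<lambda>x. g (chart_inv c' x) (Z (chart_inv c' x)) (coord_field A (ambient c') w (chart_inv c' x)))"
  shows "smooth_on (chart_map c' ` chart_dom c') (\<lambda>x. sigma A g m F C (chart_inv c' x) (Z (chart_inv c' x)) c')"
proof -
  define c where "c = ambient c'"
  have c: "c \<in> A" using ambient_in[OF c'] by (simp add: c_def)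
  let ?U = "chart_map c' ` chart_dom c'" and ?p = "chart_inv c'"
  let ?E = "coord_field A c"
  let ?\<sigma> = "\<lambda>p. sigma A g m F C p (Z p)"
  let ?X = "\<lambda>i p. sharp A g p (F i p)"
  have U: "?p x \<in> chart_dom c'" "?p x \<in> chart_dom c" "?p x \<in> C" "?p x \<in> Q" if "x \<in> ?U" for x
    using that slice_inv[OF c'] in_dom_C[OF c'] in_dom_ambient[OF c'] C_subset by (auto simp: c_def)
  have dims: "dim (model c') + m = dim (model c)" "model c' \<subseteq> model c"
    using dim_slice[OF c'] model_slice_subset[OF c'] by (simp_all add: c_def)
  obtain \<pi> h where \<pi>: "bounded_linear \<pi>" "\<And>x. \<pi> x \<in> model c'" "\<And>x. x \<in> model c' \<Longrightarrow> \<pi> x = x"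
    and h: "\<And>i. i \<in> {1..m} \<Longrightarrow> h i \<in> model c" "\<And>i. i \<in> {1..m} \<Longrightarrow> \<pi> (h i) = 0"
      "\<And>i x. i \<in> {1..m} \<Longrightarrow> x \<in> model c' \<Longrightarrow> x \<bullet> h i = 0"
      "\<And>i j. i \<in> {1..m} \<Longrightarrow> j \<in> {1..m} \<Longrightarrow> h i \<bullet> h j = (if i = j then 1 else 0)"
      "\<forall>z\<in>model c. \<pi> z = 0 \<longrightarrow> (\<forall>i\<in>{1..m}. z \<bullet> h i = 0) \<longrightarrow> z = 0"
    by (rule slice_coordinates[OF subspace_model subspace_model dims(2,1)]) (rule that)
  obtain \<kappa> where \<kappa>: "bounded_linear \<kappa>" "\<And>x. \<kappa> x \<in> model c" "\<And>x. x \<in> model c \<Longrightarrow> \<kappa> x = x"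
    "\<And>x y. y \<in> model c \<Longrightarrow> (x - \<kappa> x) \<bullet> y = 0"
    using ex_orthogonal_projection[OF subspace_model] by blast
  interpret \<pi>: bounded_linear \<pi> by (rule \<pi>(1))
  interpret \<kappa>: bounded_linear \<kappa> by (rule \<kappa>(1))
  have \<pi>c: "\<pi> x \<in> model c" for x using \<pi>(2) dims(2) by blast
  \<comment> \<open>The value at \<open>y\<close> of this form stands for the covector \<open>g(u, \<cdot>) + \<Sum> \<lambda>\<^sub>i F\<^sub>i\<close>, where \<open>u = \<pi> y\<close> is
    the component of \<open>y\<close> along the slice and \<open>\<lambda>\<^sub>i = y \<bullet> h i\<close> are its transverse coordinates.\<close>
  define \<Phi> where "\<Phi> p y w = g p (?E (\<pi> y) p) (?E w p) + (\<Sum>i=1..m. (y \<bullet> h i) * F i p (?E w p))" for p y w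
  \<comment> \<open>The summand \<open>y - \<kappa> y\<close> makes the map injective on the orthogonal complement of the model space.\<close>
  define L where "L x y = (\<Sum>b\<in>Basis. \<Phi> (?p x) y (\<kappa> b) *\<^sub>R b) + (y - \<kappa> y)" for x y
  have Et: "?E u p \<in> tangent_space A p" if "u \<in> model c" "p \<in> chart_dom c" for u p
    using Q.coord_field_tangent[OF c that(2,1)] .
  have sharp: "?X i p \<in> tangent_space A p" "\<And>v. v \<in> tangent_space A p \<Longrightarrow> g p (?X i p) v = F i p v"
    if "p \<in> Q" "i \<in> {1..m}" for i p
    using Q.sharp_tangent[OF g_metric that(1) F_functional[OF that]] Q.sharp_represents[OF g_metric that(1) F_functional[OF that]] by auto
  have vec: "(\<Sum>i=1..m. a i *\<^sub>R ?X i p) \<in> tangent_space A p" if "p \<in> Q" for a p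
    using sharp[OF that] by (intro subspace_sum[OF Q.subspace_tangent] Q.tangent_scale) auto
  have \<Phi>_metric: "\<Phi> p y w = g p (?E (\<pi> y) p + (\<Sum>i=1..m. (y \<bullet> h i) *\<^sub>R ?X i p)) (?E w p)"
    if p: "p \<in> Q" "p \<in> chart_dom c" and w: "w \<in> model c" for p y w
  proof -
    note Ew = Et[OF w p(2)]
    have "g p (\<Sum>i=1..m. (y \<bullet> h i) *\<^sub>R ?X i p) (?E w p) = (\<Sum>i=1..m. (y \<bullet> h i) * F i p (?E w p))"
      using Q.metric_sum_left[OF g_metric p(1) Ew, of "{1..m}" "\<lambda>i. ?X i p" "\<lambda>i. y \<bullet> h i"] sharp[OF p(1)] Ew by simp
    then show ?thesis
      using Q.metric_lin_left[OF g_metric p(1) Et[OF \<pi>c p(2)] vec[OF p(1)] Ew, of 1 y 1 "\<lambda>i. y \<bullet> h i"]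
      by (simp add: \<Phi>_def del: plus_fun_apply)
  qed
  have \<Phi>_functional: "\<exists>\<omega>. linear_functional_on (tangent_space A p) \<omega> \<and> (\<forall>w\<in>model c. \<Phi> p y w = \<omega> (?E w p))"
    if p: "p \<in> Q" "p \<in> chart_dom c" for p y
    using Q.metric_functional[OF g_metric p(1) Q.tangent_add[OF Et[OF \<pi>c p(2)] vec[OF p(1)]], of y "\<lambda>i. y \<bullet> h i"] \<Phi>_metric[OF p] by blast
  have L_dot: "L x y \<bullet> w = \<Phi> (?p x) y w" if x: "x \<in> ?U" and w: "w \<in> model c" for x y w
  proof -
    obtain \<omega> where \<omega>: "linear_functional_on (tangent_space A (?p x)) \<omega>" "\<And>w. w \<in> model c \<Longrightarrow> \<Phi> (?p x) y w = \<omega> (?E w (?p x))"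
      using \<Phi>_functional[OF U(4,2)[OF x]] by blast
    show ?thesis
      using Q.functional_coord_field_expansion[OF \<omega>(1) c U(2)[OF x] \<kappa>(1,2), of w] \<kappa>(2-4) w \<omega>(2)
      by (simp add: L_def inner_add_left)
  qed
  have lin: "linear (L x)" if x: "x \<in> ?U" for x
  proof
    note p = U[OF x]
    note gl = Q.metric_lin_left[OF g_metric p(4) Et[OF \<pi>c p(2)] Et[OF \<pi>c p(2)] Et[OF \<kappa>(2) p(2)]]
    show "L x (y + z) = L x y + L x z" for y z
      using gl[of 1 y 1 z] Q.coord_field_lin[OF c p(2) \<pi>c \<pi>c, of 1 y 1 z]
      by (simp add: L_def \<Phi>_def \<pi>.add \<kappa>.add inner_add_left distrib_right sum.distrib scaleR_add_left)
    show "L x (r *\<^sub>R y) = r *\<^sub>R L x y" for r y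
      using gl[of r y 0 y] Q.coord_field_lin[OF c p(2) \<pi>c \<pi>c, of r y 0 y]
      by (simp add: L_def \<Phi>_def \<pi>.scaleR \<kappa>.scaleR scaleR_sum_right sum_distrib_left distrib_left mult.assoc scaleR_add_right scaleR_diff_right)
  qed
  have inj: "z = 0" if x: "x \<in> ?U" and 0: "L x z = 0" for x z
  proof -
    note p = U[OF x]
    have \<Phi>0: "\<Phi> (?p x) z w = 0" if "w \<in> model c" for w using L_dot[OF x that, of z] 0 by simp
    then have zc: "z \<in> model c" using 0 \<kappa>(2)[of z] \<kappa>(2) by (simp add: L_def)
    define V where "V = (\<Sum>i=1..m. (z \<bullet> h i) *\<^sub>R ?X i (?p x))"
    define a where "a = coord_field AC c' (\<pi> z) (?p x)"
    have a: "a \<in> tangent_space AC (?p x)" "a c' = \<pi> z"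
      using S.coord_field_tangent[OF c' p(1) \<pi>(2)] S.coord_field_self[OF c' p(1) \<pi>(2)] by (simp_all add: a_def)
    have ia: "incl A m C (?p x) a = ?E (\<pi> z) (?p x)"
      using incl_eq[OF c' p(1) a(1)] a(2) by (simp add: c_def)
    have VT: "V \<in> tangent_space A (?p x)" unfolding V_def by (rule vec[OF p(4)])
    have VD: "V \<in> DA (?p x)"
      unfolding V_def acceleration_distribution_def by (intro span_sum span_scale span_base) auto
    have T: "incl A m C (?p x) a + V \<in> tangent_space A (?p x)"
      by (rule Q.tangent_add[OF incl_tangent[OF p(3) a(1)] VT])
    have "incl A m C (?p x) a + V = 0"
    proof (rule Q.metric_nondegenerate[OF g_metric p(4) T Q.tangent_0])
      fix v assume v: "v \<in> tangent_space A (?p x)"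
      note vm = Q.tangent_in_model[OF v c p(2)]
      have "g (?p x) 0 v = 0" using Q.metric_lin_left[OF g_metric p(4) Q.tangent_0 Q.tangent_0 v, of 0 0] by simp
      then show "g (?p x) (incl A m C (?p x) a + V) v = g (?p x) 0 v"
        using \<Phi>0[OF vm] \<Phi>_metric[OF p(4,2) vm, of z] Q.tangent_eq_coord_field[OF v c p(2)]
        by (simp add: ia V_def del: plus_fun_apply)
    qed
    then have eq: "incl A m C (?p x) a = - V" by (rule eq_neg_iff_add_eq_0[THEN iffD2])
    have "a = 0"
      by (rule incl_eq_zero[OF p(3) a(1)]) (simp only: eq subspace_neg[OF subspace_DA VD])
    then have \<pi>z: "\<pi> z = 0" using a(2) by simp
    have V0: "V = 0" using eq \<open>a = 0\<close> incl_zero[OF p(3)] by simp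
    have "z \<bullet> h i = 0" if i: "i \<in> {1..m}" for i
    proof (rule F_independent[OF p(4) _ i])
      fix v assume v: "v \<in> tangent_space A (?p x)"
      have "(\<Sum>i=1..m. (z \<bullet> h i) * F i (?p x) v) = g (?p x) V v"
        unfolding V_def using Q.metric_sum_left[OF g_metric p(4) v, of "{1..m}" "\<lambda>i. ?X i (?p x)"] sharp[OF p(4)] v by simp
      also have "\<dots> = 0" unfolding V0 using Q.metric_lin_left[OF g_metric p(4) Q.tangent_0 Q.tangent_0 v, of 0 0] by simp
      finally show "(\<Sum>i=1..m. (z \<bullet> h i) * F i (?p x) v) = 0" .
    qed
    then show "z = 0" using h(5) zc \<pi>z by blast
  qed
  have smooth_L: "smooth_on ?U (\<lambda>x. L x y)" for y
  proof -
    have sub: "?U \<subseteq> chart_map c ` chart_dom c" using dom_slice[OF c'] map_slice[OF c'] by (auto simp: c_def)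
    have inv: "?p x = chart_inv c x" if "x \<in> ?U" for x using slice_inv_eq[OF c' that] by (simp add: c_def)
    have \<Phi>s: "smooth_on ?U (\<lambda>x. \<Phi> (chart_inv c x) y w)" if w: "w \<in> model c" for w
      unfolding \<Phi>_def
      by (intro smooth_on_add smooth_on_sum smooth_on_mult smooth_on_const
          smooth_on_subset[OF smooth_metric_coord[OF c Q.smooth_coord_field[OF c \<pi>c] w] sub]
          smooth_on_subset[OF smooth_form_coord[OF c w] sub])
    have "smooth_on ?U (\<lambda>x. (\<Sum>b\<in>Basis. \<Phi> (chart_inv c x) y (\<kappa> b) *\<^sub>R b) + (y - \<kappa> y))"
      by (intro smooth_on_add smooth_on_sum smooth_on_scaleR smooth_on_const \<Phi>s \<kappa>(2))
    then show ?thesis by (rule smooth_on_cong[rotated]) (simp add: L_def inv)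
  qed
  have "\<exists>y. \<pi> y = ?\<sigma> (?p x) c' \<and> L x y = (\<Sum>b\<in>Basis. g (?p x) (Z (?p x)) (?E (\<kappa> b) (?p x)) *\<^sub>R b)"
    if x: "x \<in> ?U" for x
  proof -
    note p = U[OF x]
    note ZT = Z[OF p(1)]
    note \<sigma>T = sigma_tangent[OF p(3) ZT]
    let ?u = "?\<sigma> (?p x) c'"
    have u: "?u \<in> model c'" by (rule S.tangent_in_model[OF \<sigma>T c' p(1)])
    obtain l where l: "Z (?p x) - incl A m C (?p x) (?\<sigma> (?p x)) = (\<Sum>i\<in>{1..m}. l i *\<^sub>R ?X i (?p x))"
      using span_image_sum[OF _ sigma_diff[OF p(3) ZT, unfolded acceleration_distribution_def]] by blast
    define y where "y = ?u + (\<Sum>j=1..m. l j *\<^sub>R h j)"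
    have \<pi>y: "\<pi> y = ?u" unfolding y_def \<pi>.add \<pi>.sum \<pi>.scaleR using \<pi>(3)[OF u] h(2) by simp
    have yh: "y \<bullet> h i = l i" if i: "i \<in> {1..m}" for i
    proof -
      have "(\<Sum>j=1..m. l j * (h j \<bullet> h i)) = (\<Sum>j=1..m. if j = i then l j else 0)"
        by (rule sum.cong[OF refl]) (use h(4) i in auto)
      also have "\<dots> = l i" using i by simp
      finally show ?thesis using h(3)[OF i u] by (simp add: y_def inner_add_left inner_sum_left)
    qed
    have ym: "y \<in> model c"
      unfolding y_def using u dims(2) h(1)
      by (intro subspace_add[OF subspace_model] subspace_sum[OF subspace_model] subspace_scale[OF subspace_model]) auto
    have iE: "incl A m C (?p x) (?\<sigma> (?p x)) = ?E (\<pi> y) (?p x)"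
      using incl_eq[OF c' p(1) \<sigma>T] \<pi>y by (simp add: c_def)
    have "?E (\<pi> y) (?p x) + (\<Sum>i=1..m. (y \<bullet> h i) *\<^sub>R ?X i (?p x)) = ?E (\<pi> y) (?p x) + (\<Sum>i=1..m. l i *\<^sub>R ?X i (?p x))"
      using yh by simp
    also have "\<dots> = Z (?p x)" unfolding l[symmetric] iE by simp
    finally have "\<Phi> (?p x) y w = g (?p x) (Z (?p x)) (?E w (?p x))" if "w \<in> model c" for w
      using \<Phi>_metric[OF p(4,2) that, of y] by simp
    then show ?thesis using \<pi>y \<kappa>(2) \<kappa>(3)[OF ym] by (intro exI[of _ y]) (simp add: L_def)
  qed
  then have "\<forall>x\<in>?U. \<exists>y. \<pi> y = ?\<sigma> (?p x) c' \<and> L x y = (\<Sum>b\<in>Basis. g (?p x) (Z (?p x)) (?E (\<kappa> b) (?p x)) *\<^sub>R b)"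
    by (rule ballI)
  from bchoice[OF this] obtain y where y: "\<And>x. x \<in> ?U \<Longrightarrow> \<pi> (y x) = ?\<sigma> (?p x) c'"
    "\<And>x. x \<in> ?U \<Longrightarrow> L x (y x) = (\<Sum>b\<in>Basis. g (?p x) (Z (?p x)) (?E (\<kappa> b) (?p x)) *\<^sub>R b)"
    by blast
  have rhs: "smooth_on ?U (\<lambda>x. \<Sum>b\<in>Basis. g (?p x) (Z (?p x)) (?E (\<kappa> b) (?p x)) *\<^sub>R b)"
    by (intro smooth_on_sum smooth_on_scaleR smooth_on_const) (use gZ \<kappa>(2) in \<open>simp add: c_def\<close>)
  have "smooth_on ?U y"
    by (rule smooth_on_linear_solution[of ?U L]) (fact lin inj smooth_L rhs y(2))+
  then have "smooth_on ?U (\<lambda>x. \<pi> (y x))" by (rule smooth_on_linear_comp[OF \<pi>(1)])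
  then show ?thesis by (rule smooth_on_cong[rotated]) (use y(1) in auto)
qed

lemma grad_tangent: "p \<in> Q \<Longrightarrow> grad A g P p \<in> tangent_space A p"
  and grad_represents: "p \<in> Q \<Longrightarrow> v \<in> tangent_space A p \<Longrightarrow> g p (grad A g P p) v = dfun A P p v"
  unfolding grad_def
  using Q.sharp_tangent[OF g_metric _ Q.dfun_functional[OF P_smooth]] Q.sharp_represents[OF g_metric _ Q.dfun_functional[OF P_smooth]] by blast+

text \<open>Pairing the gradient with a coordinate field gives a directional derivative of \<open>P\<close>.\<close>

lemma smooth_sigma_grad:
  assumes c': "c' \<in> AC"
  shows "smooth_on (chart_map c' ` chart_dom c') (\<lambda>x. sigma A g m F C (chart_inv c' x) (grad A g P (chart_inv c' x)) c')"
proof (rule smooth_sigma[OF c'])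
  show "grad A g P p \<in> tangent_space A p" if "p \<in> chart_dom c'" for p
    using grad_tangent C_subset in_dom_C[OF c'] that by blast
  fix w assume w: "w \<in> model (ambient c')"
  define c where "c = ambient c'"
  have c: "c \<in> A" "w \<in> model c" using ambient_in[OF c'] w by (simp_all add: c_def)
  have sP: "smooth_on (chart_map c ` chart_dom c) (\<lambda>x. P (chart_inv c x))"
  proof -
    have "chart_dom c \<inter> Q = chart_dom c" using Q.dom_subset[OF c(1)] by blast
    with P_smooth[unfolded smooth_fun_def comp_def, rule_format, OF c(1)] show ?thesis by simp
  qed
  have "smooth_on (chart_map c ` chart_dom c) (\<lambda>x. dir_deriv (\<lambda>x. P (chart_inv c x)) x w)"
    by (intro smooth_on_dir_deriv[OF Q.image_dom_subspace_open[OF c(1)] sP] smooth_on_bounded_linear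
        bounded_linear_ident smooth_on_const) (use c in auto)
  then have "smooth_on (chart_map c' ` chart_dom c') (\<lambda>x. dir_deriv (\<lambda>x. P (chart_inv c x)) x w)"
    by (rule smooth_on_subset) (use dom_slice[OF c'] map_slice[OF c'] in \<open>auto simp: c_def\<close>)
  then show "smooth_on (chart_map c' ` chart_dom c') (\<lambda>x. g (chart_inv c' x) (grad A g P (chart_inv c' x)) (coord_field A (ambient c') w (chart_inv c' x)))"
  proof (rule smooth_on_cong[rotated])
    fix x assume "x \<in> chart_map c' ` chart_dom c'"
    then obtain p where p: "p \<in> chart_dom c'" "x = chart_map c' p" by blast
    have pc: "p \<in> chart_dom c" "p \<in> Q" using p in_dom_ambient[OF c'] C_subset in_dom_C[OF c'] by (auto simp: c_def)
    have x: "x = chart_map c p" using p map_slice[OF c'] by (simp add: c_def)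
    note E = Q.coord_field_tangent[OF c(1) pc(1) c(2)]
    show "dir_deriv (\<lambda>x. P (chart_inv c x)) x w = g (chart_inv c' x) (grad A g P (chart_inv c' x)) (coord_field A (ambient c') w (chart_inv c' x))"
      using grad_represents[OF pc(2) E] Q.dfun_eq[OF openin_subtopology_self P_smooth c(1) pc(1,2) E] Q.coord_field_self[OF c(1) pc(1) c(2)] x
        slice_inv[OF c' p(1)] p(2)
      by (simp add: c_def)
  qed
qed

text \<open>In a slice chart a field on \<open>C\<close> is extended constantly along the fibres of a linear projection onto
  the slice.\<close>

lemma ex_extension:
  assumes W: "openin (top_of_set C) W" "smooth_vector_field AC W Y" "p \<in> W"
  shows "\<exists>Y'. extends_near Q A m C p Y Y'"
proof -
  have "p \<in> C" using W openin_imp_subset by blast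
  then obtain c' where c': "c' \<in> AC" "p \<in> chart_dom c'" using S.ex_chart by blast
  define c where "c = ambient c'"
  have c: "c \<in> A" "p \<in> chart_dom c" using ambient_in[OF c'(1)] in_dom_ambient[OF c'] by (simp_all add: c_def)
  have mp: "chart_map c' = chart_map c" using map_slice[OF c'(1)] by (simp add: c_def)
  obtain \<pi> where \<pi>: "bounded_linear \<pi>" "\<And>x. \<pi> x \<in> model c'" "\<And>x. x \<in> model c' \<Longrightarrow> \<pi> x = x"
    using ex_linear_projection[OF subspace_model] by blast
  let ?y = "\<lambda>x. Y (chart_inv c' x) c'"
  define V where "V = chart_map c' ` (chart_dom c' \<inter> W)"
  have y: "smooth_on V ?y" using S.smooth_field_rep[OF W(2) c'(1)] by (simp add: V_def)
  have V: "subspace_open (model c') V" unfolding V_def by (rule S.image_subspace_open[OF c'(1) W(1)])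
  obtain T where T: "open T" "V = model c' \<inter> T" using V unfolding subspace_open_def openin_open by blast
  define W' where "W' = {x \<in> chart_dom c. \<pi> (chart_map c x) \<in> V}"
  have "continuous_on (chart_dom c) (\<lambda>x. \<pi> (chart_map c x))"
    by (rule bounded_linear.continuous_on[OF \<pi>(1)]) (use Q.homeo[OF c(1)] in \<open>simp add: homeomorphism_def\<close>)
  then have "openin (top_of_set (chart_dom c)) (chart_dom c \<inter> (\<lambda>x. \<pi> (chart_map c x)) -` T)"
    using T(1) by (rule continuous_openin_preimage_gen)
  moreover have "chart_dom c \<inter> (\<lambda>x. \<pi> (chart_map c x)) -` T = W'"
    using T(2) \<pi>(2) by (auto simp: W'_def)
  ultimately have W': "openin (top_of_set Q) W'" using Q.dom_openin[OF c(1)] openin_trans by metis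
  have proj: "\<pi> (chart_map c x) = chart_map c x" if "x \<in> chart_dom c'" for x
    using \<pi>(3) S.chart_map_in_model[of x c'] that mp by simp
  have yV: "?y x \<in> model c" if "x \<in> V" for x
  proof -
    from that obtain s where s: "s \<in> chart_dom c'" "s \<in> W" "x = chart_map c' s" unfolding V_def by blast
    from S.tangent_in_model[OF S.smooth_field_tangent[OF W(2) s(2)] c'(1) s(1)]
    show ?thesis using slice_inv[OF c'(1) s(1)] s(3) model_slice[OF c'(1)] by (simp add: c_def)
  qed
  define Y' where "Y' x = coord_field A c (?y (\<pi> (chart_map c x))) x" for x
  have "smooth_vector_field A W' Y'"
    unfolding Y'_def
  proof (rule Q.smooth_field_from_chart[OF c(1), where y="\<lambda>z. ?y (\<pi> z)"])
    show "smooth_on (chart_map c ` W') (\<lambda>z. ?y (\<pi> z))"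
      by (rule smooth_on_compose[OF y smooth_on_bounded_linear[OF \<pi>(1)]]) (auto simp: W'_def)
  qed (use yV in \<open>auto simp: W'_def\<close>)
  moreover have "p \<in> W'" using c c' proj[OF c'(2)] mp W(3) by (auto simp: W'_def V_def)
  moreover have "Y' x = incl A m C x (Y x)" if x: "x \<in> W' \<inter> C" for x
  proof -
    have xc: "x \<in> chart_dom c'" using x dom_slice[OF c'(1)] by (simp add: W'_def c_def)
    then have "chart_map c' x \<in> V" using x proj mp by (simp add: W'_def)
    then obtain s where "s \<in> chart_dom c'" "s \<in> W" "chart_map c' x = chart_map c' s" unfolding V_def by blast
    then have "x \<in> W" using slice_inv[OF c'(1)] xc by metis
    then show ?thesis
      using incl_eq[OF c'(1) xc S.smooth_field_tangent[OF W(2)]] proj[OF xc] slice_inv[OF c'(1) xc] mp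
      by (simp add: Y'_def c_def)
  qed
  ultimately show ?thesis unfolding extends_near_def using W' by blast
qed

definition slice_christoffel :: "('q, 'e) chart \<Rightarrow> 'q \<Rightarrow> 'e \<Rightarrow> 'e \<Rightarrow> 'e" where
  "slice_christoffel c' p u w = sigma A g m F C p
     (coord_field A (ambient c') (christoffel A D (ambient c') p u w) p) c'"

lemma christoffel_in_model:
  assumes "c \<in> A" "p \<in> chart_dom c" "u \<in> model c" "w \<in> model c"
  shows "christoffel A D c p u w \<in> model c"
  unfolding christoffel_def
  using Q.affine_tangent[OF D_connection(2) Q.dom_openin[OF assms(1)] Q.smooth_coord_field[OF assms(1,4)] assms(2) Q.coord_field_tangent[OF assms(1-3)]]
  by (rule Q.tangent_in_model[OF _ assms(1,2)])

text \<open>The derivative of an extension in a direction tangent to \<open>C\<close> only sees its values on \<open>C\<close>, which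
  is why the choice of the extension does not matter.  This derivative is tangent to \<open>C\<close> and fixed by
  \<open>\<sigma>\<close>; the remaining term contains no derivative.\<close>

lemma induced_connection_chart:
  assumes W: "openin (top_of_set C) W" "smooth_vector_field AC W Y" "p \<in> W" "v \<in> tangent_space AC p"
  shows "DC p v Y \<in> tangent_space AC p"
    and "c' \<in> AC \<Longrightarrow> p \<in> chart_dom c' \<Longrightarrow>
      DC p v Y c' = dir_deriv (\<lambda>x. Y (chart_inv c' x) c') (chart_map c' p) (v c') + slice_christoffel c' p (v c') (Y p c')"
proof -
  have pC: "p \<in> C" using W openin_imp_subset by blast
  define Y' where "Y' = (SOME Y'. extends_near Q A m C p Y Y')"
  have "extends_near Q A m C p Y Y'"
    unfolding Y'_def by (rule someI_ex[OF ex_extension[OF W(1-3)]])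
  then obtain W' where W': "openin (top_of_set Q) W'" "p \<in> W'" "smooth_vector_field A W' Y'"
    "\<And>x. x \<in> W' \<inter> C \<Longrightarrow> Y' x = incl A m C x (Y x)" unfolding extends_near_def by blast
  note iv = incl_tangent[OF pC W(4)]
  have DY: "D p (incl A m C p v) Y' \<in> tangent_space A p"
    by (rule Q.affine_tangent[OF D_connection(2) W'(1,3,2) iv])
  have DC: "DC p v Y = sigma A g m F C p (D p (incl A m C p v) Y')"
    by (simp add: induced_connection_def Y'_def)
  show "DC p v Y \<in> tangent_space AC p" unfolding DC by (rule sigma_tangent[OF pC DY])
  assume c': "c' \<in> AC" "p \<in> chart_dom c'"
  define c where "c = ambient c'"
  have c: "c \<in> A" "p \<in> chart_dom c" using ambient_in[OF c'(1)] in_dom_ambient[OF c'] by (simp_all add: c_def)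
  have mp: "chart_map c' = chart_map c" using map_slice[OF c'(1)] by (simp add: c_def)
  have vm: "v c' \<in> model c'" by (rule S.tangent_in_model[OF W(4) c'])
  note YT = S.smooth_field_tangent[OF W(2)]
  have Ym: "Y p c' \<in> model c'" by (rule S.tangent_in_model[OF YT[OF W(3)] c'])
  let ?y = "\<lambda>x. Y (chart_inv c' x) c'"
  let ?d = "dir_deriv ?y (chart_map c' p) (v c')" and ?k = "christoffel A D c p (v c') (Y p c')"
  have S: "subspace_open (model c') (chart_map c' ` (chart_dom c' \<inter> W))" by (rule S.image_subspace_open[OF c'(1) W(1)])
  have "Y x c' \<in> model c'" if "x \<in> chart_dom c'" "x \<in> W" for x using S.tangent_in_model[OF YT[OF that(2)] c'(1) that(1)] .
  then have dm: "?d \<in> model c'"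
    by (intro dir_deriv_in_subspace[OF S S.smooth_field_rep[OF W(2) c'(1)] _ vm subspace_model])
      (use c' W(3) slice_inv[OF c'(1)] in auto)
  have km: "?k \<in> model c"
    using christoffel_in_model[OF c] model_slice[OF c'(1)] vm Ym by (simp add: c_def)
  have "D p (incl A m C p v) Y' c = dir_deriv (\<lambda>x. Y' (chart_inv c x) c) (chart_map c p) (incl A m C p v c)
      + christoffel A D c p (incl A m C p v c) (Y' p c)"
    by (rule Q.christoffel_formD(2)[OF Q.affine_has_christoffel_form[OF D_connection(2)] W'(1,3,2) iv c])
  also have "incl A m C p v c = v c'" using incl_component[OF c' W(4)] by (simp add: c_def)
  also have "Y' p c = Y p c'"
    using W'(4)[of p] W'(2) pC incl_component[OF c' YT[OF W(3)]] by (simp add: c_def)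
  also have "dir_deriv (\<lambda>x. Y' (chart_inv c x) c) (chart_map c p) (v c') = ?d"
    unfolding mp[symmetric]
  proof (rule dir_deriv_cong[OF S.image_subspace_open[OF c'(1) openin_Int[OF W(1) openin_C[OF W'(1)]]] _ vm])
    fix x assume "x \<in> chart_map c' ` (chart_dom c' \<inter> (W \<inter> (W' \<inter> C)))"
    then obtain s where s: "s \<in> chart_dom c'" "s \<in> W" "s \<in> W' \<inter> C" "x = chart_map c' s" by blast
    have "chart_inv c x = s" "chart_inv c' x = s"
      using s slice_inv[OF c'(1) s(1)] slice_inv_eq[OF c'(1), of x] by (auto simp: c_def)
    then show "Y' (chart_inv c x) c = ?y x"
      using W'(4)[OF s(3)] incl_component[OF c'(1) s(1) YT[OF s(2)]] by (simp add: c_def)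
  qed (use c' W W' pC in auto)
  finally have comp: "D p (incl A m C p v) Y' c = ?d + ?k" .
  define a where "a = coord_field AC c' ?d p"
  have a: "a \<in> tangent_space AC p" "a c' = ?d"
    using S.coord_field_tangent[OF c' dm] S.coord_field_self[OF c' dm] by (simp_all add: a_def)
  note KT = Q.coord_field_tangent[OF c km]
  note ia = incl_tangent[OF pC a(1)]
  have "D p (incl A m C p v) Y' = 1 *\<^sub>R incl A m C p a + 1 *\<^sub>R coord_field A c ?k p"
  proof (rule Q.tangent_eqI[OF DY Q.tangent_lin[OF ia KT] c])
    show "D p (incl A m C p v) Y' c = (1 *\<^sub>R incl A m C p a + 1 *\<^sub>R coord_field A c ?k p) c"
      using comp incl_component[OF c' a(1)] a(2) Q.coord_field_self[OF c km] by (simp add: c_def)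
  qed
  then have "DC p v Y = 1 *\<^sub>R a + 1 *\<^sub>R sigma A g m F C p (coord_field A c ?k p)"
    unfolding DC by (simp only: sigma_lin[OF pC ia KT] sigma_incl[OF pC a(1)])
  then show "DC p v Y c' = ?d + slice_christoffel c' p (v c') (Y p c')"
    using a(2) by (simp add: slice_christoffel_def c_def)
qed

lemma induced_christoffel:
  assumes c': "c' \<in> AC" "p \<in> chart_dom c'" "u \<in> model c'" "w \<in> model c'"
  shows "christoffel AC DC c' p u w = slice_christoffel c' p u w"
  unfolding christoffel_def
  using induced_connection_chart(2)[OF S.dom_openin[OF c'(1)] S.smooth_coord_field[OF c'(1,4)] c'(2) S.coord_field_tangent[OF c'(1-3)] c'(1,2)]
    S.dir_deriv_coord_field_rep[OF c'] S.coord_field_self[OF c'(1,2)] c'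
  by simp

theorem induced_has_christoffel_form: "has_christoffel_form C AC DC"
  unfolding has_christoffel_form_def
proof (intro allI impI conjI ballI)
  fix W Y p v assume *: "openin (top_of_set C) W" "smooth_vector_field AC W Y" "p \<in> W" "v \<in> tangent_space AC p"
  show "DC p v Y \<in> tangent_space AC p" by (rule induced_connection_chart(1)[OF *])
  fix c' assume c': "c' \<in> AC" "p \<in> chart_dom c'"
  show "DC p v Y c' = dir_deriv (\<lambda>x. Y (chart_inv c' x) c') (chart_map c' p) (v c') + christoffel AC DC c' p (v c') (Y p c')"
    using induced_connection_chart(2)[OF * c']
      induced_christoffel[OF c' S.tangent_in_model[OF *(4) c'] S.tangent_in_model[OF S.smooth_field_tangent[OF *(2,3)] c']]
    by simp
qed

lemma induced_christoffel_sym: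
  assumes c': "c' \<in> AC" "p \<in> chart_dom c'" "u \<in> model c'" "w \<in> model c'"
  shows "christoffel AC DC c' p u w = christoffel AC DC c' p w u"
  using Q.torsion_free_christoffel_sym[OF D_connection(3) ambient_in[OF c'(1)] in_dom_ambient[OF c'(1,2)]
      model_slice[OF c'(1,3)] model_slice[OF c'(1,4)]]
  by (simp add: induced_christoffel c' slice_christoffel_def)

lemma induced_christoffel_lin_right:
  assumes c': "c' \<in> AC" "p \<in> chart_dom c'" "u \<in> model c'" "w \<in> model c'" "z \<in> model c'"
  shows "christoffel AC DC c' p u (a *\<^sub>R w + b *\<^sub>R z) = a *\<^sub>R christoffel AC DC c' p u w + b *\<^sub>R christoffel AC DC c' p u z"
proof -
  note c = ambient_in[OF c'(1)] in_dom_ambient[OF c'(1,2)]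
  note m = model_slice[OF c'(1,3)] model_slice[OF c'(1,4)] model_slice[OF c'(1,5)]
  note k = christoffel_in_model[OF c m(1,2)] christoffel_in_model[OF c m(1,3)]
  have s: "a *\<^sub>R w + b *\<^sub>R z \<in> model c'" by (intro subspace_add subspace_scale subspace_model c')
  show ?thesis
    unfolding induced_christoffel[OF c'(1-3) s] induced_christoffel[OF c'(1-4)] induced_christoffel[OF c'(1-3,5)]
      slice_christoffel_def Q.affine_christoffel_lin_right[OF D_connection(2) c m] Q.coord_field_lin[OF c k]
      sigma_lin[OF in_dom_C[OF c'(1,2)] Q.coord_field_tangent[OF c k(1)] Q.coord_field_tangent[OF c k(2)]]
    by (simp add: scaleR_fun_def)
qed

lemma smooth_induced_christoffel:
  assumes c': "c' \<in> AC" "u \<in> model c'" "w \<in> model c'"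
  shows "smooth_on (chart_map c' ` chart_dom c') (\<lambda>x. christoffel AC DC c' (chart_inv c' x) u w)"
proof -
  define c where "c = ambient c'"
  have c: "c \<in> A" "u \<in> model c" "w \<in> model c"
    using ambient_in[OF c'(1)] model_slice[OF c'(1)] c' by (simp_all add: c_def)
  define Z where "Z p = D p (coord_field A c u p) (coord_field A c w)" for p
  have Z: "smooth_vector_field A (chart_dom c) Z"
    unfolding Z_def
    by (rule D_connection(2)[unfolded affine_connection_def, THEN spec, THEN spec, THEN mp,
        OF conjI[OF Q.dom_openin[OF c(1)] Q.smooth_coord_field[OF c(1,3)]],
        THEN conjunct2, THEN spec, THEN mp, OF Q.smooth_coord_field[OF c(1,2)]])
  have dom: "p \<in> chart_dom c" if "p \<in> chart_dom c'" for p using in_dom_ambient[OF c'(1) that] by (simp add: c_def)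
  have ZT: "Z p \<in> tangent_space A p" if "p \<in> chart_dom c'" for p
    by (rule Q.smooth_field_tangent[OF Z dom[OF that]])
  have "smooth_on (chart_map c' ` chart_dom c') (\<lambda>x. sigma A g m F C (chart_inv c' x) (Z (chart_inv c' x)) c')"
  proof (rule smooth_sigma[OF c'(1) ZT])
    fix z assume "z \<in> model (ambient c')"
    then have "smooth_on (chart_map c ` chart_dom c) (\<lambda>x. g (chart_inv c x) (Z (chart_inv c x)) (coord_field A c z (chart_inv c x)))"
      by (intro smooth_metric_coord[OF c(1) Z]) (simp add: c_def)
    then have "smooth_on (chart_map c' ` chart_dom c') (\<lambda>x. g (chart_inv c x) (Z (chart_inv c x)) (coord_field A c z (chart_inv c x)))"
      by (rule smooth_on_subset) (use dom_slice[OF c'(1)] map_slice[OF c'(1)] in \<open>auto simp: c_def\<close>)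
    then show "smooth_on (chart_map c' ` chart_dom c') (\<lambda>x. g (chart_inv c' x) (Z (chart_inv c' x)) (coord_field A (ambient c') z (chart_inv c' x)))"
      by (rule smooth_on_cong[rotated]) (simp add: slice_inv_eq[OF c'(1)] c_def)
  qed
  then show ?thesis
  proof (rule smooth_on_cong[rotated])
    fix x assume "x \<in> chart_map c' ` chart_dom c'"
    then obtain p where p: "p \<in> chart_dom c'" "x = chart_map c' p" by blast
    then have px: "chart_inv c' x = p" using slice_inv[OF c'(1)] by simp
    show "sigma A g m F C (chart_inv c' x) (Z (chart_inv c' x)) c' = christoffel AC DC c' (chart_inv c' x) u w"
      unfolding px induced_christoffel[OF c'(1) p(1) c'(2,3)] slice_christoffel_def
      using Q.tangent_eq_coord_field[OF ZT[OF p(1)] c(1) dom[OF p(1)]]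
      by (simp add: Z_def christoffel_def c_def)
  qed
qed

end

section \<open>Existence of smooth solutions of second-order equations\<close>

lemma C1_lipschitz_on_compact_convex:
  fixes F :: "'a::euclidean_space \<Rightarrow> 'b::real_normed_vector"
  assumes "open U" "smooth_on U F" "B \<subseteq> U" "compact B" "convex B"
  obtains K where "K > 0" "\<And>x y. x \<in> B \<Longrightarrow> y \<in> B \<Longrightarrow> norm (F x - F y) \<le> K * norm (x - y)"
proof -
  have U: "subspace_open UNIV U" using assms(1) by (simp add: subspace_open_def)
  have "C_k_on (Suc 0) U F" using assms(2) by (simp add: smooth_on_def del: C_k_on.simps)
  from C_k_on_dir_deriv[OF U this] obtain F' where F': "\<And>x. x \<in> U \<Longrightarrow> (F has_derivative F' x) (at x)"
    "\<And>u. C_k_on 0 U (\<lambda>x. F' x u)" by metis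
  have "\<exists>M. \<forall>x\<in>B. norm (F' x b) \<le> M" for b
  proof -
    have "continuous_on B (\<lambda>x. F' x b)" using F'(2)[of b] assms(3) continuous_on_subset by auto
    then have "bounded ((\<lambda>x. F' x b) ` B)" using compact_continuous_image assms(4) compact_imp_bounded by blast
    then show ?thesis by (auto simp: bounded_iff)
  qed
  then obtain M where M: "\<And>b x. x \<in> B \<Longrightarrow> norm (F' x b) \<le> M b" by metis
  define K where "K = (\<Sum>b\<in>Basis. \<bar>M b\<bar>) + 1"
  have K: "K > 0" unfolding K_def by (intro add_nonneg_pos sum_nonneg) auto
  have on: "onorm (F' x) \<le> K" if x: "x \<in> B" for x
  proof (rule onorm_le)
    fix u
    have "F' x u = (\<Sum>b\<in>Basis. (u \<bullet> b) *\<^sub>R F' x b)"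
      using F'(1) x assms(3) has_derivative_linear by (intro linear_basis_expansion) blast
    then have "norm (F' x u) \<le> (\<Sum>b\<in>Basis. norm ((u \<bullet> b) *\<^sub>R F' x b))" using norm_sum[of "\<lambda>b. (u \<bullet> b) *\<^sub>R F' x b" Basis] by simp
    also have "\<dots> \<le> (\<Sum>b\<in>Basis. norm u * \<bar>M b\<bar>)"
    proof (rule sum_mono)
      fix b :: 'a assume b: "b \<in> Basis"
      have "norm (F' x b) \<le> \<bar>M b\<bar>" using M[OF x, of b] by linarith
      then show "norm ((u \<bullet> b) *\<^sub>R F' x b) \<le> norm u * \<bar>M b\<bar>"
        using Basis_le_norm[OF b, of u] by (simp add: mult_mono)
    qed
    also have "\<dots> = (\<Sum>b\<in>Basis. \<bar>M b\<bar>) * norm u" by (simp add: sum_distrib_left mult.commute)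
    also have "\<dots> \<le> K * norm u" unfolding K_def by (intro mult_right_mono) auto
    finally show "norm (F' x u) \<le> K * norm u" .
  qed
  have "norm (F x - F y) \<le> K * norm (x - y)" if xy: "x \<in> B" "y \<in> B" for x y
  proof (rule differentiable_bound[OF assms(5) _ on xy])
    show "(F has_derivative F' x) (at x within B)" if "x \<in> B" for x
      using F'(1) that assms(3) has_derivative_at_withinI by blast
  qed
  then show ?thesis using that K by blast
qed

text \<open>The integral operator is a contraction on the bounded continuous functions on the whole real line.
  Its values are frozen outside \<open>[-\<epsilon>, \<epsilon>]\<close> by clamping the time, so that no function space on a
  subset is needed.\<close>

lemma picard_lindelof_bounded_lipschitz:
  fixes G :: "'a::euclidean_space \<Rightarrow> 'a"
  assumes lip: "\<And>x y. norm (G x - G y) \<le> K * norm (x - y)" and bd: "\<And>x. norm (G x) \<le> N"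
    and e: "\<epsilon> > 0" "\<epsilon> * K \<le> 1 / 2"
  obtains z where "z 0 = z0" "\<And>t. \<bar>t\<bar> < \<epsilon> \<Longrightarrow> (z has_vector_derivative G (z t)) (at t)"
    "\<And>t. \<bar>t\<bar> < \<epsilon> \<Longrightarrow> norm (z t - z0) \<le> \<epsilon> * N"
proof -
  have K0: "K * norm (x - y) \<ge> 0" for x y :: 'a using lip[of x y] norm_ge_zero order_trans by blast
  have contG: "continuous_on UNIV G"
  proof -
    have "\<bar>K\<bar> * norm (x - y) \<ge> norm (G x - G y)" for x y
      using lip[of x y] K0[of x y] by (smt (verit) mult_right_mono norm_ge_zero)
    then have "\<bar>K\<bar>-lipschitz_on UNIV G" by (auto intro!: lipschitz_onI simp: dist_norm)
    then show ?thesis by (rule lipschitz_on_continuous_on)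
  qed
  define I where "I w t = integral {-\<epsilon>..t} (\<lambda>s. G (apply_bcontfun w s))" for w t
  define cl where "cl t = max (-\<epsilon>) (min \<epsilon> t)" for t :: real
  have cl: "cl t \<in> {-\<epsilon>..\<epsilon>}" for t using e by (auto simp: cl_def)
  have dI: "(I w has_vector_derivative G (apply_bcontfun w t)) (at t within {-\<epsilon>..\<epsilon>})" if "t \<in> {-\<epsilon>..\<epsilon>}" for w t
    unfolding I_def
    by (rule integral_has_vector_derivative[OF _ that]) (auto intro: continuous_on_compose2[OF contG])
  have bI: "norm (I w t - I w 0) \<le> \<epsilon> * N" if t: "t \<in> {-\<epsilon>..\<epsilon>}" for w t
  proof -
    have "norm (I w t - I w 0) \<le> N * norm (t - 0)"
    proof (rule differentiable_bound[where S="{-\<epsilon>..\<epsilon>}"])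
      show "(I w has_derivative (\<lambda>h. h *\<^sub>R G (apply_bcontfun w x))) (at x within {-\<epsilon>..\<epsilon>})" if "x \<in> {-\<epsilon>..\<epsilon>}" for x
        using dI[OF that] by (simp add: has_vector_derivative_def)
      show "onorm (\<lambda>h. h *\<^sub>R G (apply_bcontfun w x)) \<le> N" for x
      proof (rule onorm_le)
        fix h :: real
        show "norm (h *\<^sub>R G (apply_bcontfun w x)) \<le> N * norm h"
          using mult_left_mono[OF bd[of "apply_bcontfun w x"] abs_ge_zero[of h]] by (simp add: mult.commute)
      qed
    qed (use t e in auto)
    also have "\<dots> \<le> N * \<epsilon>" using t bd[of 0] norm_ge_zero[of "G 0"] by (intro mult_left_mono) (auto simp del: norm_ge_zero)
    finally show ?thesis by (simp add: mult.commute)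
  qed
  have mem: "(\<lambda>t. z0 + (I w (cl t) - I w 0)) \<in> bcontfun" for w
  proof (rule bcontfun_normI)
    have "continuous_on {-\<epsilon>..\<epsilon>} (I w)" using dI by (intro continuous_on_vector_derivative) auto
    moreover have "continuous_on UNIV cl" unfolding cl_def by (intro continuous_intros)
    ultimately have "continuous_on UNIV (\<lambda>t. I w (cl t))" by (rule continuous_on_compose2) (use cl in auto)
    then show "continuous_on UNIV (\<lambda>t. z0 + (I w (cl t) - I w 0))" by (intro continuous_intros)
    show "norm (z0 + (I w (cl t) - I w 0)) \<le> norm z0 + \<epsilon> * N" for t
      using norm_triangle_ineq[of z0 "I w (cl t) - I w 0"] bI[OF cl[of t], of w] by linarith
  qed
  define T where "T w = Bcontfun (\<lambda>t. z0 + (I w (cl t) - I w 0))" for w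
  have T: "apply_bcontfun (T w) t = z0 + (I w (cl t) - I w 0)" for w t
    unfolding T_def using mem by (simp add: Bcontfun_inverse)
  have "\<exists>!w. T w = w"
  proof (rule banach_fix_type[of "1/2"])
    show "\<forall>v w. dist (T v) (T w) \<le> 1 / 2 * dist v w"
    proof (intro allI dist_bound)
      fix v w t
      let ?H = "\<lambda>s. I v s - I w s"
      have Kd: "norm (G (apply_bcontfun v s) - G (apply_bcontfun w s)) \<le> \<bar>K\<bar> * dist v w" for s
      proof -
        have "norm (apply_bcontfun v s - apply_bcontfun w s) \<le> dist v w"
          using dist_bounded[of v s w] by (simp add: dist_norm)
        then have "\<bar>K\<bar> * norm (apply_bcontfun v s - apply_bcontfun w s) \<le> \<bar>K\<bar> * dist v w"
          by (rule mult_left_mono) simp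
        moreover have "K * norm (apply_bcontfun v s - apply_bcontfun w s) \<le> \<bar>K\<bar> * norm (apply_bcontfun v s - apply_bcontfun w s)"
          by (rule mult_right_mono) auto
        ultimately show ?thesis using lip[of "apply_bcontfun v s" "apply_bcontfun w s"] by linarith
      qed
      have "norm (?H (cl t) - ?H 0) \<le> (\<bar>K\<bar> * dist v w) * norm (cl t - 0)"
      proof (rule differentiable_bound[where S="{-\<epsilon>..\<epsilon>}"])
        show "(?H has_derivative (\<lambda>h. h *\<^sub>R (G (apply_bcontfun v x) - G (apply_bcontfun w x)))) (at x within {-\<epsilon>..\<epsilon>})"
          if "x \<in> {-\<epsilon>..\<epsilon>}" for x
          using has_vector_derivative_diff[OF dI[OF that] dI[OF that]] by (simp add: has_vector_derivative_def)
        show "onorm (\<lambda>h. h *\<^sub>R (G (apply_bcontfun v x) - G (apply_bcontfun w x))) \<le> \<bar>K\<bar> * dist v w" for x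
          by (rule onorm_le) (use Kd[of x] in \<open>simp add: mult.commute mult_left_mono\<close>)
      qed (use cl e in auto)
      also have "\<dots> \<le> (\<bar>K\<bar> * dist v w) * \<epsilon>" using cl[of t] by (intro mult_left_mono) auto
      also have "\<dots> = (\<epsilon> * \<bar>K\<bar>) * dist v w" by simp
      also have "\<dots> \<le> 1 / 2 * dist v w"
      proof (rule mult_right_mono)
        have "\<bar>K\<bar> = K"
        proof -
          obtain b :: 'a where "b \<in> Basis" using nonempty_Basis by blast
          then show ?thesis using K0[of b 0] by simp
        qed
        then show "\<epsilon> * \<bar>K\<bar> \<le> 1 / 2" using e by simp
      qed simp
      finally show "dist (apply_bcontfun (T v) t) (apply_bcontfun (T w) t) \<le> 1 / 2 * dist v w"
        by (simp add: T dist_norm algebra_simps)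
    qed
  qed auto
  then obtain w where w: "T w = w" by blast
  have z: "apply_bcontfun w t = z0 + (I w (cl t) - I w 0)" for t using T[of w t] w by simp
  show ?thesis
  proof (rule that[of "apply_bcontfun w"])
    show "apply_bcontfun w 0 = z0" using z[of 0] e by (simp add: cl_def)
    fix t assume t: "\<bar>t\<bar> < \<epsilon>"
    then have tin: "t \<in> {-\<epsilon><..<\<epsilon>}" by auto
    have clt: "cl s = s" if "s \<in> {-\<epsilon><..<\<epsilon>}" for s using that by (auto simp: cl_def)
    show "norm (apply_bcontfun w t - z0) \<le> \<epsilon> * N" using bI[OF cl[of t], of w] z[of t] by simp
    have "at t within {-\<epsilon>..\<epsilon>} = at t" using tin by (intro at_within_interior) (simp add: interior_atLeastAtMost_real)
    then have "(I w has_vector_derivative G (apply_bcontfun w t)) (at t)" using dI[of t w] tin by simp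
    then have "((\<lambda>s. z0 + (I w s - I w 0)) has_vector_derivative G (apply_bcontfun w t)) (at t)"
      by (auto intro!: derivative_eq_intros)
    then show "(apply_bcontfun w has_vector_derivative G (apply_bcontfun w t)) (at t)"
      by (rule has_vector_derivative_transform_within_open[OF _ open_greaterThanLessThan tin]) (simp add: z clt)
  qed
qed

text \<open>Precomposition with the nearest-point projection onto a closed ball makes \<open>F\<close> bounded and globally
  Lipschitz, and during the time \<open>\<epsilon>\<close> a solution does not leave the ball.  The equation itself then raises
  the differentiability of the solution by one order at a time.\<close>

theorem smooth_ode_solution:
  fixes F :: "'a::euclidean_space \<Rightarrow> 'a"
  assumes U: "open U" "smooth_on U F" "z0 \<in> U"
  obtains z \<epsilon> where "\<epsilon> > 0" "z 0 = z0" "smooth_on {-\<epsilon><..<\<epsilon>} z"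
    "\<And>t. t \<in> {-\<epsilon><..<\<epsilon>} \<Longrightarrow> z t \<in> U" "\<And>t. t \<in> {-\<epsilon><..<\<epsilon>} \<Longrightarrow> (z has_vector_derivative F (z t)) (at t)"
proof -
  obtain r where r: "r > 0" "cball z0 r \<subseteq> U" using U open_contains_cball by metis
  let ?B = "cball z0 r"
  have B: "compact ?B" "convex ?B" "closed ?B" "?B \<noteq> {}" using r by auto
  obtain K where K: "K > 0" "\<And>x y. x \<in> ?B \<Longrightarrow> y \<in> ?B \<Longrightarrow> norm (F x - F y) \<le> K * norm (x - y)"
    using C1_lipschitz_on_compact_convex[OF U(1,2) r(2) B(1,2)] by blast
  have "bounded (F ` ?B)"
    using smooth_on_imp_continuous_on[OF U(2)] r(2) B(1) compact_continuous_image compact_imp_bounded continuous_on_subset by metis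
  then obtain N where N: "N > 0" "\<And>x. x \<in> ?B \<Longrightarrow> norm (F x) \<le> N" by (auto simp: bounded_pos)
  define G where "G x = F (closest_point ?B x)" for x
  have cp: "closest_point ?B x \<in> ?B" for x using closest_point_in_set[OF B(3,4)] .
  have lip: "norm (G x - G y) \<le> K * norm (x - y)" for x y
  proof -
    have "norm (G x - G y) \<le> K * norm (closest_point ?B x - closest_point ?B y)" unfolding G_def by (rule K(2)[OF cp cp])
    also have "\<dots> \<le> K * norm (x - y)"
      using closest_point_lipschitz[OF B(2-4), of x y] K(1) by (intro mult_left_mono) (auto simp: dist_norm)
    finally show ?thesis .
  qed
  have bd: "norm (G x) \<le> N" for x unfolding G_def by (rule N(2)[OF cp])
  \<comment> \<open>The first bound yields the contraction factor \<open>1/2\<close>, the second keeps the solution in the ball.\<close>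
  define \<epsilon> where "\<epsilon> = min (1 / (2 * K)) (r / N)"
  have e: "\<epsilon> > 0" "\<epsilon> * K \<le> 1 / 2" "\<epsilon> * N \<le> r"
  proof -
    show "\<epsilon> > 0" using K N r by (simp add: \<epsilon>_def)
    have "\<epsilon> * K \<le> 1 / (2 * K) * K" using K by (intro mult_right_mono) (auto simp: \<epsilon>_def)
    then show "\<epsilon> * K \<le> 1 / 2" using K by simp
    have "\<epsilon> * N \<le> r / N * N" using N by (intro mult_right_mono) (auto simp: \<epsilon>_def)
    then show "\<epsilon> * N \<le> r" using N by simp
  qed
  obtain z where z: "z 0 = z0" "\<And>t. \<bar>t\<bar> < \<epsilon> \<Longrightarrow> (z has_vector_derivative G (z t)) (at t)"
    "\<And>t. \<bar>t\<bar> < \<epsilon> \<Longrightarrow> norm (z t - z0) \<le> \<epsilon> * N"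
    using picard_lindelof_bounded_lipschitz[OF lip bd e(1,2)] by metis
  let ?J = "{-\<epsilon><..<\<epsilon>}"
  have zB: "z t \<in> ?B" if "t \<in> ?J" for t
  proof -
    have "\<bar>t\<bar> < \<epsilon>" using that by auto
    from z(3)[OF this] e(3) show ?thesis by (simp add: dist_norm norm_minus_commute)
  qed
  have der: "(z has_vector_derivative F (z t)) (at t)" if "t \<in> ?J" for t
    using z(2)[of t] that closest_point_self[OF zB[OF that]] by (auto simp: G_def)
  have "C_k_on k ?J z" for k
  proof (induction k)
    case 0
    have "isCont z t" if "t \<in> ?J" for t using der[OF that] by (rule has_vector_derivative_continuous)
    then show ?case by (simp add: continuous_at_imp_continuous_on)
  next
    case (Suc k)
    have Fz: "C_k_on k ?J (\<lambda>t. F (z t))"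
      by (rule C_k_on_compose[OF _ Suc]) (use U(2) zB r(2) in \<open>auto simp: smooth_on_def\<close>)
    show ?case unfolding C_k_on.simps
    proof (intro exI[of _ "\<lambda>t h. h *\<^sub>R F (z t)"] conjI ballI allI)
      show "(z has_derivative (\<lambda>h. h *\<^sub>R F (z t))) (at t within ?J)" if "t \<in> ?J" for t
        using der[OF that] by (simp add: has_vector_derivative_def has_derivative_at_withinI)
      show "C_k_on k ?J (\<lambda>t. u *\<^sub>R F (z t))" for u by (rule C_k_on_scaleR[OF C_k_on_const Fz])
    qed
  qed
  then have "smooth_on ?J z" by (simp add: smooth_on_def)
  moreover have "z t \<in> U" if "t \<in> ?J" for t using zB[OF that] r(2) by blast
  ultimately show ?thesis using that[of \<epsilon> z] e(1) z(1) der by blast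
qed

text \<open>The right-hand side is only given on a subspace.  It is composed with a linear projection to obtain
  a first-order system on an open set of pairs, whose solutions starting in the subspace stay in it.\<close>

theorem smooth_second_order_solution:
  fixes f :: "'a::euclidean_space \<Rightarrow> 'a \<Rightarrow> 'a"
  assumes U: "subspace_open E U" and f: "smooth_on (U \<times> E) (\<lambda>z. f (fst z) (snd z))" "\<And>x v. x \<in> U \<Longrightarrow> v \<in> E \<Longrightarrow> f x v \<in> E"
    and x0: "x0 \<in> U" "v0 \<in> E"
  obtains x v \<epsilon> where "\<epsilon> > 0" "x 0 = x0" "v 0 = v0" "smooth_on {-\<epsilon><..<\<epsilon>} x"
    "\<And>t. t \<in> {-\<epsilon><..<\<epsilon>} \<Longrightarrow> x t \<in> U \<and> v t \<in> E"
    "\<And>t. t \<in> {-\<epsilon><..<\<epsilon>} \<Longrightarrow> (x has_vector_derivative v t) (at t)"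
    "\<And>t. t \<in> {-\<epsilon><..<\<epsilon>} \<Longrightarrow> (v has_vector_derivative f (x t) (v t)) (at t)"
proof -
  have E: "subspace E" using U by (simp add: subspace_open_def)
  obtain \<pi> where \<pi>: "bounded_linear \<pi>" "\<And>x. \<pi> x \<in> E" "\<And>x. x \<in> E \<Longrightarrow> \<pi> x = x"
    using ex_linear_projection[OF E] by blast
  obtain T where T: "open T" "U = E \<inter> T" using U unfolding subspace_open_def openin_open by blast
  define W where "W = {z::'a \<times> 'a. \<pi> (fst z) \<in> T}"
  have "W = (\<lambda>z. \<pi> (fst z)) -` T" by (auto simp: W_def)
  moreover have "continuous_on UNIV (\<lambda>z::'a \<times> 'a. \<pi> (fst z))"
    by (intro bounded_linear.continuous_on[OF \<pi>(1)] continuous_intros)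
  ultimately have W: "open W" using open_vimage[OF T(1)] by simp
  define \<Phi> where "\<Phi> z = (\<pi> (snd z), f (\<pi> (fst z)) (\<pi> (snd z)))" for z
  have sp: "smooth_on W (\<lambda>z. \<pi> (fst z))" "smooth_on W (\<lambda>z. \<pi> (snd z))"
    by (intro smooth_on_linear_comp[OF \<pi>(1)] smooth_on_bounded_linear bounded_linear_fst bounded_linear_snd)+
  have "smooth_on W (\<lambda>z. f (fst (\<pi> (fst z), \<pi> (snd z))) (snd (\<pi> (fst z), \<pi> (snd z))))"
    by (rule smooth_on_compose[OF f(1) smooth_on_Pair[OF sp]]) (use \<pi>(2) T in \<open>auto simp: W_def\<close>)
  then have "smooth_on W \<Phi>" unfolding \<Phi>_def using smooth_on_Pair[OF sp(2)] by simp
  moreover have "(x0, v0) \<in> W" using x0 T \<pi>(3) by (simp add: W_def)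
  ultimately obtain z \<epsilon> where z: "\<epsilon> > 0" "z 0 = (x0, v0)" "smooth_on {-\<epsilon><..<\<epsilon>} z"
    "\<And>t. t \<in> {-\<epsilon><..<\<epsilon>} \<Longrightarrow> z t \<in> W" "\<And>t. t \<in> {-\<epsilon><..<\<epsilon>} \<Longrightarrow> (z has_vector_derivative \<Phi> (z t)) (at t)"
    using smooth_ode_solution[OF W] by metis
  let ?J = "{-\<epsilon><..<\<epsilon>}"
  let ?x = "\<lambda>t. fst (z t)" and ?v = "\<lambda>t. snd (z t)"
  have zero: "0 \<in> ?J" using z(1) by simp
  have dx: "(?x has_vector_derivative \<pi> (?v t)) (at t)" if "t \<in> ?J" for t
    using bounded_linear.has_vector_derivative[OF bounded_linear_fst z(5)[OF that]] by (simp add: \<Phi>_def)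
  have dv: "(?v has_vector_derivative f (\<pi> (?x t)) (\<pi> (?v t))) (at t)" if "t \<in> ?J" for t
    using bounded_linear.has_vector_derivative[OF bounded_linear_snd z(5)[OF that]] by (simp add: \<Phi>_def)
  \<comment> \<open>A curve that starts in the subspace and whose velocity stays in it does not leave it.\<close>
  have stay: "\<gamma> t \<in> E" if \<gamma>: "\<gamma> 0 \<in> E" "\<And>t. t \<in> ?J \<Longrightarrow> (\<gamma> has_vector_derivative a t) (at t)" "\<And>t. t \<in> ?J \<Longrightarrow> a t \<in> E"
    and t: "t \<in> ?J" for \<gamma> a t
  proof -
    have "((\<lambda>t. \<gamma> t - \<pi> (\<gamma> t)) has_vector_derivative 0) (at s within ?J)" if s: "s \<in> ?J" for s
    proof -
      have "((\<lambda>t. \<gamma> t - \<pi> (\<gamma> t)) has_vector_derivative (a s - \<pi> (a s))) (at s within ?J)"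
        using has_vector_derivative_at_within[OF \<gamma>(2)[OF s]]
        by (intro has_vector_derivative_diff bounded_linear.has_vector_derivative[OF \<pi>(1)])
      then show ?thesis using \<pi>(3)[OF \<gamma>(3)[OF s]] by simp
    qed
    then obtain c where c: "\<And>s. s \<in> ?J \<Longrightarrow> \<gamma> s - \<pi> (\<gamma> s) = c"
      using has_vector_derivative_zero_constant[of ?J "\<lambda>t. \<gamma> t - \<pi> (\<gamma> t)"] by auto
    have "\<gamma> t - \<pi> (\<gamma> t) = \<gamma> 0 - \<pi> (\<gamma> 0)" using c[OF zero] c[OF t] by simp
    then have "\<gamma> t - \<pi> (\<gamma> t) = 0" using \<pi>(3)[OF \<gamma>(1)] by simp
    then show ?thesis using \<pi>(2)[of "\<gamma> t"] by simp
  qed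
  have xU: "\<pi> (?x t) \<in> U" if "t \<in> ?J" for t using z(4)[OF that] \<pi>(2) T by (simp add: W_def)
  have xE: "?x t \<in> E" if t: "t \<in> ?J" for t
    by (rule stay[OF _ dx \<pi>(2) t]) (use z(2) x0 U in \<open>auto dest: subspace_open_subset\<close>)
  have vE: "?v t \<in> E" if t: "t \<in> ?J" for t
    by (rule stay[OF _ dv _ t]) (use z(2) x0 f(2) xU \<pi>(2) in auto)
  show ?thesis
  proof (rule that[of \<epsilon> ?x ?v])
    show "smooth_on ?J ?x" by (rule smooth_on_linear_comp[OF bounded_linear_fst z(3)])
    fix t assume t: "t \<in> ?J"
    show "?x t \<in> U \<and> ?v t \<in> E" using xU[OF t] \<pi>(3)[OF xE[OF t]] vE[OF t] by simp
    show "(?x has_vector_derivative ?v t) (at t)" using dx[OF t] \<pi>(3)[OF vE[OF t]] by simp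
    show "(?v has_vector_derivative f (?x t) (?v t)) (at t)" using dv[OF t] \<pi>(3)[OF vE[OF t]] \<pi>(3)[OF xE[OF t]] by simp
  qed (use z in auto)
qed

section \<open>Lagrangian structures of the constrained dynamics\<close>

lemma polarization:
  fixes \<Gamma> :: "'a::real_vector \<Rightarrow> 'a \<Rightarrow> 'b::real_vector"
  assumes E: "subspace E" and sym: "\<And>u w. u \<in> E \<Longrightarrow> w \<in> E \<Longrightarrow> \<Gamma> u w = \<Gamma> w u"
    and lin: "\<And>u w z a b. u \<in> E \<Longrightarrow> w \<in> E \<Longrightarrow> z \<in> E \<Longrightarrow> \<Gamma> u (a *\<^sub>R w + b *\<^sub>R z) = a *\<^sub>R \<Gamma> u w + b *\<^sub>R \<Gamma> u z"
    and uw: "u \<in> E" "w \<in> E"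
  shows "\<Gamma> (u + w) (u + w) = \<Gamma> u u + 2 *\<^sub>R \<Gamma> u w + \<Gamma> w w"
proof -
  have m: "u + w \<in> E" by (rule subspace_add[OF E uw])
  have "\<Gamma> (u + w) (u + w) = \<Gamma> (u + w) u + \<Gamma> (u + w) w" using lin[OF m uw, of 1 1] by simp
  also have "\<dots> = \<Gamma> u (u + w) + \<Gamma> w (u + w)" using sym[OF m] uw by simp
  also have "\<dots> = (\<Gamma> u u + \<Gamma> u w) + (\<Gamma> w u + \<Gamma> w w)"
    using lin[OF uw(1) uw, of 1 1] lin[OF uw(2) uw, of 1 1] by simp
  finally show ?thesis using sym[OF uw] by (simp add: scaleR_2)
qed

context atlas
begin

text \<open>The operators may differ on arguments that are not smooth fields and tangent vectors; the conditions
  on a connection do not look at such arguments.\<close>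

lemma levi_civita_cong:
  assumes D1: "levi_civita M A g D1"
    and eq: "\<And>W Y p v. openin (top_of_set M) W \<Longrightarrow> smooth_vector_field A W Y \<Longrightarrow> p \<in> W \<Longrightarrow> v \<in> tangent_space A p
      \<Longrightarrow> D2 p v Y = D1 p v Y"
  shows "levi_civita M A g D2"
proof -
  have aff: "affine_connection M A D1" and tor: "torsion_free M A D1" and met: "metric_compatible M A g D1"
    using D1 by (simp_all add: levi_civita_def)
  have "affine_connection M A D2"
    unfolding affine_connection_def
  proof (intro allI impI conjI ballI; elim conjE)
    fix W Y p v assume W: "openin (top_of_set M) W" "smooth_vector_field A W Y" "p \<in> W" "v \<in> tangent_space A p"
    note e = eq[OF W(1) _ W(3)]
    show "D2 p v Y \<in> tangent_space A p" using affine_tangent[OF aff W] e[OF W(2,4)] by simp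
    show "D2 p (a *\<^sub>R v + b *\<^sub>R w) Y = a *\<^sub>R D2 p v Y + b *\<^sub>R D2 p w Y" if w: "w \<in> tangent_space A p" for w a b
      using affine_left_lin[OF aff W w, of a b] e[OF W(2,4)] e[OF W(2) w] e[OF W(2) tangent_lin[OF W(4) w]] by simp
    show "D2 p v (\<lambda>x. Y x + Z x) = D2 p v Y + D2 p v Z" if Z: "smooth_vector_field A W Z" for Z
      using affine_add[OF aff W Z] e[OF W(2,4)] e[OF Z W(4)] e[OF smooth_field_add[OF W(2) Z] W(4)] by simp
    show "D2 p v Y = D2 p v Z" if Z: "smooth_vector_field A W Z" "\<forall>x\<in>W. Y x = Z x" for Z
      using affine_cong[OF aff W Z(1)] Z(2) e[OF W(2,4)] e[OF Z(1) W(4)] by simp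
    show "D2 p v (\<lambda>x. f x *\<^sub>R Y x) = dfun A f p v *\<^sub>R Y p + f p *\<^sub>R D2 p v Y" if f: "smooth_fun A W f" for f
      using affine_leibniz[OF aff W f] e[OF W(2,4)] e[OF smooth_field_scale[OF W(2) f] W(4)] by simp
  next
    fix W Y X assume W: "openin (top_of_set M) W" "smooth_vector_field A W Y" and X: "smooth_vector_field A W X"
    have "smooth_vector_field A W (\<lambda>p. D1 p (X p) Y)"
      by (rule aff[unfolded affine_connection_def, THEN spec, THEN spec, THEN mp, OF conjI[OF W],
        THEN conjunct2, THEN spec, THEN mp, OF X])
    then show "smooth_vector_field A W (\<lambda>p. D2 p (X p) Y)"
      by (rule smooth_field_cong) (use eq[OF W _ smooth_field_tangent[OF X]] in simp)
  qed
  moreover have "torsion_free M A D2"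
    unfolding torsion_free_def
  proof (intro allI impI ballI; elim conjE)
    fix W X Y p assume W: "openin (top_of_set M) W" "smooth_vector_field A W X" "smooth_vector_field A W Y" "p \<in> W"
    show "D2 p (X p) Y - D2 p (Y p) X = lie_bracket A X Y p"
      using tor[unfolded torsion_free_def, rule_format, OF conjI[OF W(1) conjI[OF W(2,3)]] W(4)]
        eq[OF W(1,3,4) smooth_field_tangent[OF W(2,4)]] eq[OF W(1,2,4) smooth_field_tangent[OF W(3,4)]] by simp
  qed
  moreover have "metric_compatible M A g D2"
    unfolding metric_compatible_def
  proof (intro allI impI ballI; elim conjE)
    fix W Y Z p v assume W: "openin (top_of_set M) W" "smooth_vector_field A W Y" "smooth_vector_field A W Z" "p \<in> W" "v \<in> tangent_space A p"
    show "dfun A (\<lambda>x. g x (Y x) (Z x)) p v = g p (D2 p v Y) (Z p) + g p (Y p) (D2 p v Z)"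
      using met[unfolded metric_compatible_def, rule_format, OF conjI[OF W(1) conjI[OF W(2,3)]] W(4,5)]
        eq[OF W(1,2,4,5)] eq[OF W(1,3,4,5)] by simp
  qed
  ultimately show ?thesis by (simp add: levi_civita_def)
qed

lemma levi_civita_empty:
  assumes "M = {}"
  shows "levi_civita M A g D"
proof -
  have "smooth_on {} f" for f :: "'e \<Rightarrow> 'e"
    by (rule smooth_on_cong[OF _ smooth_on_const[of "{}" 0]]) simp
  then have "smooth_vector_field A {} X" for X
    by (simp add: smooth_vector_field_def)
  then show ?thesis
    using assms by (auto simp: levi_civita_def affine_connection_def torsion_free_def metric_compatible_def)
qed

end

context vhc
begin

text \<open>Smoothness of the Christoffel symbols is known for fixed arguments; expanding the moving argument in
  a basis gives it for the quadratic term of the equation of motion.\<close>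

lemma smooth_induced_quadratic:
  assumes c': "c' \<in> AC"
  shows "smooth_on (chart_map c' ` chart_dom c' \<times> model c')
    (\<lambda>z. christoffel AC DC c' (chart_inv c' (fst z)) (snd z) (snd z))"
proof -
  obtain \<pi> where \<pi>: "bounded_linear \<pi>" "\<And>x. \<pi> x \<in> model c'" "\<And>x. x \<in> model c' \<Longrightarrow> \<pi> x = x"
    using ex_linear_projection[OF subspace_model] by blast
  interpret \<pi>: bounded_linear \<pi> by (rule \<pi>(1))
  let ?\<Gamma> = "\<lambda>x. christoffel AC DC c' (chart_inv c' x)"
  let ?U = "chart_map c' ` chart_dom c'"
  have expand: "?\<Gamma> x v v = (\<Sum>a\<in>Basis. \<Sum>b\<in>Basis. ((v \<bullet> a) * (v \<bullet> b)) *\<^sub>R ?\<Gamma> x (\<pi> a) (\<pi> b))"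
    if x: "x \<in> ?U" and v: "v \<in> model c'" for x v
  proof -
    have p: "chart_inv c' x \<in> chart_dom c'" using x slice_inv[OF c'] by auto
    have right: "?\<Gamma> x u w = (\<Sum>b\<in>Basis. (w \<bullet> b) *\<^sub>R ?\<Gamma> x u (\<pi> b))" if u: "u \<in> model c'" and w: "w \<in> model c'" for u w
    proof -
      note lin = induced_christoffel_lin_right[OF c' p u \<pi>(2) \<pi>(2)]
      have "linear (\<lambda>w. ?\<Gamma> x u (\<pi> w))"
      proof
        show "?\<Gamma> x u (\<pi> (y + z)) = ?\<Gamma> x u (\<pi> y) + ?\<Gamma> x u (\<pi> z)" for y z
          using lin[of 1 y 1 z] by (simp add: \<pi>.add)
        show "?\<Gamma> x u (\<pi> (r *\<^sub>R y)) = r *\<^sub>R ?\<Gamma> x u (\<pi> y)" for r y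
          using lin[of r y 0 y] by (simp add: \<pi>.scaleR)
      qed
      from linear_basis_expansion[OF this, of w] show ?thesis using \<pi>(3)[OF w] by simp
    qed
    have "?\<Gamma> x v v = (\<Sum>a\<in>Basis. (v \<bullet> a) *\<^sub>R ?\<Gamma> x (\<pi> a) v)"
      using right[OF v v] induced_christoffel_sym[OF c' p v \<pi>(2)] by simp
    also have "\<dots> = (\<Sum>a\<in>Basis. (v \<bullet> a) *\<^sub>R (\<Sum>b\<in>Basis. (v \<bullet> b) *\<^sub>R ?\<Gamma> x (\<pi> a) (\<pi> b)))"
      using right[OF \<pi>(2) v] by simp
    finally show ?thesis by (simp add: scaleR_sum_right)
  qed
  have g1: "smooth_on (?U \<times> model c') (\<lambda>z. ?\<Gamma> (fst z) (\<pi> a) (\<pi> b))" for a b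
    by (rule smooth_on_compose[OF smooth_induced_christoffel[OF c' \<pi>(2) \<pi>(2)] smooth_on_bounded_linear[OF bounded_linear_fst]]) auto
  have g2: "smooth_on (?U \<times> model c') (\<lambda>z. snd z \<bullet> b)" for b
    by (rule smooth_on_inner_const[OF smooth_on_bounded_linear[OF bounded_linear_snd]])
  have "smooth_on (?U \<times> model c') (\<lambda>z. \<Sum>a\<in>Basis. \<Sum>b\<in>Basis. ((snd z \<bullet> a) * (snd z \<bullet> b)) *\<^sub>R ?\<Gamma> (fst z) (\<pi> a) (\<pi> b))"
    by (intro smooth_on_sum smooth_on_scaleR smooth_on_mult g1 g2)
  then show ?thesis by (rule smooth_on_cong[rotated]) (use expand in auto)
qed

theorem constrained_dynamics_solution:
  assumes c': "c' \<in> AC" "p \<in> chart_dom c'" and u: "u \<in> model c'"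
  obtains I q where "open_interval I" "0 \<in> I" "smooth_curve C AC I q" "q 0 = p" "velocity AC q 0 c' = u"
    "satisfies_constrained_dynamics Q A g D P m F C I q"
proof -
  let ?U = "chart_map c' ` chart_dom c'"
  let ?\<sigma> = "\<lambda>p. sigma A g m F C p (grad A g P p)"
  have \<sigma>T: "?\<sigma> p \<in> tangent_space AC p" if "p \<in> C" for p
    using sigma_tangent[OF that grad_tangent[OF C_subset[OF that]]] .
  define f where "f x v = - christoffel AC DC c' (chart_inv c' x) v v + - ?\<sigma> (chart_inv c' x) c'" for x v
  have fs: "smooth_on (?U \<times> model c') (\<lambda>z. f (fst z) (snd z))"
    unfolding f_def
    by (intro smooth_on_add smooth_on_minus smooth_induced_quadratic[OF c'(1)]
        smooth_on_compose[OF smooth_sigma_grad[OF c'(1)] smooth_on_bounded_linear[OF bounded_linear_fst]]) auto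
  have fm: "f x v \<in> model c'" if x: "x \<in> ?U" and v: "v \<in> model c'" for x v
  proof -
    have s: "chart_inv c' x \<in> chart_dom c'" using x slice_inv[OF c'(1)] by auto
    have "christoffel AC DC c' (chart_inv c' x) v v \<in> model c'"
      unfolding christoffel_def
      by (rule S.tangent_in_model[OF induced_connection_chart(1)[OF S.dom_openin[OF c'(1)] S.smooth_coord_field[OF c'(1) v] s
          S.coord_field_tangent[OF c'(1) s v]] c'(1) s])
    then show ?thesis
      unfolding f_def
      by (intro subspace_add subspace_neg subspace_model S.tangent_in_model[OF \<sigma>T[OF in_dom_C[OF c'(1) s]] c'(1) s])
  qed
  have px: "chart_map c' p \<in> ?U" using c' by blast
  obtain x v \<epsilon> where sol: "\<epsilon> > 0" "x 0 = chart_map c' p" "v 0 = u" "smooth_on {-\<epsilon><..<\<epsilon>} x"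
    "\<And>t. t \<in> {-\<epsilon><..<\<epsilon>} \<Longrightarrow> x t \<in> ?U \<and> v t \<in> model c'"
    "\<And>t. t \<in> {-\<epsilon><..<\<epsilon>} \<Longrightarrow> (x has_vector_derivative v t) (at t)"
    "\<And>t. t \<in> {-\<epsilon><..<\<epsilon>} \<Longrightarrow> (v has_vector_derivative f (x t) (v t)) (at t)"
    by (rule smooth_second_order_solution[OF S.image_dom_subspace_open[OF c'(1)] fs _ px u]) (rule fm, assumption+, rule that)
  let ?J = "{-\<epsilon><..<\<epsilon>}"
  define q where "q t = chart_inv c' (x t)" for t
  have zero: "0 \<in> ?J" using sol(1) by simp
  have J: "open_interval ?J" using sol(1) zero by (auto simp: open_interval_def is_interval_oo)
  have q: "q t \<in> chart_dom c'" "chart_map c' (q t) = x t" if "t \<in> ?J" for t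
  proof -
    obtain s where "s \<in> chart_dom c'" "x t = chart_map c' s" using sol(5)[OF \<open>t \<in> ?J\<close>] by blast
    then show "q t \<in> chart_dom c'" "chart_map c' (q t) = x t" using slice_inv[OF c'(1)] by (auto simp: q_def)
  qed
  have curve: "smooth_curve C AC ?J q"
    unfolding q_def by (rule S.smooth_curve_from_chart[OF c'(1) _ sol(4)]) (use sol(5) in auto)
  have vel: "vector_derivative (\<lambda>s. chart_map c' (q s)) (at t) = v t" if t: "t \<in> ?J" for t
    by (rule vector_derivative_at[OF has_vector_derivative_transform_within_open[OF sol(6)[OF t] open_greaterThanLessThan t]])
      (use q in auto)
  have acc: "vector_derivative (\<lambda>s. vector_derivative (\<lambda>s. chart_map c' (q s)) (at s)) (at t) = f (x t) (v t)" if t: "t \<in> ?J" for t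
    by (rule vector_derivative_at[OF has_vector_derivative_transform_within_open[OF sol(7)[OF t] open_greaterThanLessThan t]])
      (use vel in auto)
  have "covariant_acceleration AC DC q t = - ?\<sigma> (q t)" if t: "t \<in> ?J" for t
  proof (rule S.tangent_eqI[OF _ _ c'(1) q(1)[OF t]])
    show "covariant_acceleration AC DC q t \<in> tangent_space AC (q t)"
      by (rule S.covariant_acceleration_tangent[OF induced_has_christoffel_form open_greaterThanLessThan curve t])
    show "- ?\<sigma> (q t) \<in> tangent_space AC (q t)"
      by (rule S.tangent_neg[OF \<sigma>T[OF in_dom_C[OF c'(1) q(1)[OF t]]]])
    have "f (x t) (v t) = - christoffel AC DC c' (q t) (v t) (v t) + - ?\<sigma> (q t) c'"
      by (simp only: f_def q_def)
    then show "covariant_acceleration AC DC q t c' = (- ?\<sigma> (q t)) c'"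
      using S.covariant_acceleration_at[OF open_greaterThanLessThan curve t c'(1) q(1)[OF t], of DC] acc[OF t]
        S.velocity_at[of c' q t, OF c'(1) q(1)[OF t]] vel[OF t]
      by simp
  qed
  then have "satisfies_constrained_dynamics Q A g D P m F C ?J q"
    by (simp add: satisfies_constrained_dynamics_def)
  moreover have "q 0 = p" using slice_inv[OF c'] sol(2) by (simp add: q_def)
  moreover have "velocity AC q 0 c' = u" using S.velocity_at[of c' q 0, OF c'(1) q(1)[OF zero]] vel[OF zero] sol(3) by simp
  ultimately show ?thesis using that J zero curve by blast
qed

text \<open>The Levi-Civita connection that witnesses a base integral curve need not be the induced one, but it
  has the same Christoffel symbols and hence the same covariant acceleration.\<close>

lemma induced_levi_civita_imp_lagrangian_structure:
  assumes gC: "riemannian_metric C AC gC" "levi_civita C AC gC DC" and PC: "smooth_fun AC C PC"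
    and grad: "\<And>q. q \<in> C \<Longrightarrow> sigma A g m F C q (grad A g P q) = grad AC gC PC q"
  shows "lagrangian_structure Q A g D P m F C gC PC"
  unfolding lagrangian_structure_def
proof (intro conjI allI impI gC PC; elim conjE)
  fix I q assume I: "open_interval I" and q: "smooth_curve C AC I q"
  have oI: "open I" using I by (simp add: open_interval_def)
  have qC: "q t \<in> C" if "t \<in> I" for t using q that by (auto simp: smooth_curve_def)
  show "satisfies_constrained_dynamics Q A g D P m F C I q = base_integral_curve C AC gC PC I q"
  proof
    assume "satisfies_constrained_dynamics Q A g D P m F C I q"
    then show "base_integral_curve C AC gC PC I q"
      using gC(2) q grad qC by (auto simp: satisfies_constrained_dynamics_def base_integral_curve_def)
  next
    assume "base_integral_curve C AC gC PC I q"
    then obtain D' where D': "levi_civita C AC gC D'" "\<And>t. t \<in> I \<Longrightarrow> covariant_acceleration AC D' q t = - grad AC gC PC (q t)"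
      by (auto simp: base_integral_curve_def)
    have "covariant_acceleration AC DC q t = covariant_acceleration AC D' q t" if t: "t \<in> I" for t
    proof
      fix c
      show "covariant_acceleration AC DC q t c = covariant_acceleration AC D' q t c"
      proof (cases "c \<in> AC \<and> q t \<in> chart_dom c")
        case True
        then have c: "c \<in> AC" "q t \<in> chart_dom c" by auto
        note v = S.tangent_in_model[OF S.velocity_tangent[OF oI q t] c]
        show ?thesis
          unfolding S.covariant_acceleration_at[OF oI q t c]
          by (simp add: S.levi_civita_christoffel_unique[OF gC(1,2) D'(1) c v v])
      next
        case False then show ?thesis by (auto simp: covariant_acceleration_def)
      qed
    qed
    then show "satisfies_constrained_dynamics Q A g D P m F C I q"
      using D'(2) grad qC by (simp add: satisfies_constrained_dynamics_def)
  qed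
qed

text \<open>The solution of the constrained equation through \<open>p\<close> with velocity \<open>u\<close> is also a base integral
  curve, so its second derivative at \<open>p\<close> is given by both equations.  The curve also supplies a
  Levi-Civita connection of \<open>gC\<close>.\<close>

lemma lagrangian_structure_at:
  assumes L: "lagrangian_structure Q A g D P m F C gC PC"
    and c': "c' \<in> AC" "p \<in> chart_dom c'" and u: "u \<in> model c'"
  obtains D' where "levi_civita C AC gC D'" "grad AC gC PC p \<in> tangent_space AC p"
    "christoffel AC DC c' p u u + sigma A g m F C p (grad A g P p) c' = christoffel AC D' c' p u u + grad AC gC PC p c'"
proof -
  obtain I q where q: "open_interval I" "0 \<in> I" "smooth_curve C AC I q" "q 0 = p" "velocity AC q 0 c' = u"
    "satisfies_constrained_dynamics Q A g D P m F C I q"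
    by (rule constrained_dynamics_solution[OF c' u])
  have oI: "open I" using q(1) by (simp add: open_interval_def)
  have "base_integral_curve C AC gC PC I q"
    using L q unfolding lagrangian_structure_def by blast
  then obtain D' where D': "levi_civita C AC gC D'" "covariant_acceleration AC D' q 0 = - grad AC gC PC p"
    using q(2,4) by (auto simp: base_integral_curve_def)
  have DC: "covariant_acceleration AC DC q 0 = - sigma A g m F C p (grad A g P p)"
    using q(2,4,6) by (auto simp: satisfies_constrained_dynamics_def)
  have p: "q 0 \<in> chart_dom c'" using q(4) c' by simp
  note at = S.covariant_acceleration_at[OF oI q(3,2) c'(1) p, unfolded q(4,5)]
  have "affine_connection C AC D'" using D'(1) by (simp add: levi_civita_def)
  then have "- grad AC gC PC p \<in> tangent_space AC p"
    using S.covariant_acceleration_tangent[OF S.affine_has_christoffel_form oI q(3,2), of D'] D'(2) q(4) by simp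
  then have "grad AC gC PC p \<in> tangent_space AC p" using S.tangent_neg by fastforce
  moreover have "christoffel AC DC c' p u u + sigma A g m F C p (grad A g P p) c' = christoffel AC D' c' p u u + grad AC gC PC p c'"
  proof -
    have "christoffel AC DC c' p u u + sigma A g m F C p (grad A g P p) c' = - S.accel q c' 0"
      using at[of DC] unfolding DC by (simp add: eq_neg_iff_add_eq_0 neg_eq_iff_add_eq_0 ac_simps)
    moreover have "christoffel AC D' c' p u u + grad AC gC PC p c' = - S.accel q c' 0"
      using at[of D'] unfolding D'(2) by (simp add: eq_neg_iff_add_eq_0 neg_eq_iff_add_eq_0 ac_simps)
    ultimately show ?thesis by simp
  qed
  ultimately show ?thesis using that D'(1) by blast
qed

lemma lagrangian_structure_imp:
  assumes L: "lagrangian_structure Q A g D P m F C gC PC"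
  shows "levi_civita C AC gC DC"
    and "p \<in> C \<Longrightarrow> sigma A g m F C p (grad A g P p) = grad AC gC PC p"
proof -
  have gC: "riemannian_metric C AC gC" using L by (simp add: lagrangian_structure_def)
  have zero: "\<Gamma> c' p 0 0 = (0::'e)" if "\<And>a b. \<Gamma> c' p 0 (a *\<^sub>R 0 + b *\<^sub>R 0) = a *\<^sub>R \<Gamma> c' p 0 0 + b *\<^sub>R \<Gamma> c' p 0 0"
    for \<Gamma> :: "('q, 'e) chart \<Rightarrow> 'q \<Rightarrow> 'e \<Rightarrow> 'e \<Rightarrow> 'e" and c' p
    using that[of 0 0] by simp
  have comp: "sigma A g m F C p (grad A g P p) c' = grad AC gC PC p c'" and
    gT: "grad AC gC PC p \<in> tangent_space AC p" if c': "c' \<in> AC" "p \<in> chart_dom c'" for p c'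
  proof -
    have 0: "0 \<in> model c'" by (rule subspace_0[OF subspace_model])
    obtain D' where D': "levi_civita C AC gC D'" "grad AC gC PC p \<in> tangent_space AC p"
      "christoffel AC DC c' p 0 0 + sigma A g m F C p (grad A g P p) c' = christoffel AC D' c' p 0 0 + grad AC gC PC p c'"
      by (rule lagrangian_structure_at[OF L c' 0])
    have aff: "affine_connection C AC D'" using D'(1) by (simp add: levi_civita_def)
    show "sigma A g m F C p (grad A g P p) c' = grad AC gC PC p c'"
      using D'(3) zero[of "christoffel AC DC", OF induced_christoffel_lin_right[OF c' 0 0 0]]
        zero[of "christoffel AC D'", OF S.affine_christoffel_lin_right[OF aff c' 0 0 0]] by simp
    show "grad AC gC PC p \<in> tangent_space AC p" by (rule D'(2))
  qed
  show "sigma A g m F C p (grad A g P p) = grad AC gC PC p" if p: "p \<in> C" for p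
  proof -
    obtain c' where c': "c' \<in> AC" "p \<in> chart_dom c'" using S.ex_chart[OF p] by blast
    show ?thesis
      by (rule S.tangent_eqI[OF sigma_tangent[OF p grad_tangent[OF C_subset[OF p]]] gT[OF c'] c' comp[OF c']])
  qed
  \<comment> \<open>Through a point of \<open>C\<close> there is a curve that provides a Levi-Civita connection \<open>D0\<close>; if \<open>C\<close> is empty
    there is none, but then the claim is void.\<close>
  show "levi_civita C AC gC DC"
  proof (cases "C = {}")
    case True then show ?thesis by (rule S.levi_civita_empty)
  next
    case False
    then obtain p0 c0 where c0: "c0 \<in> AC" "p0 \<in> chart_dom c0" using S.ex_chart by blast
    obtain D0 where D0: "levi_civita C AC gC D0"
      by (rule lagrangian_structure_at[OF L c0 subspace_0[OF subspace_model]])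
    have aff: "affine_connection C AC D0" and tor: "torsion_free C AC D0" using D0 by (simp_all add: levi_civita_def)
    have quad: "christoffel AC DC c' p u u = christoffel AC D0 c' p u u"
      if c': "c' \<in> AC" "p \<in> chart_dom c'" and u: "u \<in> model c'" for c' p u
    proof -
      obtain D' where D': "levi_civita C AC gC D'"
        "christoffel AC DC c' p u u + sigma A g m F C p (grad A g P p) c' = christoffel AC D' c' p u u + grad AC gC PC p c'"
        by (rule lagrangian_structure_at[OF L c' u])
      then show ?thesis
        using comp[OF c'] S.levi_civita_christoffel_unique[OF gC D'(1) D0 c' u u] by simp
    qed
    have chr: "christoffel AC DC c' p u w = christoffel AC D0 c' p u w"
      if c': "c' \<in> AC" "p \<in> chart_dom c'" and u: "u \<in> model c'" and w: "w \<in> model c'" for c' p u w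
    proof -
      have m: "u + w \<in> model c'" by (rule subspace_add[OF subspace_model u w])
      have "christoffel AC DC c' p (u + w) (u + w)
          = christoffel AC DC c' p u u + 2 *\<^sub>R christoffel AC DC c' p u w + christoffel AC DC c' p w w"
        by (rule polarization[OF subspace_model induced_christoffel_sym[OF c'] induced_christoffel_lin_right[OF c'] u w])
      moreover have "christoffel AC D0 c' p (u + w) (u + w)
          = christoffel AC D0 c' p u u + 2 *\<^sub>R christoffel AC D0 c' p u w + christoffel AC D0 c' p w w"
        by (rule polarization[OF subspace_model S.torsion_free_christoffel_sym[OF tor c'] S.affine_christoffel_lin_right[OF aff c'] u w])
      ultimately show ?thesis using quad[OF c' u] quad[OF c' w] quad[OF c' m] by simp
    qed
    show ?thesis
    proof (rule S.levi_civita_cong[OF D0])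
      fix W Y p v assume *: "openin (top_of_set C) W" "smooth_vector_field AC W Y" "p \<in> W" "v \<in> tangent_space AC p"
      obtain c' where c': "c' \<in> AC" "p \<in> chart_dom c'"
        using S.ex_chart openin_imp_subset[OF *(1)] *(3) by blast
      note f1 = S.christoffel_formD[OF induced_has_christoffel_form *]
        and f2 = S.christoffel_formD[OF S.affine_has_christoffel_form[OF aff] *]
      show "DC p v Y = D0 p v Y"
      proof (rule S.tangent_eqI[OF f1(1) f2(1) c'])
        show "DC p v Y c' = D0 p v Y c'"
          unfolding f1(2)[OF c'] f2(2)[OF c']
          using chr[OF c' S.tangent_in_model[OF *(4) c'] S.tangent_in_model[OF S.smooth_field_tangent[OF *(2,3)] c']] by simp
      qed
    qed
  qed
qed

end

theorem theorem5p1: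
  fixes n m :: nat
    and Q C :: "'q::{t2_space, second_countable_topology} set"
    and A :: "('q, 'e::euclidean_space) chart set"
    and g :: "'q \<Rightarrow> ('q, 'e) tvec \<Rightarrow> ('q, 'e) tvec \<Rightarrow> real"
    and D :: "('q, 'e) conn"
    and P :: "'q \<Rightarrow> real"
    and F :: "nat \<Rightarrow> 'q \<Rightarrow> ('q, 'e) tvec \<Rightarrow> real"
  defines "AC \<equiv> submanifold_atlas A m C"
    and "DC \<equiv> induced_connection Q A g D m F C"
  assumes "lagrangian_control_system n Q A g D P m F"
    and "regular_VHC Q A g m F C"
  shows "((\<exists>gC PC. lagrangian_structure Q A g D P m F C gC PC) \<longleftrightarrow>
          (\<exists>gC. riemannian_metric C AC gC \<and> levi_civita C AC gC DC \<and>
             (\<exists>PC. smooth_fun AC C PC \<and>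
                (\<forall>q\<in>C. sigma A g m F C q (grad A g P q) = grad AC gC PC q))))
       \<and> (\<forall>gC PC. riemannian_metric C AC gC \<and> levi_civita C AC gC DC \<and> smooth_fun AC C PC \<and>
             (\<forall>q\<in>C. sigma A g m F C q (grad A g P q) = grad AC gC PC q) \<longrightarrow>
             lagrangian_structure Q A g D P m F C gC PC)"
proof -
  interpret vhc n m Q C A g D P F using assms(3,4) by unfold_locales
  have sufficient: "lagrangian_structure Q A g D P m F C gC PC"
    if "riemannian_metric C AC gC" "levi_civita C AC gC DC" "smooth_fun AC C PC"
      "\<forall>q\<in>C. sigma A g m F C q (grad A g P q) = grad AC gC PC q" for gC PC
    using induced_levi_civita_imp_lagrangian_structure[of gC PC] that unfolding AC_def DC_def by blast
  have necessary: "riemannian_metric C AC gC \<and> levi_civita C AC gC DC \<and> smooth_fun AC C PC \<and>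
      (\<forall>q\<in>C. sigma A g m F C q (grad A g P q) = grad AC gC PC q)"
    if L: "lagrangian_structure Q A g D P m F C gC PC" for gC PC
    using lagrangian_structure_imp[OF L] L unfolding AC_def DC_def lagrangian_structure_def by blast
  show ?thesis using sufficient necessary by blast
qed

end
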